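(* Let $\mathcal C$ and $\mathcal M$ be rigid semisimple tensor categories, and let $\Phi:\mathcal C\to\mathcal M$ be a tensor functor with right adjoint $\mathrm{Tr}_{\mathcal C}:\mathcal M\to\mathcal C$. If $A\in\mathcal M$ is a connected semisimple Frobenius algebra, then $\mathrm{Tr}_{\mathcal C}(A)$ is as well (i.e. the algebra $\mathrm{Tr}_{\mathcal C}(A)$ is connected and semisimple, and its algebra structure extends to a Frobenius algebra structure).
   Context: Categories and functors are linear over a field $k$, with finite-dimensional morphism spaces. Tensor functors are strong monoidal; coherence isomorphisms are suppressed. A tensor category is rigid if every object $a$ has a dual $a^*$ (with $\mathrm{ev}_a:a^*\otimes a\to1$, $\mathrm{coev}_a:1\to a\otimes a^*$ satisfying the zig-zag equations) and every object is isomorphic to the dual of some object. An algebra object is an associative unital triple $(A,m_A,i_A)$. It is semisimple if its category of (left) modules is semisimple, and connected if $\dim\mathrm{Hom}(1,A)=1$. A Frobenius algebra is $(A,m,\Delta,i,\epsilon)$ with $(A,m,i)$ an algebra, $(A,\Delta,\epsilon)$ a coalgebra, and $(m\otimes\mathrm{id}_A)\circ(\mathrm{id}_A\otimes\Delta)=\Delta\circ m=(\mathrm{id}_A\otimes m)\circ(\Delta\otimes\mathrm{id}_A)$. Let $\varepsilon_x:\Phi(\mathrm{Tr}_{\mathcal C}(x))\to x$ and $\eta_c:c\to\mathrm{Tr}_{\mathcal C}(\Phi(c))$ be the counit and unit of $\Phi\dashv\mathrm{Tr}_{\mathcal C}$. For $x,y\in\mathcal M$, $\mu_{x,y}:\mathrm{Tr}_{\mathcal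 C}(x)\otimes\mathrm{Tr}_{\mathcal C}(y)\to\mathrm{Tr}_{\mathcal C}(x\otimes y)$ is the unique morphism with $\varepsilon_{x\otimes y}\circ\Phi(\mu_{x,y})=\varepsilon_x\otimes\varepsilon_y$. For an algebra $A$ in $\mathcal M$, the object $\mathrm{Tr}_{\mathcal C}(A)$ is an algebra in $\mathcal C$ with multiplication $\mathrm{Tr}_{\mathcal C}(m_A)\circ\mu_{A,A}$ and unit $\mathrm{Tr}_{\mathcal C}(i_A)\circ\eta_{1}$. *)

theory Defs
  imports Complex_Main
begin

section \<open>Linear categories\<close>

text \<open>
  The morphism spaces are linear subspaces \<open>Hom x y\<close> of one ambient vector space
  \<open>'m\<close> with scalar multiplication \<open>scale\<close>.  This is no loss of generality: any family of
  morphism spaces embeds in its direct sum, to which composition and the tensor product of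
  morphisms extend bilinearly.  The spaces all share the zero vector, so a morphism does not
  determine its source and target; notions that depend on them take the objects as arguments.
  Nothing is required of morphisms outside the spaces \<open>Hom x y\<close> with \<open>x, y \<in> Obj\<close>.
\<close>

record ('k, 'o, 'm) linear_cat =
  objects :: "'o set" ("Obj\<index>")
  homset :: "'o \<Rightarrow> 'o \<Rightarrow> 'm set" ("Hom\<index>")
  compose :: "'m \<Rightarrow> 'm \<Rightarrow> 'm" (infixl "\<cdot>\<index>" 70)
  identity :: "'o \<Rightarrow> 'm" ("idm\<index>")
  scale :: "'k \<Rightarrow> 'm \<Rightarrow> 'm"

locale linear_category = vector_space "scale C"
  for C :: "('k::field, 'o, 'm::ab_group_add, 'z) linear_cat_scheme" (structure) +
  assumes Hom_subspace: "\<lbrakk>x \<in> Obj; y \<in> Obj\<rbrakk> \<Longrightarrow> subspace (Hom x y)"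
    and Hom_finite_dim: "\<lbrakk>x \<in> Obj; y \<in> Obj\<rbrakk> \<Longrightarrow> \<exists>B. finite B \<and> span B = Hom x y"
    and id_in_Hom: "x \<in> Obj \<Longrightarrow> idm x \<in> Hom x x"
    and comp_in_Hom:
      "\<lbrakk>x \<in> Obj; y \<in> Obj; z \<in> Obj; g \<in> Hom y z; f \<in> Hom x y\<rbrakk> \<Longrightarrow> g \<cdot> f \<in> Hom x z"
    and comp_assoc:
      "\<lbrakk>w \<in> Obj; x \<in> Obj; y \<in> Obj; z \<in> Obj; h \<in> Hom y z; g \<in> Hom x y; f \<in> Hom w x\<rbrakk>
        \<Longrightarrow> (h \<cdot> g) \<cdot> f = h \<cdot> (g \<cdot> f)"
    and comp_id_left: "\<lbrakk>x \<in> Obj; y \<in> Obj; f \<in> Hom x y\<rbrakk> \<Longrightarrow> idm y \<cdot> f = f"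
    and comp_id_right: "\<lbrakk>x \<in> Obj; y \<in> Obj; f \<in> Hom x y\<rbrakk> \<Longrightarrow> f \<cdot> idm x = f"
    and comp_add_left:
      "\<lbrakk>x \<in> Obj; y \<in> Obj; z \<in> Obj; g \<in> Hom y z; g' \<in> Hom y z; f \<in> Hom x y\<rbrakk>
        \<Longrightarrow> (g + g') \<cdot> f = g \<cdot> f + g' \<cdot> f"
    and comp_add_right:
      "\<lbrakk>x \<in> Obj; y \<in> Obj; z \<in> Obj; g \<in> Hom y z; f \<in> Hom x y; f' \<in> Hom x y\<rbrakk>
        \<Longrightarrow> g \<cdot> (f + f') = g \<cdot> f + g \<cdot> f'"
    and comp_scale_left:
      "\<lbrakk>x \<in> Obj; y \<in> Obj; z \<in> Obj; g \<in> Hom y z; f \<in> Hom x y\<rbrakk>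
        \<Longrightarrow> scale C a g \<cdot> f = scale C a (g \<cdot> f)"
    and comp_scale_right:
      "\<lbrakk>x \<in> Obj; y \<in> Obj; z \<in> Obj; g \<in> Hom y z; f \<in> Hom x y\<rbrakk>
        \<Longrightarrow> g \<cdot> scale C a f = scale C a (g \<cdot> f)"
begin

definition is_inverse :: "'o \<Rightarrow> 'o \<Rightarrow> 'm \<Rightarrow> 'm \<Rightarrow> bool" where
  "is_inverse x y f g \<longleftrightarrow>
     f \<in> Hom x y \<and> g \<in> Hom y x \<and> g \<cdot> f = idm x \<and> f \<cdot> g = idm y"

definition is_iso :: "'o \<Rightarrow> 'o \<Rightarrow> 'm \<Rightarrow> bool" where
  "is_iso x y f \<longleftrightarrow> (\<exists>g. is_inverse x y f g)"

definition inv_mor :: "'o \<Rightarrow> 'o \<Rightarrow> 'm \<Rightarrow> 'm" where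
  "inv_mor x y f = (THE g. is_inverse x y f g)"

definition isomorphic :: "'o \<Rightarrow> 'o \<Rightarrow> bool" where
  "isomorphic x y \<longleftrightarrow> (\<exists>f. is_iso x y f)"

definition is_mono :: "'o \<Rightarrow> 'o \<Rightarrow> 'm \<Rightarrow> bool" where
  "is_mono x y f \<longleftrightarrow> f \<in> Hom x y \<and>
     (\<forall>w\<in>Obj. \<forall>g\<in>Hom w x. \<forall>h\<in>Hom w x. f \<cdot> g = f \<cdot> h \<longrightarrow> g = h)"

definition is_epi :: "'o \<Rightarrow> 'o \<Rightarrow> 'm \<Rightarrow> bool" where
  "is_epi x y f \<longleftrightarrow> f \<in> Hom x y \<and>
     (\<forall>z\<in>Obj. \<forall>g\<in>Hom y z. \<forall>h\<in>Hom y z. g \<cdot> f = h \<cdot> f \<longrightarrow> g = h)"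

definition is_kernel :: "'o \<Rightarrow> 'o \<Rightarrow> 'm \<Rightarrow> 'o \<Rightarrow> 'm \<Rightarrow> bool" where
  "is_kernel x y f k j \<longleftrightarrow> k \<in> Obj \<and> j \<in> Hom k x \<and> f \<cdot> j = 0 \<and>
     (\<forall>w\<in>Obj. \<forall>g\<in>Hom w x. f \<cdot> g = 0 \<longrightarrow> (\<exists>!h. h \<in> Hom w k \<and> j \<cdot> h = g))"

definition is_cokernel :: "'o \<Rightarrow> 'o \<Rightarrow> 'm \<Rightarrow> 'o \<Rightarrow> 'm \<Rightarrow> bool" where
  "is_cokernel x y f q p \<longleftrightarrow> q \<in> Obj \<and> p \<in> Hom y q \<and> p \<cdot> f = 0 \<and>
     (\<forall>z\<in>Obj. \<forall>g\<in>Hom y z. g \<cdot> f = 0 \<longrightarrow> (\<exists>!h. h \<in> Hom q z \<and> h \<cdot> p = g))"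

text \<open>For \<open>n = 0\<close> the following says that \<open>s\<close> is a zero object.\<close>

definition is_direct_sum ::
    "nat \<Rightarrow> (nat \<Rightarrow> 'o) \<Rightarrow> 'o \<Rightarrow> (nat \<Rightarrow> 'm) \<Rightarrow> (nat \<Rightarrow> 'm) \<Rightarrow> bool" where
  "is_direct_sum n x s incl proj \<longleftrightarrow> s \<in> Obj \<and>
     (\<forall>i<n. incl i \<in> Hom (x i) s \<and> proj i \<in> Hom s (x i)) \<and>
     (\<forall>i<n. \<forall>j<n. proj i \<cdot> incl j = (if i = j then idm (x i) else 0)) \<and>
     (\<Sum>i<n. incl i \<cdot> proj i) = idm s"

definition simple :: "'o \<Rightarrow> bool" where
  "simple x \<longleftrightarrow> x \<in> Obj \<and> idm x \<noteq> 0 \<and>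
     (\<forall>y\<in>Obj. \<forall>f. is_mono y x f \<longrightarrow> f = 0 \<or> is_iso y x f)"

end

locale abelian_category = linear_category C
  for C :: "('k::field, 'o, 'm::ab_group_add, 'z) linear_cat_scheme" (structure) +
  assumes direct_sums:
      "(\<And>i. i < n \<Longrightarrow> xs i \<in> Obj) \<Longrightarrow> \<exists>s incl proj. is_direct_sum n xs s incl proj"
    and kernels: "\<lbrakk>x \<in> Obj; y \<in> Obj; f \<in> Hom x y\<rbrakk> \<Longrightarrow> \<exists>k j. is_kernel x y f k j"
    and cokernels: "\<lbrakk>x \<in> Obj; y \<in> Obj; f \<in> Hom x y\<rbrakk> \<Longrightarrow> \<exists>q p. is_cokernel x y f q p"
    and mono_is_kernel:
      "\<lbrakk>x \<in> Obj; y \<in> Obj; is_mono x y f\<rbrakk> \<Longrightarrow> \<exists>z\<in>Obj. \<exists>g\<in>Hom y z. is_kernel y z g x f"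
    and epi_is_cokernel:
      "\<lbrakk>x \<in> Obj; y \<in> Obj; is_epi x y f\<rbrakk> \<Longrightarrow> \<exists>w\<in>Obj. \<exists>g\<in>Hom w x. is_cokernel w x g y f"

locale semisimple_category = abelian_category C
  for C :: "('k::field, 'o, 'm::ab_group_add, 'z) linear_cat_scheme" (structure) +
  assumes sum_of_simples:
    "s \<in> Obj \<Longrightarrow> \<exists>n x incl proj. (\<forall>i<n. simple (x i)) \<and> is_direct_sum n x s incl proj"


section \<open>Tensor categories\<close>

record ('k, 'o, 'm) tensor_cat = "('k, 'o, 'm) linear_cat" +
  tobj :: "'o \<Rightarrow> 'o \<Rightarrow> 'o" (infixl "\<otimes>\<index>" 75)
  tmor :: "'m \<Rightarrow> 'm \<Rightarrow> 'm" (infixl "\<odot>\<index>" 75)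
  unit_obj :: 'o ("\<one>\<index>")
  assoc :: "'o \<Rightarrow> 'o \<Rightarrow> 'o \<Rightarrow> 'm" ("\<a>\<index>")
  lunit :: "'o \<Rightarrow> 'm" ("\<l>\<index>")
  runit :: "'o \<Rightarrow> 'm" ("\<r>\<index>")

locale tensor_category = linear_category C
  for C :: "('k::field, 'o, 'm::ab_group_add, 'z) tensor_cat_scheme" (structure) +
  assumes unit_in_Obj: "\<one> \<in> Obj"
    and tobj_in_Obj: "\<lbrakk>x \<in> Obj; y \<in> Obj\<rbrakk> \<Longrightarrow> x \<otimes> y \<in> Obj"
    and tmor_in_Hom:
      "\<lbrakk>x \<in> Obj; x' \<in> Obj; y \<in> Obj; y' \<in> Obj; f \<in> Hom x x'; g \<in> Hom y y'\<rbrakk>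
        \<Longrightarrow> f \<odot> g \<in> Hom (x \<otimes> y) (x' \<otimes> y')"
    and tmor_id: "\<lbrakk>x \<in> Obj; y \<in> Obj\<rbrakk> \<Longrightarrow> idm x \<odot> idm y = idm (x \<otimes> y)"
    and tmor_comp:
      "\<lbrakk>x \<in> Obj; x' \<in> Obj; x'' \<in> Obj; y \<in> Obj; y' \<in> Obj; y'' \<in> Obj;
        f \<in> Hom x x'; f' \<in> Hom x' x''; g \<in> Hom y y'; g' \<in> Hom y' y''\<rbrakk>
        \<Longrightarrow> (f' \<cdot> f) \<odot> (g' \<cdot> g) = (f' \<odot> g') \<cdot> (f \<odot> g)"
    and tmor_add_left:
      "\<lbrakk>x \<in> Obj; x' \<in> Obj; y \<in> Obj; y' \<in> Obj; f \<in> Hom x x'; f' \<in> Hom x x'; g \<in> Hom y y'\<rbrakk>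
        \<Longrightarrow> (f + f') \<odot> g = f \<odot> g + f' \<odot> g"
    and tmor_add_right:
      "\<lbrakk>x \<in> Obj; x' \<in> Obj; y \<in> Obj; y' \<in> Obj; f \<in> Hom x x'; g \<in> Hom y y'; g' \<in> Hom y y'\<rbrakk>
        \<Longrightarrow> f \<odot> (g + g') = f \<odot> g + f \<odot> g'"
    and tmor_scale_left:
      "\<lbrakk>x \<in> Obj; x' \<in> Obj; y \<in> Obj; y' \<in> Obj; f \<in> Hom x x'; g \<in> Hom y y'\<rbrakk>
        \<Longrightarrow> scale C a f \<odot> g = scale C a (f \<odot> g)"
    and tmor_scale_right:
      "\<lbrakk>x \<in> Obj; x' \<in> Obj; y \<in> Obj; y' \<in> Obj; f \<in> Hom x x'; g \<in> Hom y y'\<rbrakk>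
        \<Longrightarrow> f \<odot> scale C a g = scale C a (f \<odot> g)"
    and assoc_iso:
      "\<lbrakk>x \<in> Obj; y \<in> Obj; z \<in> Obj\<rbrakk> \<Longrightarrow> is_iso ((x \<otimes> y) \<otimes> z) (x \<otimes> (y \<otimes> z)) (\<a> x y z)"
    and assoc_natural:
      "\<lbrakk>x \<in> Obj; x' \<in> Obj; y \<in> Obj; y' \<in> Obj; z \<in> Obj; z' \<in> Obj;
        f \<in> Hom x x'; g \<in> Hom y y'; h \<in> Hom z z'\<rbrakk>
        \<Longrightarrow> \<a> x' y' z' \<cdot> ((f \<odot> g) \<odot> h) = (f \<odot> (g \<odot> h)) \<cdot> \<a> x y z"
    and lunit_iso: "x \<in> Obj \<Longrightarrow> is_iso (\<one> \<otimes> x) x (\<l> x)"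
    and lunit_natural:
      "\<lbrakk>x \<in> Obj; y \<in> Obj; f \<in> Hom x y\<rbrakk> \<Longrightarrow> \<l> y \<cdot> (idm \<one> \<odot> f) = f \<cdot> \<l> x"
    and runit_iso: "x \<in> Obj \<Longrightarrow> is_iso (x \<otimes> \<one>) x (\<r> x)"
    and runit_natural:
      "\<lbrakk>x \<in> Obj; y \<in> Obj; f \<in> Hom x y\<rbrakk> \<Longrightarrow> \<r> y \<cdot> (f \<odot> idm \<one>) = f \<cdot> \<r> x"
    and pentagon:
      "\<lbrakk>w \<in> Obj; x \<in> Obj; y \<in> Obj; z \<in> Obj\<rbrakk>
        \<Longrightarrow> (idm w \<odot> \<a> x y z) \<cdot> \<a> w (x \<otimes> y) z \<cdot> (\<a> w x y \<odot> idm z)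
          = \<a> w x (y \<otimes> z) \<cdot> \<a> (w \<otimes> x) y z"
    and triangle:
      "\<lbrakk>x \<in> Obj; y \<in> Obj\<rbrakk> \<Longrightarrow> (idm x \<odot> \<l> y) \<cdot> \<a> x \<one> y = \<r> x \<odot> idm y"
begin

definition assoc_inv :: "'o \<Rightarrow> 'o \<Rightarrow> 'o \<Rightarrow> 'm" where
  "assoc_inv x y z = inv_mor ((x \<otimes> y) \<otimes> z) (x \<otimes> (y \<otimes> z)) (\<a> x y z)"

text \<open>\<open>b\<close> is the dual \<open>a\<^sup>*\<close> of \<open>a\<close>, with \<open>ev : b \<otimes> a \<rightarrow> \<one>\<close> and \<open>coev : \<one> \<rightarrow> a \<otimes> b\<close>.\<close>

definition is_dual :: "'o \<Rightarrow> 'o \<Rightarrow> 'm \<Rightarrow> 'm \<Rightarrow> bool" where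
  "is_dual a b ev coev \<longleftrightarrow>
     a \<in> Obj \<and> b \<in> Obj \<and> ev \<in> Hom (b \<otimes> a) \<one> \<and> coev \<in> Hom \<one> (a \<otimes> b) \<and>
     \<r> a \<cdot> (idm a \<odot> ev) \<cdot> \<a> a b a \<cdot> (coev \<odot> idm a) = \<l> a \<and>
     \<l> b \<cdot> (ev \<odot> idm b) \<cdot> assoc_inv b a b \<cdot> (idm b \<odot> coev) = \<r> b"

end

locale rigid_tensor_category = tensor_category C
  for C :: "('k::field, 'o, 'm::ab_group_add, 'z) tensor_cat_scheme" (structure) +
  assumes has_dual: "a \<in> Obj \<Longrightarrow> \<exists>b ev coev. is_dual a b ev coev"
    and iso_to_dual: "b \<in> Obj \<Longrightarrow> \<exists>a b' ev coev. is_dual a b' ev coev \<and> isomorphic b b'"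

locale rigid_semisimple_tensor_category =
  rigid_tensor_category C + semisimple_category C
  for C :: "('k::field, 'o, 'm::ab_group_add, 'z) tensor_cat_scheme" (structure)


section \<open>Algebra objects\<close>

locale algebra_object = tensor_category C
  for C :: "('k::field, 'o, 'm::ab_group_add, 'z) tensor_cat_scheme" (structure) +
  fixes A :: 'o and m :: 'm and i :: 'm
  assumes alg_in_Obj: "A \<in> Obj"
    and mult_in_Hom: "m \<in> Hom (A \<otimes> A) A"
    and unit_in_Hom: "i \<in> Hom \<one> A"
    and mult_assoc: "m \<cdot> (m \<odot> idm A) = m \<cdot> (idm A \<odot> m) \<cdot> \<a> A A A"
    and mult_unit_left: "m \<cdot> (i \<odot> idm A) = \<l> A"
    and mult_unit_right: "m \<cdot> (idm A \<odot> i) = \<r> A"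
begin

definition is_left_module :: "'o \<Rightarrow> 'm \<Rightarrow> bool" where
  "is_left_module x act \<longleftrightarrow> x \<in> Obj \<and> act \<in> Hom (A \<otimes> x) x \<and>
     act \<cdot> (m \<odot> idm x) = act \<cdot> (idm A \<odot> act) \<cdot> \<a> A A x \<and>
     act \<cdot> (i \<odot> idm x) = \<l> x"

definition module_category :: "('k, 'o \<times> 'm, 'm) linear_cat" where
  "module_category =
     \<lparr>objects = {(x, act). is_left_module x act},
      homset = (\<lambda>(x, act) (y, act'). {f \<in> Hom x y. f \<cdot> act = act' \<cdot> (idm A \<odot> f)}),
      compose = compose C,
      identity = (\<lambda>(x, act). idm x),
      scale = scale C\<rparr>"

end

locale connected_algebra = algebra_object C A m i
  for C :: "('k::field, 'o, 'm::ab_group_add, 'z) tensor_cat_scheme" (structure)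
    and A :: 'o and m :: 'm and i :: 'm +
  assumes connected: "dim (Hom \<one> A) = 1"

locale semisimple_algebra = algebra_object C A m i
  for C :: "('k::field, 'o, 'm::ab_group_add, 'z) tensor_cat_scheme" (structure)
    and A :: 'o and m :: 'm and i :: 'm +
  assumes semisimple_modules: "semisimple_category module_category"

locale coalgebra_object = tensor_category C
  for C :: "('k::field, 'o, 'm::ab_group_add, 'z) tensor_cat_scheme" (structure) +
  fixes A :: 'o and \<Delta> :: 'm and e :: 'm
  assumes coalg_in_Obj: "A \<in> Obj"
    and comult_in_Hom: "\<Delta> \<in> Hom A (A \<otimes> A)"
    and counit_in_Hom: "e \<in> Hom A \<one>"
    and comult_coassoc: "\<a> A A A \<cdot> (\<Delta> \<odot> idm A) \<cdot> \<Delta> = (idm A \<odot> \<Delta>) \<cdot> \<Delta>"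
    and comult_counit_left: "\<l> A \<cdot> (e \<odot> idm A) \<cdot> \<Delta> = idm A"
    and comult_counit_right: "\<r> A \<cdot> (idm A \<odot> e) \<cdot> \<Delta> = idm A"

locale frobenius_algebra =
  algebra_object C A m i + coalgebra_object C A \<Delta> e
  for C :: "('k::field, 'o, 'm::ab_group_add, 'z) tensor_cat_scheme" (structure)
    and A :: 'o and m :: 'm and \<Delta> :: 'm and i :: 'm and e :: 'm +
  assumes frobenius_left: "(m \<odot> idm A) \<cdot> assoc_inv A A A \<cdot> (idm A \<odot> \<Delta>) = \<Delta> \<cdot> m"
    and frobenius_right: "\<Delta> \<cdot> m = (idm A \<odot> m) \<cdot> \<a> A A A \<cdot> (\<Delta> \<odot> idm A)"


section \<open>Tensor functors and adjunctions\<close>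

record ('o, 'm, 'p, 'n) linear_functor_data =
  fobj :: "'o \<Rightarrow> 'p"
  fmor :: "'m \<Rightarrow> 'n"

record ('o, 'm, 'p, 'n) tensor_functor_data = "('o, 'm, 'p, 'n) linear_functor_data" +
  tensorator :: "'o \<Rightarrow> 'o \<Rightarrow> 'n"
  unitor :: 'n

locale linear_functor = C: linear_category C + D: linear_category D
  for C :: "('k::field, 'o, 'm::ab_group_add, 'y) linear_cat_scheme"
    and D :: "('k, 'p, 'n::ab_group_add, 'z) linear_cat_scheme"
    and F :: "('o, 'm, 'p, 'n, 'f) linear_functor_data_scheme" +
  assumes fobj_in_Obj: "x \<in> Obj\<^bsub>C\<^esub> \<Longrightarrow> fobj F x \<in> Obj\<^bsub>D\<^esub>"
    and fmor_in_Hom: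
      "\<lbrakk>x \<in> Obj\<^bsub>C\<^esub>; y \<in> Obj\<^bsub>C\<^esub>; f \<in> Hom\<^bsub>C\<^esub> x y\<rbrakk> \<Longrightarrow> fmor F f \<in> Hom\<^bsub>D\<^esub> (fobj F x) (fobj F y)"
    and fmor_id: "x \<in> Obj\<^bsub>C\<^esub> \<Longrightarrow> fmor F (idm\<^bsub>C\<^esub> x) = idm\<^bsub>D\<^esub> (fobj F x)"
    and fmor_comp:
      "\<lbrakk>x \<in> Obj\<^bsub>C\<^esub>; y \<in> Obj\<^bsub>C\<^esub>; z \<in> Obj\<^bsub>C\<^esub>; g \<in> Hom\<^bsub>C\<^esub> y z; f \<in> Hom\<^bsub>C\<^esub> x y\<rbrakk>
        \<Longrightarrow> fmor F (g \<cdot>\<^bsub>C\<^esub> f) = fmor F g \<cdot>\<^bsub>D\<^esub> fmor F f"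
    and fmor_add:
      "\<lbrakk>x \<in> Obj\<^bsub>C\<^esub>; y \<in> Obj\<^bsub>C\<^esub>; f \<in> Hom\<^bsub>C\<^esub> x y; g \<in> Hom\<^bsub>C\<^esub> x y\<rbrakk>
        \<Longrightarrow> fmor F (f + g) = fmor F f + fmor F g"
    and fmor_scale:
      "\<lbrakk>x \<in> Obj\<^bsub>C\<^esub>; y \<in> Obj\<^bsub>C\<^esub>; f \<in> Hom\<^bsub>C\<^esub> x y\<rbrakk>
        \<Longrightarrow> fmor F (scale C a f) = scale D a (fmor F f)"

text \<open>Strong monoidal functors, with \<open>tensorator F x y : F x \<otimes> F y \<rightarrow> F (x \<otimes> y)\<close> and
  \<open>unitor F : \<one> \<rightarrow> F \<one>\<close>.\<close>

locale tensor_functor =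
  linear_functor C D F + C: tensor_category C + D: tensor_category D
  for C :: "('k::field, 'o, 'm::ab_group_add, 'y) tensor_cat_scheme"
    and D :: "('k, 'p, 'n::ab_group_add, 'z) tensor_cat_scheme"
    and F :: "('o, 'm, 'p, 'n, 'f) tensor_functor_data_scheme" +
  assumes tensorator_iso:
      "\<lbrakk>x \<in> Obj\<^bsub>C\<^esub>; y \<in> Obj\<^bsub>C\<^esub>\<rbrakk>
        \<Longrightarrow> D.is_iso (fobj F x \<otimes>\<^bsub>D\<^esub> fobj F y) (fobj F (x \<otimes>\<^bsub>C\<^esub> y)) (tensorator F x y)"
    and tensorator_natural:
      "\<lbrakk>x \<in> Obj\<^bsub>C\<^esub>; x' \<in> Obj\<^bsub>C\<^esub>; y \<in> Obj\<^bsub>C\<^esub>; y' \<in> Obj\<^bsub>C\<^esub>; f \<in> Hom\<^bsub>C\<^esub> x x'; g \<in> Hom\<^bsub>C\<^esub> y y'\<rbrakk>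
        \<Longrightarrow> tensorator F x' y' \<cdot>\<^bsub>D\<^esub> (fmor F f \<odot>\<^bsub>D\<^esub> fmor F g)
          = fmor F (f \<odot>\<^bsub>C\<^esub> g) \<cdot>\<^bsub>D\<^esub> tensorator F x y"
    and unitor_iso: "D.is_iso \<one>\<^bsub>D\<^esub> (fobj F \<one>\<^bsub>C\<^esub>) (unitor F)"
    and tensorator_assoc:
      "\<lbrakk>x \<in> Obj\<^bsub>C\<^esub>; y \<in> Obj\<^bsub>C\<^esub>; z \<in> Obj\<^bsub>C\<^esub>\<rbrakk>
        \<Longrightarrow> fmor F (\<a>\<^bsub>C\<^esub> x y z) \<cdot>\<^bsub>D\<^esub> tensorator F (x \<otimes>\<^bsub>C\<^esub> y) z
              \<cdot>\<^bsub>D\<^esub> (tensorator F x y \<odot>\<^bsub>D\<^esub> idm\<^bsub>D\<^esub> (fobj F z))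
          = tensorator F x (y \<otimes>\<^bsub>C\<^esub> z) \<cdot>\<^bsub>D\<^esub> (idm\<^bsub>D\<^esub> (fobj F x) \<odot>\<^bsub>D\<^esub> tensorator F y z)
              \<cdot>\<^bsub>D\<^esub> \<a>\<^bsub>D\<^esub> (fobj F x) (fobj F y) (fobj F z)"
    and unitor_left:
      "x \<in> Obj\<^bsub>C\<^esub> \<Longrightarrow> fmor F (\<l>\<^bsub>C\<^esub> x) \<cdot>\<^bsub>D\<^esub> tensorator F \<one>\<^bsub>C\<^esub> x \<cdot>\<^bsub>D\<^esub> (unitor F \<odot>\<^bsub>D\<^esub> idm\<^bsub>D\<^esub> (fobj F x))
        = \<l>\<^bsub>D\<^esub> (fobj F x)"
    and unitor_right:
      "x \<in> Obj\<^bsub>C\<^esub> \<Longrightarrow> fmor F (\<r>\<^bsub>C\<^esub> x) \<cdot>\<^bsub>D\<^esub> tensorator F x \<one>\<^bsub>C\<^esub> \<cdot>\<^bsub>D\<^esub> (idm\<^bsub>D\<^esub> (fobj F x) \<odot>\<^bsub>D\<^esub> unitor F)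
        = \<r>\<^bsub>D\<^esub> (fobj F x)"

text \<open>\<open>G\<close> is right adjoint to \<open>F\<close>, with unit \<open>\<eta>\<close> and counit \<open>\<epsilon>\<close>.\<close>

locale linear_adjunction = F: linear_functor C D F + G: linear_functor D C G
  for C :: "('k::field, 'o, 'm::ab_group_add, 'y) linear_cat_scheme"
    and D :: "('k, 'p, 'n::ab_group_add, 'z) linear_cat_scheme"
    and F :: "('o, 'm, 'p, 'n, 'f) linear_functor_data_scheme"
    and G :: "('p, 'n, 'o, 'm, 'g) linear_functor_data_scheme" +
  fixes \<eta> :: "'o \<Rightarrow> 'm" and \<epsilon> :: "'p \<Rightarrow> 'n"
  assumes unit_in_Hom: "c \<in> Obj\<^bsub>C\<^esub> \<Longrightarrow> \<eta> c \<in> Hom\<^bsub>C\<^esub> c (fobj G (fobj F c))"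
    and unit_natural:
      "\<lbrakk>c \<in> Obj\<^bsub>C\<^esub>; c' \<in> Obj\<^bsub>C\<^esub>; f \<in> Hom\<^bsub>C\<^esub> c c'\<rbrakk>
        \<Longrightarrow> \<eta> c' \<cdot>\<^bsub>C\<^esub> f = fmor G (fmor F f) \<cdot>\<^bsub>C\<^esub> \<eta> c"
    and counit_in_Hom: "x \<in> Obj\<^bsub>D\<^esub> \<Longrightarrow> \<epsilon> x \<in> Hom\<^bsub>D\<^esub> (fobj F (fobj G x)) x"
    and counit_natural:
      "\<lbrakk>x \<in> Obj\<^bsub>D\<^esub>; x' \<in> Obj\<^bsub>D\<^esub>; g \<in> Hom\<^bsub>D\<^esub> x x'\<rbrakk>
        \<Longrightarrow> \<epsilon> x' \<cdot>\<^bsub>D\<^esub> fmor F (fmor G g) = g \<cdot>\<^bsub>D\<^esub> \<epsilon> x"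
    and triangle_left: "c \<in> Obj\<^bsub>C\<^esub> \<Longrightarrow> \<epsilon> (fobj F c) \<cdot>\<^bsub>D\<^esub> fmor F (\<eta> c) = idm\<^bsub>D\<^esub> (fobj F c)"
    and triangle_right: "x \<in> Obj\<^bsub>D\<^esub> \<Longrightarrow> fmor G (\<epsilon> x) \<cdot>\<^bsub>C\<^esub> \<eta> (fobj G x) = idm\<^bsub>C\<^esub> (fobj G x)"

locale tensor_functor_right_adjoint =
  tensor_functor C M \<Phi> + linear_adjunction C M \<Phi> Tr \<eta> \<epsilon>
  for C :: "('k::field, 'o, 'm::ab_group_add, 'y) tensor_cat_scheme"
    and M :: "('k, 'p, 'n::ab_group_add, 'z) tensor_cat_scheme"
    and \<Phi> :: "('o, 'm, 'p, 'n, 'f) tensor_functor_data_scheme"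
    and Tr :: "('p, 'n, 'o, 'm, 'g) linear_functor_data_scheme"
    and \<eta> :: "'o \<Rightarrow> 'm" and \<epsilon> :: "'p \<Rightarrow> 'n"
begin

text \<open>The usual formulas \<open>\<epsilon> (x \<otimes> y) \<cdot> \<Phi> \<mu> = \<epsilon> x \<odot> \<epsilon> y\<close> for the multiplicator \<open>\<mu>\<close> and \<open>Tr i \<cdot> \<eta> \<one>\<close> for
  the unit suppress the coherence isomorphisms of \<open>\<Phi>\<close>; here they are inserted.\<close>

definition tr_mu :: "'p \<Rightarrow> 'p \<Rightarrow> 'm" where
  "tr_mu x y = (THE h. h \<in> Hom\<^bsub>C\<^esub> (fobj Tr x \<otimes>\<^bsub>C\<^esub> fobj Tr y) (fobj Tr (x \<otimes>\<^bsub>M\<^esub> y)) \<and>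
     \<epsilon> (x \<otimes>\<^bsub>M\<^esub> y) \<cdot>\<^bsub>M\<^esub> fmor \<Phi> h \<cdot>\<^bsub>M\<^esub> tensorator \<Phi> (fobj Tr x) (fobj Tr y) = \<epsilon> x \<odot>\<^bsub>M\<^esub> \<epsilon> y)"

definition tr_mult :: "'p \<Rightarrow> 'n \<Rightarrow> 'm" where
  "tr_mult A m = fmor Tr m \<cdot>\<^bsub>C\<^esub> tr_mu A A"

definition tr_unit :: "'n \<Rightarrow> 'm" where
  "tr_unit i =
     fmor Tr i \<cdot>\<^bsub>C\<^esub> fmor Tr (D.inv_mor \<one>\<^bsub>M\<^esub> (fobj \<Phi> \<one>\<^bsub>C\<^esub>) (unitor \<Phi>)) \<cdot>\<^bsub>C\<^esub> \<eta> \<one>\<^bsub>C\<^esub>"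

end

end

theory Submission
  imports Defs
begin

text \<open>
  Call a morphism \<open>f\<close> regular if \<open>f \<cdot> g \<cdot> f = f\<close> for some \<open>g\<close>.  A linear category with direct sums and
  split idempotents is semisimple abelian iff all its morphisms are regular.  For an algebra \<open>A\<close>
  every module is the cokernel of a map of free modules, so for semisimplicity of the module category
  it suffices that maps between free modules are regular.  Maps of free modules form a Kleisli category,
  and the projection formula \<open>Hom d (Tr A \<otimes> c) \<cong> Hom (\<Phi> d) (A \<otimes> \<Phi> c)\<close>, which comes from
  the adjunction and the dual of \<open>c\<close>, identifies the Kleisli category of \<open>Tr A\<close> with a full
  subcategory of that of \<open>A\<close>; regularity is thereby inherited.

  A connected algebra with semisimple module category is a simple module over itself, so any nonzero
  \<open>e : A \<rightarrow> \<one>\<close> makes \<open>e \<cdot> m\<close> a nondegenerate pairing, and this gives the Frobenius structure.  In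
  particular the Frobenius structure on \<open>Tr A\<close> does not come from the one on \<open>A\<close>.

  Coherence isomorphisms are handled by embedding a tensor category into a strict one.
\<close>

text \<open>Regularity is an equation between composites, so it passes along any family of
  bijections between morphism sets that respects composition. This is why it is preferred to
  exactness or to chasing simple modules: the functor \<Phi> need not be essentially surjective, and
  the comparison reaches only the free modules on objects \<Phi> c. The obstacle in the Frobenius
  part is that nondegeneracy of a form on \<open>A\<close> gives only a monomorphism from
  \<open>A\<close> to an object z that has \<open>A\<close> as its dual. Left and right duals are
  not identified and objects have no dimension that could be compared. What can be compared are
  endomorphism spaces: duality gives a linear isomorphism from End z to End A, while a split
  monomorphism embeds End A into End z. Finite dimension makes the composite onto, so the identity
  of z factors through the monomorphism.\<close>

context vector_space_pair
begin

text \<open>Composition and tensor product are bilinear only on the morphism spaces, not on the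
  ambient space, so linearity of \<open>f\<close> is assumed on \<open>V\<close> alone. A vanishing
  combination of images is the image of a combination of \<open>B\<close>, which vanishes by
  injectivity.\<close>

lemma independent_image_on_subspace:
  assumes V: "vs1.subspace V" and B: "B \<subseteq> V" "vs1.independent B"
    and add: "\<And>u v. \<lbrakk>u \<in> V; v \<in> V\<rbrakk> \<Longrightarrow> f (u + v) = f u + f v"
    and scale: "\<And>c v. v \<in> V \<Longrightarrow> f (s1 c v) = s2 c (f v)"
    and inj: "\<And>v. \<lbrakk>v \<in> V; f v = 0\<rbrakk> \<Longrightarrow> v = 0"
  shows "vs2.independent (f ` B)" "inj_on f B"
proof -
  have f0: "f 0 = 0"
    using scale[of 0 0] vs1.subspace_0[OF V] by simp
  have fneg: "f (- v) = - f v" if "v \<in> V" for v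
    using scale[OF that, of "- 1"] by simp
  have injV: "inj_on f V"
  proof (rule inj_onI)
    fix u v assume "u \<in> V" "v \<in> V" "f u = f v"
    moreover then have "f (u - v) = 0"
      using add[of u "- v"] fneg[of v] vs1.subspace_neg[OF V] by simp
    ultimately show "u = v"
      using inj[of "u - v"] vs1.subspace_diff[OF V] by simp
  qed
  then show injB: "inj_on f B"
    using B(1) by (rule inj_on_subset)
  have fsum: "f (\<Sum>v\<in>t. s1 (u v) v) = (\<Sum>v\<in>t. s2 (u v) (f v))" if "finite t" "t \<subseteq> V" for t u
    using that
  proof (induction t rule: finite_induct)
    case (insert x t)
    then show ?case
      using vs1.subspace_sum[OF V, of t "\<lambda>v. s1 (u v) v"] vs1.subspace_scale[OF V]
      by (simp add: add scale subset_iff)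
  qed (simp add: f0)
  show "vs2.independent (f ` B)"
    unfolding vs2.independent_explicit_module
  proof (intro allI impI)
    fix t u w
    assume t: "finite t" "t \<subseteq> f ` B" "(\<Sum>v\<in>t. s2 (u v) v) = 0" "w \<in> t"
    obtain t' where t': "t' \<subseteq> B" "t = f ` t'" "finite t'"
      using t(1,2) by (metis finite_subset_image)
    have inj': "inj_on f t'" using injB t'(1) by (rule inj_on_subset)
    have t'V: "t' \<subseteq> V" using t' B by blast
    have "f (\<Sum>v\<in>t'. s1 (u (f v)) v) = 0"
      using fsum[OF t'(3) t'V, of "\<lambda>v. u (f v)"] t(3) sum.reindex[OF inj', of "\<lambda>v. s2 (u v) v"]
      by (simp add: t'(2) o_def)
    moreover have "(\<Sum>v\<in>t'. s1 (u (f v)) v) \<in> V"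
      using t'V by (intro vs1.subspace_sum[OF V] vs1.subspace_scale[OF V]) auto
    ultimately have "(\<Sum>v\<in>t'. s1 (u (f v)) v) = 0" using inj by blast
    moreover obtain w' where "w' \<in> t'" "w = f w'" using t(4) t'(2) by blast
    ultimately show "u w = 0"
      using B(2)[unfolded vs1.independent_explicit_module, rule_format, OF t'(3,1), of "\<lambda>v. u (f v)" w']
      by blast
  qed
qed

end

context vector_space
begin

lemma independent_card_le_dim_finite:
  assumes "finite B0" "span B0 = W" "S \<subseteq> W" "independent S"
  shows "finite S" "card S \<le> dim W"
proof -
  obtain B where B: "B \<subseteq> W" "independent B" "W \<subseteq> span B" "card B = dim W"
    using basis_exists by blast
  have "finite B" using independent_span_bound[OF assms(1) B(2)] B(1) assms(2) by blast
  then show "finite S" "card S \<le> dim W"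
    using independent_span_bound[OF _ assms(4), of B] assms(3) B by auto
qed

text \<open>The image of a basis stays independent; if its span missed a vector of \<open>V\<close>,
  adding that vector would give more than \<open>dim V\<close> independent vectors. This count is
  what later inverts the map from an algebra to its dual.\<close>

lemma injective_endo_surjective:
  assumes V: "finite B0" "span B0 = V"
    and maps: "\<And>v. v \<in> V \<Longrightarrow> f v \<in> V"
    and add: "\<And>u v. \<lbrakk>u \<in> V; v \<in> V\<rbrakk> \<Longrightarrow> f (u + v) = f u + f v"
    and scale: "\<And>c v. v \<in> V \<Longrightarrow> f (scale c v) = scale c (f v)"
    and inj: "\<And>v. \<lbrakk>v \<in> V; f v = 0\<rbrakk> \<Longrightarrow> v = 0"
  shows "f ` V = V"
proof -
  interpret vector_space_pair scale scale ..
  have sV: "subspace V" using V(2) subspace_span by blast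
  obtain B where B: "B \<subseteq> V" "independent B" "V \<subseteq> span B" "card B = dim V"
    using basis_exists by blast
  note im = independent_image_on_subspace[of V B f, OF sV B(1,2) add scale inj]
  have fB: "f ` B \<subseteq> V" using B(1) maps by auto
  have finB: "finite B" using independent_card_le_dim_finite(1)[OF V B(1,2)] .
  have "V \<subseteq> span (f ` B)"
  proof (rule ccontr)
    assume "\<not> V \<subseteq> span (f ` B)"
    then obtain v where v: "v \<in> V" "v \<notin> span (f ` B)" by blast
    then have "independent (insert v (f ` B))" using im(1) by (intro independent_insertI)
    from independent_card_le_dim_finite(2)[OF V _ this] v(1) fB
    have "card (insert v (f ` B)) \<le> dim V" by blast
    moreover have "v \<notin> f ` B" using v(2) span_base by blast
    ultimately have "Suc (card (f ` B)) \<le> dim V" using finB by (metis card_insert_disjoint finite_imageI)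
    then show False using B(4) card_image[OF im(2)] by linarith
  qed
  moreover have "subspace (f ` V)"
    unfolding subspace_def
  proof (intro conjI ballI allI)
    have "f 0 = 0" using scale[of 0 0] subspace_0[OF sV] by simp
    then show "0 \<in> f ` V" using subspace_0[OF sV] by force
  next
    fix x y assume "x \<in> f ` V" "y \<in> f ` V"
    then show "x + y \<in> f ` V" by (auto simp: add[symmetric] intro: subspace_add[OF sV])
  next
    fix x c assume "x \<in> f ` V"
    then show "scale c x \<in> f ` V" by (auto simp: scale[symmetric] intro: subspace_scale[OF sV])
  qed
  then have "span (f ` B) \<subseteq> f ` V"
    using B(1) by (intro span_minimal) auto
  ultimately show ?thesis using maps by blast
qed

end

section \<open>Von Neumann regularity in linear categories\<close>

context linear_category
begin

text \<open>One fact carries the membership of source, target and morphism, which are the premises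
  of the category laws. Hom sets overlap at least in zero, so a morphism can satisfy
  \<open>mor\<close> for several pairs of objects.\<close>

definition mor :: "'m \<Rightarrow> 'o \<Rightarrow> 'o \<Rightarrow> bool" where
  "mor f x y \<longleftrightarrow> x \<in> Obj \<and> y \<in> Obj \<and> f \<in> Hom x y"

lemma mor_Obj: "mor f x y \<Longrightarrow> x \<in> Obj" "mor f x y \<Longrightarrow> y \<in> Obj"
  and mor_Hom: "mor f x y \<Longrightarrow> f \<in> Hom x y"
  by (simp_all add: mor_def)

lemma mor_id: "x \<in> Obj \<Longrightarrow> mor (idm x) x x"
  by (simp add: mor_def id_in_Hom)

lemma mor_comp: "\<lbrakk>mor g y z; mor f x y\<rbrakk> \<Longrightarrow> mor (g \<cdot> f) x z"
  unfolding mor_def using comp_in_Hom by blast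

lemma mor_zero: "\<lbrakk>x \<in> Obj; y \<in> Obj\<rbrakk> \<Longrightarrow> mor 0 x y"
  by (simp add: mor_def Hom_subspace subspace_0)

lemma mor_add: "\<lbrakk>mor f x y; mor g x y\<rbrakk> \<Longrightarrow> mor (f + g) x y"
  by (simp add: mor_def Hom_subspace subspace_add)

lemma mor_diff: "\<lbrakk>mor f x y; mor g x y\<rbrakk> \<Longrightarrow> mor (f - g) x y"
  by (simp add: mor_def Hom_subspace subspace_diff)

lemma mor_scale: "mor f x y \<Longrightarrow> mor (scale C c f) x y"
  by (simp add: mor_def Hom_subspace subspace_scale)

lemma mor_sum:
  "\<lbrakk>x \<in> Obj; y \<in> Obj; \<And>i. i \<in> I \<Longrightarrow> mor (f i) x y\<rbrakk> \<Longrightarrow> mor (\<Sum>i\<in>I. f i) x y"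
  by (simp add: mor_def Hom_subspace subspace_sum)

lemmas mor_intros = mor_id mor_comp mor_zero mor_add mor_diff mor_scale

lemma m_assoc: "\<lbrakk>mor h y z; mor g x y; mor f w x\<rbrakk> \<Longrightarrow> (h \<cdot> g) \<cdot> f = h \<cdot> (g \<cdot> f)"
  unfolding mor_def using comp_assoc by blast

lemma m_id: "mor f x y \<Longrightarrow> idm y \<cdot> f = f" "mor f x y \<Longrightarrow> f \<cdot> idm x = f"
  unfolding mor_def using comp_id_left comp_id_right by blast+

lemma m_add:
  "\<lbrakk>mor g y z; mor g' y z; mor f x y\<rbrakk> \<Longrightarrow> (g + g') \<cdot> f = g \<cdot> f + g' \<cdot> f"
  "\<lbrakk>mor g y z; mor f x y; mor f' x y\<rbrakk> \<Longrightarrow> g \<cdot> (f + f') = g \<cdot> f + g \<cdot> f'"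
  unfolding mor_def using comp_add_left comp_add_right by blast+

lemma m_scale:
  "\<lbrakk>mor g y z; mor f x y\<rbrakk> \<Longrightarrow> scale C c g \<cdot> f = scale C c (g \<cdot> f)"
  "\<lbrakk>mor g y z; mor f x y\<rbrakk> \<Longrightarrow> g \<cdot> scale C c f = scale C c (g \<cdot> f)"
  unfolding mor_def using comp_scale_left comp_scale_right by blast+

lemma m_zero:
  "\<lbrakk>mor f x y; z \<in> Obj\<rbrakk> \<Longrightarrow> 0 \<cdot> f = 0"
  "\<lbrakk>mor g y z; x \<in> Obj\<rbrakk> \<Longrightarrow> g \<cdot> 0 = 0"
  using m_scale(1)[OF mor_zero[of y z], of f x 0] m_scale(2)[OF _ mor_zero[of x y], of g z 0]
  by (auto simp: mor_def)

lemma m_diff: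
  "\<lbrakk>mor g y z; mor g' y z; mor f x y\<rbrakk> \<Longrightarrow> (g - g') \<cdot> f = g \<cdot> f - g' \<cdot> f"
  "\<lbrakk>mor g y z; mor f x y; mor f' x y\<rbrakk> \<Longrightarrow> g \<cdot> (f - f') = g \<cdot> f - g \<cdot> f'"
  using m_add(1)[of "g - g'" y z g' f x] m_add(2)[of g y z "f - f'" x f'] mor_diff
  by (simp_all add: eq_diff_eq)

lemma m_sum:
  assumes "y \<in> Obj" "z \<in> Obj" "mor f x y" "\<And>i. i \<in> I \<Longrightarrow> mor (g i) y z"
  shows "(\<Sum>i\<in>I. g i) \<cdot> f = (\<Sum>i\<in>I. g i \<cdot> f)"
  using assms(4)
proof (induction I rule: infinite_finite_induct)
  case (insert i I)
  then show ?case
    using m_add(1)[OF _ mor_sum[OF assms(1,2)] assms(3), of "g i" I g] by simp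
qed (use m_zero(1)[OF assms(3,2)] in auto)

lemma m_sum':
  assumes "x \<in> Obj" "y \<in> Obj" "mor g y z" "\<And>i. i \<in> I \<Longrightarrow> mor (f i) x y"
  shows "g \<cdot> (\<Sum>i\<in>I. f i) = (\<Sum>i\<in>I. g \<cdot> f i)"
  using assms(4)
proof (induction I rule: infinite_finite_induct)
  case (insert i I)
  then show ?case
    using m_add(2)[OF assms(3) _ mor_sum[OF assms(1,2)], of "f i" I f] by simp
qed (use m_zero(2)[OF assms(3,1)] in auto)

definition regular :: "'o \<Rightarrow> 'o \<Rightarrow> 'm \<Rightarrow> bool" where
  "regular x y f \<longleftrightarrow> mor f x y \<and> (\<exists>g. mor g y x \<and> f \<cdot> (g \<cdot> f) = f)"

text \<open>McCoy's lemma.\<close>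

lemma regular_if_regular_diff:
  assumes f: "mor f x y" and g: "mor g y x" and r: "regular x y (f - f \<cdot> (g \<cdot> f))"
  shows "regular x y f"
proof -
  define d where "d = f - f \<cdot> (g \<cdot> f)"
  obtain h where h: "mor h y x" "d \<cdot> (h \<cdot> d) = d" and d: "mor d x y"
    using r unfolding regular_def d_def by blast
  \<comment> \<open>With \<open>h\<close> a quasi-inverse of \<open>d\<close>, the witness is
    \<open>g + ?a \<cdot> (h \<cdot> ?b)\<close>: since
    \<open>f \<cdot> ?a = d = ?b \<cdot> f\<close>, its two terms contribute
    \<open>f \<cdot> (g \<cdot> f)\<close> and \<open>d \<cdot> (h \<cdot> d) = d\<close>.\<close>
  let ?a = "idm x - g \<cdot> f" and ?b = "idm y - f \<cdot> g"
  have x: "x \<in> Obj" and y: "y \<in> Obj" using f by (auto simp: mor_def)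
  have gf: "mor (g \<cdot> f) x x" and fg: "mor (f \<cdot> g) y y" using f g by (blast intro: mor_comp)+
  have a: "mor ?a x x" and b: "mor ?b y y" using x y gf fg by (blast intro: mor_intros)+
  have fa: "f \<cdot> ?a = d" unfolding d_def by (simp add: m_diff(2)[OF f mor_id[OF x] gf] m_id[OF f])
  have bf: "?b \<cdot> f = d"
    unfolding d_def by (simp add: m_diff(1)[OF mor_id[OF y] fg f] m_id[OF f] m_assoc[OF f g f])
  have hb: "mor (h \<cdot> ?b) y x" using h b by (blast intro: mor_comp)
  have ahb: "mor (?a \<cdot> (h \<cdot> ?b)) y x" using a hb by (blast intro: mor_comp)
  have "(?a \<cdot> (h \<cdot> ?b)) \<cdot> f = ?a \<cdot> (h \<cdot> d)"
    by (simp add: m_assoc[OF a hb f] m_assoc[OF h(1) b f] bf)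
  moreover have "f \<cdot> (?a \<cdot> (h \<cdot> d)) = d"
    using m_assoc[OF f a mor_comp[OF h(1) d]] fa h(2) by simp
  ultimately have "f \<cdot> ((g + ?a \<cdot> (h \<cdot> ?b)) \<cdot> f) = f \<cdot> (g \<cdot> f) + d"
    using m_add(1)[OF g ahb f] m_add(2)[OF f gf mor_comp[OF ahb f]] by simp
  also have "\<dots> = f" by (simp add: d_def)
  finally show ?thesis
    unfolding regular_def using f mor_add[OF g ahb] by blast
qed

lemma regular_zero: "\<lbrakk>x \<in> Obj; y \<in> Obj\<rbrakk> \<Longrightarrow> regular x y 0"
  unfolding regular_def using mor_zero m_zero by metis

text \<open>A quasi-inverse \<open>g\<close> of \<open>j \<cdot> (f \<cdot> p)\<close> yields
  \<open>p \<cdot> (g \<cdot> j)\<close> for \<open>f\<close>; the one-sided inverses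
  \<open>j'\<close> and \<open>p'\<close> cancel the outer maps. It carries regularity from free
  modules to their retracts.\<close>

lemma regular_retract:
  assumes f: "mor f x y" and p: "mor p x' x" "mor p' x x'" "p \<cdot> p' = idm x"
    and j: "mor j y y'" "mor j' y' y" "j' \<cdot> j = idm y"
    and r: "regular x' y' (j \<cdot> (f \<cdot> p))"
  shows "regular x y f"
proof -
  obtain g where g: "mor g y' x'" "(j \<cdot> (f \<cdot> p)) \<cdot> (g \<cdot> (j \<cdot> (f \<cdot> p))) = j \<cdot> (f \<cdot> p)"
    using r unfolding regular_def by blast
  note t = f p(1,2) j(1,2) g(1)
  let ?k = "p \<cdot> (g \<cdot> j)"
  have fp: "mor (f \<cdot> p) x' y" and jfp: "mor (j \<cdot> (f \<cdot> p)) x' y'" and gj: "mor (g \<cdot> j) y x'"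
    using t by (blast intro: mor_comp)+
  have k: "mor ?k y x" using t by (blast intro: mor_comp)
  have 1: "j' \<cdot> (j \<cdot> (f \<cdot> p)) = f \<cdot> p"
    using m_assoc[OF j(2,1) fp] j(3) m_id(1)[OF fp] by simp
  have 2: "(f \<cdot> p) \<cdot> p' = f" using m_assoc[OF f p(1,2)] p(3) m_id(2)[OF f] by simp
  have "(j \<cdot> (f \<cdot> p)) \<cdot> (g \<cdot> (j \<cdot> (f \<cdot> p))) = j \<cdot> ((f \<cdot> p) \<cdot> (g \<cdot> (j \<cdot> (f \<cdot> p))))"
    using m_assoc[OF j(1) fp mor_comp[OF g(1) jfp]] .
  then have "j' \<cdot> (j \<cdot> ((f \<cdot> p) \<cdot> (g \<cdot> (j \<cdot> (f \<cdot> p))))) = f \<cdot> p"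
    using g(2) 1 by simp
  moreover have m1: "mor ((f \<cdot> p) \<cdot> (g \<cdot> (j \<cdot> (f \<cdot> p)))) x' y" using fp g(1) jfp by (blast intro: mor_comp)
  ultimately have 3: "(f \<cdot> p) \<cdot> (g \<cdot> (j \<cdot> (f \<cdot> p))) = f \<cdot> p"
    using m_assoc[OF j(2,1) m1] j(3) m_id(1)[OF m1] by simp
  have "g \<cdot> (j \<cdot> (f \<cdot> p)) = (g \<cdot> j) \<cdot> (f \<cdot> p)" using m_assoc[OF g(1) j(1) fp] by simp
  then have "f \<cdot> ((?k \<cdot> f) \<cdot> p) = f \<cdot> p"
    using 3 m_assoc[OF f p(1) mor_comp[OF gj fp]] m_assoc[OF k f p(1)] m_assoc[OF p(1) gj fp] by simp
  then have "((f \<cdot> (?k \<cdot> f)) \<cdot> p) \<cdot> p' = f" using m_assoc[OF f mor_comp[OF k f] p(1)] 2 by simp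
  then have "f \<cdot> (?k \<cdot> f) = f"
    using m_assoc[OF mor_comp[OF f mor_comp[OF k f]] p(1,2)] p(3) m_id(2)[OF mor_comp[OF f mor_comp[OF k f]]]
    by simp
  then show ?thesis unfolding regular_def using f k by blast
qed

lemma is_inverse_mor:
  "\<lbrakk>x \<in> Obj; y \<in> Obj; is_inverse x y f g\<rbrakk> \<Longrightarrow> mor f x y \<and> mor g y x \<and> g \<cdot> f = idm x \<and> f \<cdot> g = idm y"
  by (simp add: is_inverse_def mor_def)

lemma inv_mor_eq:
  assumes "x \<in> Obj" "y \<in> Obj" "is_inverse x y f g"
  shows "inv_mor x y f = g"
  unfolding inv_mor_def
proof (rule the_equality)
  fix h assume "is_inverse x y f h"
  then have h: "mor f x y" "mor h y x" "h \<cdot> f = idm x" and g: "mor g y x" "f \<cdot> g = idm y"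
    using is_inverse_mor assms by blast+
  show "h = g" using m_assoc[OF h(2,1) g(1)] h(3) g(2) m_id[OF g(1)] m_id[OF h(2)] by simp
qed (rule assms)

lemma inv_mor:
  assumes "x \<in> Obj" "y \<in> Obj" "is_iso x y f"
  shows "mor f x y" "mor (inv_mor x y f) y x" "inv_mor x y f \<cdot> f = idm x" "f \<cdot> inv_mor x y f = idm y"
proof -
  obtain g where "is_inverse x y f g" using assms(3) by (auto simp: is_iso_def)
  then have "is_inverse x y f (inv_mor x y f)" using inv_mor_eq assms by metis
  then show "mor f x y" "mor (inv_mor x y f) y x" "inv_mor x y f \<cdot> f = idm x" "f \<cdot> inv_mor x y f = idm y"
    using is_inverse_mor assms(1,2) by blast+
qed

end

section \<open>Schur's lemma and regularity in a semisimple category\<close>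

context semisimple_category
begin

text \<open>Simplicity is phrased through monomorphisms, so it is applied twice: to the kernel of
  \<open>f\<close>, a mono into \<open>x\<close> that cannot be invertible because \<open>f\<close>
  is nonzero and is therefore zero, and then to \<open>f\<close> itself, which has become a mono
  into \<open>y\<close>.\<close>

lemma schur:
  assumes "simple x" "simple y" "mor f x y" "f \<noteq> 0"
  shows "is_iso x y f"
proof -
  have x: "x \<in> Obj" and y: "y \<in> Obj" using assms by (auto simp: simple_def)
  obtain k j where k: "is_kernel x y f k j"
    using kernels[OF x y mor_Hom[OF assms(3)]] by blast
  then have kO: "k \<in> Obj" and j: "mor j k x" and fj: "f \<cdot> j = 0"
    using x by (auto simp: is_kernel_def mor_def)
  have U: "\<exists>!h. h \<in> Hom w k \<and> j \<cdot> h = g" if "w \<in> Obj" "g \<in> Hom w x" "f \<cdot> g = 0" for w g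
    using k that by (auto simp: is_kernel_def)
  have "is_mono k x j"
    unfolding is_mono_def
  proof (intro conjI ballI impI)
    fix w g h assume w: "w \<in> Obj" "g \<in> Hom w k" "h \<in> Hom w k" "j \<cdot> g = j \<cdot> h"
    have g: "mor g w k" using w kO by (simp add: mor_def)
    have "f \<cdot> (j \<cdot> g) = 0" using m_assoc[OF assms(3) j g] fj m_zero(1)[OF g y] by simp
    then have "\<exists>!h. h \<in> Hom w k \<and> j \<cdot> h = j \<cdot> g"
      using U[OF w(1)] mor_Hom[OF mor_comp[OF j g]] by blast
    then show "g = h" using w by metis
  qed (use j in \<open>simp add: mor_def\<close>)
  then consider "j = 0" | "is_iso k x j"
    using assms(1) kO by (auto simp: simple_def)
  then have "j = 0"
  proof cases
    case 2
    then obtain j' where j': "mor j' x k" "j \<cdot> j' = idm x"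
      using is_inverse_mor[OF kO x] unfolding is_iso_def by blast
    then have "f = (f \<cdot> j) \<cdot> j'" using m_assoc[OF assms(3) j j'(1)] m_id[OF assms(3)] by simp
    then show ?thesis using fj m_zero(1)[OF j'(1) y] assms(4) by simp
  qed
  have "is_mono x y f"
    unfolding is_mono_def
  proof (intro conjI ballI impI)
    fix w g h assume w: "w \<in> Obj" "g \<in> Hom w x" "h \<in> Hom w x" "f \<cdot> g = f \<cdot> h"
    have g: "mor g w x" and h: "mor h w x" using w x by (simp_all add: mor_def)
    have "f \<cdot> (g - h) = 0" using m_diff(2)[OF assms(3) g h] w by simp
    then obtain u where "mor u w k" "j \<cdot> u = g - h"
      using U[OF w(1) mor_Hom[OF mor_diff[OF g h]]] w kO by (auto simp: mor_def)
    then show "g = h" using \<open>j = 0\<close> m_zero(1)[of u w k x] x by simp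
  qed (use assms(3) in \<open>simp add: mor_def\<close>)
  then show ?thesis using assms(2,4) x by (auto simp: simple_def)
qed

text \<open>Gaussian elimination, by induction on the number of simple summands of \<open>x\<close>
  on which \<open>f\<close> does not vanish. Subtracting the contribution of a nonzero block,
  invertible by Schur's lemma, lowers this number, and McCoy's lemma lifts regularity back.\<close>

lemma regular:
  assumes "mor f x y"
  shows "regular x y f"
proof -
  have x: "x \<in> Obj" and y: "y \<in> Obj" using assms by (auto simp: mor_def)
  obtain n xs i p where X: "\<And>l. l < n \<Longrightarrow> simple (xs l)" "is_direct_sum n xs x i p"
    using sum_of_simples[OF x] by blast
  obtain n' ys i' p' where Y: "\<And>l. l < n' \<Longrightarrow> simple (ys l)" "is_direct_sum n' ys y i' p'"
    using sum_of_simples[OF y] by blast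
  have xsO: "xs l \<in> Obj" and i: "mor (i l) (xs l) x" and p: "mor (p l) x (xs l)" if "l < n" for l
    using X that x by (auto simp: simple_def is_direct_sum_def mor_def)
  have ysO: "ys l \<in> Obj" and i': "mor (i' l) (ys l) y" and p': "mor (p' l) y (ys l)" if "l < n'" for l
    using Y that y by (auto simp: simple_def is_direct_sum_def mor_def)
  have sx: "(\<Sum>l<n. i l \<cdot> p l) = idm x" and sy: "(\<Sum>l<n'. i' l \<cdot> p' l) = idm y"
    and pi: "\<And>l. l < n \<Longrightarrow> p l \<cdot> i l = idm (xs l)"
    using X Y by (auto simp: is_direct_sum_def)
  show ?thesis
    using assms
  proof (induction "card {l. l < n \<and> f \<cdot> i l \<noteq> 0}" arbitrary: f rule: less_induct)
    case (less f)
    note f = less.prems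
    show ?case
    proof (cases "\<exists>l<n. f \<cdot> i l \<noteq> 0")
      case False
      have "f = f \<cdot> (\<Sum>l<n. i l \<cdot> p l)" using sx m_id[OF f] by simp
      also have "\<dots> = (\<Sum>l<n. f \<cdot> (i l \<cdot> p l))"
        using i p by (intro m_sum'[OF x x f]) (auto intro: mor_comp)
      also have "\<dots> = (\<Sum>l<n. 0)"
      proof (rule sum.cong)
        fix l assume "l \<in> {..<n}"
        then show "f \<cdot> (i l \<cdot> p l) = 0"
          using False m_assoc[OF f i p, of l] m_zero(1)[OF p y, of l] by simp
      qed simp
      finally show ?thesis using regular_zero[OF x y] by simp
    next
      case True
      then obtain l where l: "l < n" "f \<cdot> i l \<noteq> 0" by blast
      have fi: "mor (f \<cdot> i l) (xs l) y" using f i[OF l(1)] by (rule mor_comp)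
      have "\<exists>k<n'. p' k \<cdot> (f \<cdot> i l) \<noteq> 0"
      proof (rule ccontr)
        assume *: "\<not> ?thesis"
        have "f \<cdot> i l = (\<Sum>k<n'. i' k \<cdot> p' k) \<cdot> (f \<cdot> i l)" using sy m_id[OF fi] by simp
        also have "\<dots> = (\<Sum>k<n'. (i' k \<cdot> p' k) \<cdot> (f \<cdot> i l))"
          using i' p' by (intro m_sum[OF y y fi]) (auto intro: mor_comp)
        also have "\<dots> = (\<Sum>k<n'. 0)"
        proof (rule sum.cong)
          fix k assume "k \<in> {..<n'}"
          then show "(i' k \<cdot> p' k) \<cdot> (f \<cdot> i l) = 0"
            using * m_assoc[OF i' p' fi, of k] m_zero(2)[OF i' xsO[OF l(1)], of k] by simp
        qed simp
        finally show False using l(2) by simp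
      qed
      then obtain k where k: "k < n'" "p' k \<cdot> (f \<cdot> i l) \<noteq> 0" by blast
      let ?q = "p' k \<cdot> (f \<cdot> i l)"
      have q: "mor ?q (xs l) (ys k)" using p'[OF k(1)] fi by (rule mor_comp)
      obtain q' where q': "mor q' (ys k) (xs l)" "q' \<cdot> ?q = idm (xs l)"
        using schur[OF X(1)[OF l(1)] Y(1)[OF k(1)] q k(2)] is_inverse_mor[OF xsO ysO] l(1) k(1)
        unfolding is_iso_def by blast
      \<comment> \<open>The inverse of the pivot block, extended by zero. It satisfies
        \<open>g \<cdot> (f \<cdot> i l) = i l\<close>, so the remainder \<open>?f'\<close> vanishes
        on summand \<open>l\<close>, and it still vanishes wherever \<open>f\<close> does.\<close>
      define g where "g = i l \<cdot> (q' \<cdot> p' k)"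
      have qp: "mor (q' \<cdot> p' k) y (xs l)" using q'(1) p'[OF k(1)] by (rule mor_comp)
      have g: "mor g y x" unfolding g_def using i[OF l(1)] qp by (rule mor_comp)
      let ?f' = "f - f \<cdot> (g \<cdot> f)"
      have gf: "mor (g \<cdot> f) x x" using g f by (rule mor_comp)
      have fgf: "mor (f \<cdot> (g \<cdot> f)) x y" using f gf by (rule mor_comp)
      have f': "mor ?f' x y" using f fgf by (rule mor_diff)
      have e: "?f' \<cdot> i j = f \<cdot> i j - f \<cdot> (g \<cdot> (f \<cdot> i j))" if "j < n" for j
        using m_diff(1)[OF f fgf i[OF that]] m_assoc[OF f gf i[OF that]] m_assoc[OF g f i[OF that]] by simp
      have "g \<cdot> (f \<cdot> i l) = i l"
        unfolding g_def
        using m_assoc[OF i[OF l(1)] qp fi] m_assoc[OF q'(1) p'[OF k(1)] fi] q'(2) m_id[OF i[OF l(1)]] by simp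
      then have z: "?f' \<cdot> i l = 0" using e[OF l(1)] by simp
      have "?f' \<cdot> i j = 0" if "j < n" "f \<cdot> i j = 0" for j
        using e[OF that(1)] that m_zero(2)[OF g, of "xs j"] m_zero(2)[OF f, of "xs j"] xsO[OF that(1)] by simp
      then have "{j. j < n \<and> ?f' \<cdot> i j \<noteq> 0} \<subseteq> {j. j < n \<and> f \<cdot> i j \<noteq> 0}" by blast
      moreover have "l \<in> {j. j < n \<and> f \<cdot> i j \<noteq> 0}" "l \<notin> {j. j < n \<and> ?f' \<cdot> i j \<noteq> 0}" using l z by auto
      ultimately have "{j. j < n \<and> ?f' \<cdot> i j \<noteq> 0} \<subset> {j. j < n \<and> f \<cdot> i j \<noteq> 0}" by blast
      then have "card {j. j < n \<and> ?f' \<cdot> i j \<noteq> 0} < card {j. j < n \<and> f \<cdot> i j \<noteq> 0}"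
        by (intro psubset_card_mono) auto
      from less.hyps[OF this f'] show ?thesis by (rule regular_if_regular_diff[OF f g])
    qed
  qed
qed

end

section \<open>Direct sums, split kernels and semisimplicity from regularity\<close>

context linear_category
begin

lemma is_direct_sum_empty: "\<lbrakk>s \<in> Obj; idm s = 0\<rbrakk> \<Longrightarrow> is_direct_sum 0 x s incl proj"
  by (simp add: is_direct_sum_def)

lemma is_direct_sum_single: "s \<in> Obj \<Longrightarrow> is_direct_sum 1 (\<lambda>_. s) s (\<lambda>_. idm s) (\<lambda>_. idm s)"
  using m_id(1)[OF mor_id] by (auto simp: is_direct_sum_def id_in_Hom)

text \<open>Refines a decomposition of \<open>s\<close> into \<open>y\<close> and \<open>z\<close>:
  indices below \<open>n\<close> belong to the summands of \<open>y\<close>, and index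
  \<open>n + l\<close> is summand \<open>l\<close> of \<open>z\<close>.\<close>

lemma is_direct_sum_append:
  assumes s: "s \<in> Obj"
    and f: "mor f y s" "mor g s y" "g \<cdot> f = idm y"
    and j: "mor j z s" "mor p s z" "p \<cdot> j = idm z"
    and o: "g \<cdot> j = 0" "p \<cdot> f = 0" and sum: "f \<cdot> g + j \<cdot> p = idm s"
    and A: "is_direct_sum n a y ia pa" "\<And>l. l < n \<Longrightarrow> a l \<in> Obj"
    and B: "is_direct_sum k b z ib pb" "\<And>l. l < k \<Longrightarrow> b l \<in> Obj"
  shows "is_direct_sum (n + k) (\<lambda>l. if l < n then a l else b (l - n)) s
    (\<lambda>l. if l < n then f \<cdot> ia l else j \<cdot> ib (l - n))
    (\<lambda>l. if l < n then pa l \<cdot> g else pb (l - n) \<cdot> p)"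
proof -
  have y: "y \<in> Obj" and z: "z \<in> Obj" using f j by (auto simp: mor_def)
  have ia: "mor (ia l) (a l) y" and pa: "mor (pa l) y (a l)" if "l < n" for l
    using A that y by (auto simp: is_direct_sum_def mor_def)
  have ib: "mor (ib l) (b l) z" and pb: "mor (pb l) z (b l)" if "l < k" for l
    using B that z by (auto simp: is_direct_sum_def mor_def)
  have oa: "pa l \<cdot> ia l' = (if l = l' then idm (a l) else 0)" if "l < n" "l' < n" for l l'
    using A that by (auto simp: is_direct_sum_def)
  have ob: "pb l \<cdot> ib l' = (if l = l' then idm (b l) else 0)" if "l < k" "l' < k" for l l'
    using B that by (auto simp: is_direct_sum_def)
  have sa: "(\<Sum>l<n. ia l \<cdot> pa l) = idm y" and sb: "(\<Sum>l<k. ib l \<cdot> pb l) = idm z"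
    using A B by (auto simp: is_direct_sum_def)
  have fia: "mor (f \<cdot> ia l) (a l) s" and pag: "mor (pa l \<cdot> g) s (a l)" if "l < n" for l
    using f ia pa that by (blast intro: mor_comp)+
  have jib: "mor (j \<cdot> ib l) (b l) s" and pbp: "mor (pb l \<cdot> p) s (b l)" if "l < k" for l
    using j ib pb that by (blast intro: mor_comp)+
  have c: "(u \<cdot> v) \<cdot> (v' \<cdot> u') = u \<cdot> ((v \<cdot> v') \<cdot> u')"
    if "mor u w w'" "mor v x w" "mor v' w'' x" "mor u' x' w''" for u v v' u' w w' w'' x x'
    using m_assoc[OF that(1,2) mor_comp[OF that(3,4)]] m_assoc[OF that(2,3,4)] by simp
  have aa: "(pa l \<cdot> g) \<cdot> (f \<cdot> ia l') = (if l = l' then idm (a l) else 0)" if "l < n" "l' < n" for l l'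
    using c[OF pa f(2,1) ia] f(3) m_id[OF ia] that oa by simp
  have bb: "(pb l \<cdot> p) \<cdot> (j \<cdot> ib l') = (if l = l' then idm (b l) else 0)" if "l < k" "l' < k" for l l'
    using c[OF pb j(2,1) ib] j(3) m_id[OF ib] that ob by simp
  have ab: "(pa l \<cdot> g) \<cdot> (j \<cdot> ib l') = 0" if "l < n" "l' < k" for l l'
    using c[OF pa f(2) j(1) ib] o(1) m_zero(1)[OF ib y] m_zero(2)[OF pa B(2)] that by simp
  have ba: "(pb l \<cdot> p) \<cdot> (f \<cdot> ia l') = 0" if "l < k" "l' < n" for l l'
    using c[OF pb j(2) f(1) ia] o(2) m_zero(1)[OF ia z] m_zero(2)[OF pb A(2)] that by simp
  have "(\<Sum>l<n. (f \<cdot> ia l) \<cdot> (pa l \<cdot> g)) = (\<Sum>l<n. f \<cdot> ((ia l \<cdot> pa l) \<cdot> g))"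
    using c[OF f(1) ia pa f(2)] by (intro sum.cong) auto
  also have "\<dots> = f \<cdot> (\<Sum>l<n. (ia l \<cdot> pa l) \<cdot> g)"
    using m_sum'[OF s y f(1), of "{..<n}" "\<lambda>l. (ia l \<cdot> pa l) \<cdot> g"] mor_comp[OF mor_comp[OF ia pa] f(2)]
    by auto
  also have "(\<Sum>l<n. (ia l \<cdot> pa l) \<cdot> g) = (\<Sum>l<n. ia l \<cdot> pa l) \<cdot> g"
    using m_sum[OF y y f(2), of "{..<n}" "\<lambda>l. ia l \<cdot> pa l"] mor_comp[OF ia pa] by auto
  finally have s1: "(\<Sum>l<n. (f \<cdot> ia l) \<cdot> (pa l \<cdot> g)) = f \<cdot> g" using sa m_id(1)[OF f(2)] by simp
  have "(\<Sum>l<k. (j \<cdot> ib l) \<cdot> (pb l \<cdot> p)) = (\<Sum>l<k. j \<cdot> ((ib l \<cdot> pb l) \<cdot> p))"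
    using c[OF j(1) ib pb j(2)] by (intro sum.cong) auto
  also have "\<dots> = j \<cdot> (\<Sum>l<k. (ib l \<cdot> pb l) \<cdot> p)"
    using m_sum'[OF s z j(1), of "{..<k}" "\<lambda>l. (ib l \<cdot> pb l) \<cdot> p"] mor_comp[OF mor_comp[OF ib pb] j(2)]
    by auto
  also have "(\<Sum>l<k. (ib l \<cdot> pb l) \<cdot> p) = (\<Sum>l<k. ib l \<cdot> pb l) \<cdot> p"
    using m_sum[OF z z j(2), of "{..<k}" "\<lambda>l. ib l \<cdot> pb l"] mor_comp[OF ib pb] by auto
  finally have s2: "(\<Sum>l<k. (j \<cdot> ib l) \<cdot> (pb l \<cdot> p)) = j \<cdot> p" using sb m_id(1)[OF j(2)] by simp
  let ?I = "\<lambda>l. if l < n then f \<cdot> ia l else j \<cdot> ib (l - n)"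
    and ?P = "\<lambda>l. if l < n then pa l \<cdot> g else pb (l - n) \<cdot> p"
  have "(\<Sum>l<n + k. ?I l \<cdot> ?P l) = (\<Sum>l<n. ?I l \<cdot> ?P l) + (\<Sum>l<k. ?I (n + l) \<cdot> ?P (n + l))"
    by (induction k) (simp_all add: add.assoc)
  also have "\<dots> = idm s" using s1 s2 sum by simp
  finally have "(\<Sum>l<n + k. ?I l \<cdot> ?P l) = idm s" .
  moreover have "?I l \<in> Hom (if l < n then a l else b (l - n)) s \<and>
      ?P l \<in> Hom s (if l < n then a l else b (l - n))" if "l < n + k" for l
    using that fia[of l] pag[of l] jib[of "l - n"] pbp[of "l - n"] by (auto simp: mor_def)
  moreover have "?P l \<cdot> ?I l' = (if l = l' then idm (if l < n then a l else b (l - n)) else 0)"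
    if "l < n + k" "l' < n + k" for l l'
  proof -
    have "l - n < k" if "\<not> l < n" using that \<open>l < n + k\<close> by simp
    moreover have "l' - n < k" if "\<not> l' < n" using that \<open>l' < n + k\<close> by simp
    moreover have "l - n = l' - n \<longleftrightarrow> l = l'" if "\<not> l < n" "\<not> l' < n" using that by arith
    ultimately show ?thesis
      using aa[of l l'] bb[of "l - n" "l' - n"] ab[of l "l' - n"] ba[of "l - n" l']
      by (cases "l < n"; cases "l' < n") auto
  qed
  ultimately show ?thesis unfolding is_direct_sum_def using s by blast
qed

text \<open>Supplies the measure for cutting an object into simple pieces. Sending \<open>h\<close>
  to \<open>f \<cdot> (h \<cdot> g)\<close> embeds the endomorphisms of \<open>y\<close> into the
  endomorphisms of \<open>s\<close> that absorb \<open>f \<cdot> g\<close> on the right; the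
  identity of \<open>s\<close> is not among these, so the dimension drops.\<close>

lemma dim_End_less:
  assumes f: "mor f y s" and g: "mor g s y" and gf: "g \<cdot> f = idm y" and ne: "f \<cdot> g \<noteq> idm s"
  shows "dim (Hom y y) < dim (Hom s s)"
proof -
  interpret vector_space_pair "scale C" "scale C" ..
  have y: "y \<in> Obj" and s: "s \<in> Obj" using f by (auto simp: mor_def)
  let ?q = "\<lambda>h. f \<cdot> (h \<cdot> g)"
  have q: "mor (?q h) s s" and hg: "mor (h \<cdot> g) s y" if "mor h y y" for h
    using that f g by (blast intro: mor_comp)+
  have H: "mor h y y" if "h \<in> Hom y y" for h using that y by (simp add: mor_def)
  have gq: "g \<cdot> (?q h \<cdot> f) = h" if "mor h y y" for h
  proof -
    have "?q h \<cdot> f = f \<cdot> h"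
      using m_assoc[OF f hg[OF that] f] m_assoc[OF that g f] gf m_id(2)[OF that] by simp
    then show ?thesis using m_assoc[OF g f that] gf m_id(1)[OF that] by simp
  qed
  have qe: "?q h \<cdot> (f \<cdot> g) = ?q h" if "mor h y y" for h
  proof -
    have "?q h \<cdot> (f \<cdot> g) = (?q h \<cdot> f) \<cdot> g" using m_assoc[OF q[OF that] f g] by simp
    also have "?q h \<cdot> f = f \<cdot> h"
      using m_assoc[OF f hg[OF that] f] m_assoc[OF that g f] gf m_id(2)[OF that] by simp
    finally show ?thesis using m_assoc[OF f that g] by simp
  qed
  have sH: "subspace (Hom y y)" "subspace (Hom s s)" using Hom_subspace y s by auto
  obtain B where B: "B \<subseteq> Hom y y" "independent B" "Hom y y \<subseteq> span B" "card B = dim (Hom y y)"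
    using basis_exists by blast
  have add: "?q (u + v) = ?q u + ?q v" if "u \<in> Hom y y" "v \<in> Hom y y" for u v
    using m_add(1)[OF H H g] m_add(2)[OF f hg[OF H] hg[OF H]] that by simp
  have sc: "?q (scale C c v) = scale C c (?q v)" if "v \<in> Hom y y" for c v
    using m_scale(1)[OF H g] m_scale(2)[OF f hg[OF H]] that by simp
  have inj: "v = 0" if "v \<in> Hom y y" "?q v = 0" for v
    using gq[OF H[OF that(1)]] that(2) m_zero(1)[OF f s] m_zero(2)[OF g y] by simp
  note im = independent_image_on_subspace[of "Hom y y" B ?q, OF sH(1) B(1,2) add sc inj]
  have qB: "?q ` B \<subseteq> Hom s s" using B(1) q[OF H] mor_Hom by blast
  let ?V = "{h \<in> Hom s s. h \<cdot> (f \<cdot> g) = h}"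
  have fg: "mor (f \<cdot> g) s s" using f g by (rule mor_comp)
  have Hs: "mor h s s" if "h \<in> Hom s s" for h using that s by (simp add: mor_def)
  have "subspace ?V"
    unfolding subspace_def
    using m_zero(1)[OF fg s] m_add(1)[OF Hs Hs fg] m_scale(1)[OF Hs fg]
      subspace_0[OF sH(2)] subspace_add[OF sH(2)] subspace_scale[OF sH(2)]
    by auto
  moreover have "?q ` B \<subseteq> ?V" using qB qe[OF H] B(1) by auto
  ultimately have "span (?q ` B) \<subseteq> ?V" by (intro span_minimal)
  moreover have "idm s \<notin> ?V" using m_id(1)[OF fg] ne by simp
  ultimately have n: "idm s \<notin> span (?q ` B)" by blast
  then have I: "independent (insert (idm s) (?q ` B))" using im(1) by (intro independent_insertI)
  obtain B0 where B0: "finite B0" "span B0 = Hom s s" using Hom_finite_dim s by blast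
  have "insert (idm s) (?q ` B) \<subseteq> Hom s s" using qB id_in_Hom[OF s] by blast
  from independent_card_le_dim_finite[OF B0 this I]
  have "finite (?q ` B)" "card (insert (idm s) (?q ` B)) \<le> dim (Hom s s)" by auto
  moreover have "idm s \<notin> ?q ` B" using n span_base[of "idm s" "?q ` B"] by argo
  ultimately have "Suc (card (?q ` B)) \<le> dim (Hom s s)" by (metis card_insert_disjoint)
  then show ?thesis using card_image[OF im(2)] B(4) by linarith
qed

text \<open>If \<open>h \<cdot> f = idm x - j \<cdot> p\<close>, every \<open>u\<close> with
  \<open>f \<cdot> u = 0\<close> equals \<open>j \<cdot> (p \<cdot> u)\<close> and so factors
  through \<open>j\<close>. In the application \<open>h\<close> is a quasi-inverse of
  \<open>f\<close>, or the identity when \<open>f\<close> is an idempotent.\<close>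

lemma is_kernel_if_split:
  assumes f: "mor f x y" and j: "mor j k x" "mor p x k" "p \<cdot> j = idm k"
    and fj: "f \<cdot> j = 0" and h: "mor h y x" "h \<cdot> f = idm x - j \<cdot> p"
  shows "is_kernel x y f k j"
proof -
  have O: "x \<in> Obj" "k \<in> Obj" using j by (auto simp: mor_def)
  have jp: "mor (j \<cdot> p) x x" using j by (blast intro: mor_comp)
  have "\<exists>!v. v \<in> Hom w k \<and> j \<cdot> v = u" if w: "w \<in> Obj" "u \<in> Hom w x" "f \<cdot> u = 0" for w u
  proof
    have u: "mor u w x" using w O by (simp add: mor_def)
    have "(idm x - j \<cdot> p) \<cdot> u = 0"
      using m_assoc[OF h(1) f u] w(3) m_zero(2)[OF h(1) w(1)] h(2) by simp
    then have "j \<cdot> (p \<cdot> u) = u"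
      using m_diff(1)[OF mor_id[OF O(1)] jp u] m_id(1)[OF u] m_assoc[OF j(1,2) u] by simp
    then show "p \<cdot> u \<in> Hom w k \<and> j \<cdot> (p \<cdot> u) = u" using mor_Hom[OF mor_comp[OF j(2) u]] by simp
    fix v assume v: "v \<in> Hom w k \<and> j \<cdot> v = u"
    then have "mor v w k" using w O by (simp add: mor_def)
    then show "v = p \<cdot> u" using m_assoc[OF j(2,1)] j(3) m_id(1) v by metis
  qed
  then show ?thesis using j(1) fj by (simp add: is_kernel_def mor_def)
qed

lemma is_cokernel_if_split:
  assumes f: "mor f x y" and j: "mor j k y" "mor p y k" "p \<cdot> j = idm k"
    and pf: "p \<cdot> f = 0" and h: "mor h y x" "f \<cdot> h = idm y - j \<cdot> p"
  shows "is_cokernel x y f k p"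
proof -
  have O: "y \<in> Obj" "k \<in> Obj" using j by (auto simp: mor_def)
  have jp: "mor (j \<cdot> p) y y" using j by (blast intro: mor_comp)
  have "\<exists>!v. v \<in> Hom k w \<and> v \<cdot> p = u" if w: "w \<in> Obj" "u \<in> Hom y w" "u \<cdot> f = 0" for w u
  proof
    have u: "mor u y w" using w O by (simp add: mor_def)
    have "u \<cdot> (idm y - j \<cdot> p) = 0"
      using m_assoc[OF u f h(1)] w(3) m_zero(1)[OF h(1) w(1)] h(2) by simp
    then have "(u \<cdot> j) \<cdot> p = u"
      using m_diff(2)[OF u mor_id[OF O(1)] jp] m_id(2)[OF u] m_assoc[OF u j(1,2)] by simp
    then show "u \<cdot> j \<in> Hom k w \<and> (u \<cdot> j) \<cdot> p = u" using mor_Hom[OF mor_comp[OF u j(1)]] by simp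
    fix v assume v: "v \<in> Hom k w \<and> v \<cdot> p = u"
    then have "mor v k w" using w O by (simp add: mor_def)
    then show "v = u \<cdot> j" using m_assoc[OF _ j(2,1)] j(3) m_id(2) v by metis
  qed
  then show ?thesis using j(2) pf by (simp add: is_cokernel_def mor_def)
qed

text \<open>All of the abelian structure comes from a quasi-inverse \<open>g\<close> of
  \<open>f\<close>: the idempotents \<open>idm x - g \<cdot> f\<close> and
  \<open>idm y - f \<cdot> g\<close> split to give a kernel and a cokernel, and cancelling a mono or
  an epi in \<open>f \<cdot> (g \<cdot> f) = f\<close> shows that it splits.\<close>

theorem semisimple_category_if_regular:
  assumes sums: "\<And>n xs. (\<And>i. i < n \<Longrightarrow> xs i \<in> Obj) \<Longrightarrow> \<exists>s incl proj. is_direct_sum n xs s incl proj"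
    and split: "\<And>x e. \<lbrakk>mor e x x; e \<cdot> e = e\<rbrakk>
      \<Longrightarrow> \<exists>y j p. mor j y x \<and> mor p x y \<and> p \<cdot> j = idm y \<and> j \<cdot> p = e"
    and reg: "\<And>x y f. mor f x y \<Longrightarrow> regular x y f"
  shows "semisimple_category C"
proof -
  have M: "mor f x y" if "f \<in> Hom x y" "x \<in> Obj" "y \<in> Obj" for f x y using that by (simp add: mor_def)
  have ex: "\<exists>g. mor g y x \<and> f \<cdot> (g \<cdot> f) = f" if "mor f x y" for x y f
    using reg[OF that] by (simp add: regular_def)
  have co: "mor (idm x - e) x x" "(idm x - e) \<cdot> (idm x - e) = idm x - e"
    if e: "mor e x x" "e \<cdot> e = e" for x e
  proof -
    have i: "mor (idm x) x x" using e by (intro mor_id) (simp add: mor_def)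
    show d: "mor (idm x - e) x x" using i e(1) by (rule mor_diff)
    show "(idm x - e) \<cdot> (idm x - e) = idm x - e"
      using m_diff(1)[OF i e(1) d] m_diff(2)[OF e(1) i e(1)] e(2) m_id[OF e(1)] m_id[OF d] by simp
  qed
  have idem: "(f \<cdot> g) \<cdot> (f \<cdot> g) = f \<cdot> g" "(g \<cdot> f) \<cdot> (g \<cdot> f) = g \<cdot> f"
    if "mor f x y" "mor g y x" "f \<cdot> (g \<cdot> f) = f" for f g x y
  proof -
    have fg: "mor (f \<cdot> g) y y" and gf: "mor (g \<cdot> f) x x" using that by (blast intro: mor_comp)+
    show "(f \<cdot> g) \<cdot> (f \<cdot> g) = f \<cdot> g"
      using m_assoc[OF fg that(1,2)] m_assoc[OF that(1,2,1)] that(3) by simp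
    show "(g \<cdot> f) \<cdot> (g \<cdot> f) = g \<cdot> f"
      using m_assoc[OF that(2,1) gf] that(3) by simp
  qed
  have kern: "\<exists>k j. is_kernel x y f k j" if f: "mor f x y" for x y f
  proof -
    obtain g where g: "mor g y x" "f \<cdot> (g \<cdot> f) = f" using ex[OF f] by blast
    have x: "x \<in> Obj" using f by (simp add: mor_def)
    have gf: "mor (g \<cdot> f) x x" using g f by (blast intro: mor_comp)
    let ?e = "idm x - g \<cdot> f"
    have e: "mor ?e x x" "?e \<cdot> ?e = ?e" using co[OF gf idem(2)[OF f g]] by auto
    obtain k j p where k: "mor j k x" "mor p x k" "p \<cdot> j = idm k" "j \<cdot> p = ?e" using split[OF e] by blast
    have fe: "f \<cdot> ?e = 0" using m_diff(2)[OF f mor_id[OF x] gf] g m_id[OF f] by simp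
    have "f \<cdot> j = f \<cdot> ((j \<cdot> p) \<cdot> j)" using m_assoc[OF k(1,2,1)] k(3) m_id(2)[OF k(1)] by simp
    also have "\<dots> = (f \<cdot> ?e) \<cdot> j" using m_assoc[OF f e(1) k(1)] k(4) by simp
    finally have fj: "f \<cdot> j = 0" using fe m_zero(1)[OF k(1) mor_Obj(2)[OF f]] by simp
    have "is_kernel x y f k j"
      by (rule is_kernel_if_split[OF f k(1-3) fj g(1)]) (simp add: k(4))
    then show ?thesis by blast
  qed
  have coker: "\<exists>q p. is_cokernel x y f q p" if f: "mor f x y" for x y f
  proof -
    obtain g where g: "mor g y x" "f \<cdot> (g \<cdot> f) = f" using ex[OF f] by blast
    have y: "y \<in> Obj" using f by (simp add: mor_def)
    have fg: "mor (f \<cdot> g) y y" using g f by (blast intro: mor_comp)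
    let ?e = "idm y - f \<cdot> g"
    have e: "mor ?e y y" "?e \<cdot> ?e = ?e" using co[OF fg idem(1)[OF f g]] by auto
    obtain k j p where k: "mor j k y" "mor p y k" "p \<cdot> j = idm k" "j \<cdot> p = ?e" using split[OF e] by blast
    have ef: "?e \<cdot> f = 0" using m_diff(1)[OF mor_id[OF y] fg f] g m_id[OF f] m_assoc[OF f g(1) f] by simp
    have "p \<cdot> f = (p \<cdot> (j \<cdot> p)) \<cdot> f" using m_assoc[OF k(2,1,2)] k(3) m_id(1)[OF k(2)] by simp
    also have "\<dots> = p \<cdot> (?e \<cdot> f)" using m_assoc[OF k(2) e(1) f] k(4) by simp
    finally have pf: "p \<cdot> f = 0" using ef m_zero(2)[OF k(2) mor_Obj(1)[OF f]] by simp
    have "is_cokernel x y f k p"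
      by (rule is_cokernel_if_split[OF f k(1-3) pf g(1)]) (simp add: k(4))
    then show ?thesis by blast
  qed
  have mono: "\<exists>g. mor g y x \<and> g \<cdot> f = idm x" if f: "is_mono x y f" "x \<in> Obj" "y \<in> Obj" for x y f
  proof -
    have f': "mor f x y" using f by (simp add: is_mono_def mor_def)
    obtain g where g: "mor g y x" "f \<cdot> (g \<cdot> f) = f" using ex[OF f'] by blast
    have "g \<cdot> f \<in> Hom x x" using mor_comp[OF g(1) f'] by (simp add: mor_def)
    moreover have "f \<cdot> (g \<cdot> f) = f \<cdot> idm x" using g m_id[OF f'] by simp
    ultimately show ?thesis using f id_in_Hom[OF f(2)] g(1) unfolding is_mono_def by blast
  qed
  have epi: "\<exists>g. mor g y x \<and> f \<cdot> g = idm y" if f: "is_epi x y f" "x \<in> Obj" "y \<in> Obj" for x y f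
  proof -
    have f': "mor f x y" using f by (simp add: is_epi_def mor_def)
    obtain g where g: "mor g y x" "f \<cdot> (g \<cdot> f) = f" using ex[OF f'] by blast
    have "f \<cdot> g \<in> Hom y y" using mor_comp[OF f' g(1)] by (simp add: mor_def)
    moreover have "(f \<cdot> g) \<cdot> f = idm y \<cdot> f" using g m_id[OF f'] m_assoc[OF f' g(1) f'] by simp
    ultimately show ?thesis using f id_in_Hom[OF f(3)] g(1) unfolding is_epi_def by blast
  qed
  show ?thesis
  proof
    show "\<exists>s incl proj. is_direct_sum n xs s incl proj" if "\<And>i. i < n \<Longrightarrow> xs i \<in> Obj" for n xs
      using sums that .
    show "\<exists>k j. is_kernel x y f k j" if "x \<in> Obj" "y \<in> Obj" "f \<in> Hom x y" for x y f
      using kern M that by blast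
    show "\<exists>k j. is_cokernel x y f k j" if "x \<in> Obj" "y \<in> Obj" "f \<in> Hom x y" for x y f
      using coker M that by blast
  next
    fix x y f assume x: "x \<in> Obj" and y: "y \<in> Obj" and f: "is_mono x y f"
    obtain g where g: "mor g y x" "g \<cdot> f = idm x" using mono[OF f x y] by blast
    have f': "mor f x y" using f x y by (simp add: is_mono_def mor_def)
    have fg: "mor (f \<cdot> g) y y" using f' g(1) by (rule mor_comp)
    \<comment> \<open>A split mono is the kernel of the complementary idempotent; for this
      idempotent the identity serves as the map \<open>h\<close> of the kernel criterion.\<close>
    let ?e = "idm y - f \<cdot> g"
    have e: "mor ?e y y" using mor_id[OF y] fg by (rule mor_diff)
    have "?e \<cdot> f = 0" using m_diff(1)[OF mor_id[OF y] fg f'] g m_id[OF f'] m_assoc[OF f' g(1) f'] by simp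
    then have "is_kernel y y ?e x f"
      using is_kernel_if_split[OF e f' g(1,2) _ mor_id[OF y]] m_id(1)[OF e] by simp
    then show "\<exists>z\<in>Obj. \<exists>g\<in>Hom y z. is_kernel y z g x f" using y mor_Hom[OF e] by blast
  next
    fix x y f assume x: "x \<in> Obj" and y: "y \<in> Obj" and f: "is_epi x y f"
    obtain g where g: "mor g y x" "f \<cdot> g = idm y" using epi[OF f x y] by blast
    have f': "mor f x y" using f x y by (simp add: is_epi_def mor_def)
    have gf: "mor (g \<cdot> f) x x" using g(1) f' by (rule mor_comp)
    let ?e = "idm x - g \<cdot> f"
    have e: "mor ?e x x" using mor_id[OF x] gf by (rule mor_diff)
    have "f \<cdot> ?e = 0" using m_diff(2)[OF f' mor_id[OF x] gf] g m_id[OF f'] m_assoc[OF f' g(1) f'] by simp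
    then have "is_cokernel x x ?e y f"
      using is_cokernel_if_split[OF e g(1) f' g(2) _ mor_id[OF x]] m_id(2)[OF e] by simp
    then show "\<exists>w\<in>Obj. \<exists>g\<in>Hom w x. is_cokernel w x g y f" using x mor_Hom[OF e] by blast
  next
    fix s assume "s \<in> Obj"
    then show "\<exists>n x incl proj. (\<forall>i<n. simple (x i)) \<and> is_direct_sum n x s incl proj"
    \<comment> \<open>Splitting off a proper subobject leaves two summands whose endomorphism spaces
      are strictly smaller, so finite dimensionality ends the recursion.\<close>
    proof (induction "dim (Hom s s)" arbitrary: s rule: less_induct)
      case less
      note s = less.prems
      show ?case
      \<comment> \<open>A zero object is not simple; it is the sum of no summands.\<close>
      proof (cases "idm s = 0 \<or> simple s")
        case True
        then show ?thesis
        proof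
          assume "idm s = 0"
          then show ?thesis using is_direct_sum_empty[OF s] by (intro exI[of _ 0]) auto
        next
          assume "simple s"
          then show ?thesis
            using is_direct_sum_single[OF s] by (intro exI[of _ 1] exI[of _ "\<lambda>_. s"]) auto
        qed
      next
        case False
        then obtain y f where y: "y \<in> Obj" "is_mono y s f" "f \<noteq> 0" "\<not> is_iso y s f"
          using s by (auto simp: simple_def)
        obtain g where g: "mor g s y" "g \<cdot> f = idm y" using mono[OF y(2,1) s] by blast
        have f: "mor f y s" using y s by (simp add: is_mono_def mor_def)
        have fgf: "f \<cdot> (g \<cdot> f) = f" using g(2) m_id(2)[OF f] by simp
        have fg: "mor (f \<cdot> g) s s" using f g(1) by (rule mor_comp)
        let ?e = "idm s - f \<cdot> g"
        have e: "mor ?e s s" "?e \<cdot> ?e = ?e" using co[OF fg idem(1)[OF f g(1) fgf]] by auto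
        obtain z j p where z: "mor j z s" "mor p s z" "p \<cdot> j = idm z" "j \<cdot> p = ?e" using split[OF e] by blast
        have zO: "z \<in> Obj" using z(1) by (simp add: mor_def)
        have ef: "?e \<cdot> f = 0"
          using m_diff(1)[OF mor_id[OF s] fg f] fgf m_id[OF f] m_assoc[OF f g(1) f] by simp
        have ge: "g \<cdot> ?e = 0"
          using m_diff(2)[OF g(1) mor_id[OF s] fg] m_assoc[OF g(1) f g(1)] g(2) m_id[OF g(1)] by simp
        have "g \<cdot> j = g \<cdot> ((j \<cdot> p) \<cdot> j)" using m_assoc[OF z(1,2,1)] z(3) m_id(2)[OF z(1)] by simp
        also have "\<dots> = (g \<cdot> ?e) \<cdot> j" using m_assoc[OF g(1) e(1) z(1)] z(4) by simp
        finally have gj: "g \<cdot> j = 0" using ge m_zero(1)[OF z(1) y(1)] by simp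
        have "p \<cdot> f = (p \<cdot> (j \<cdot> p)) \<cdot> f" using m_assoc[OF z(2,1,2)] z(3) m_id(1)[OF z(2)] by simp
        also have "\<dots> = p \<cdot> (?e \<cdot> f)" using m_assoc[OF z(2) e(1) f] z(4) by simp
        finally have pf: "p \<cdot> f = 0" using ef m_zero(2)[OF z(2) y(1)] by simp
        \<comment> \<open>Both halves are proper: \<open>f \<cdot> g = idm s\<close> would make
          \<open>f\<close> invertible, and \<open>j \<cdot> p = idm s\<close> would make
          \<open>f\<close> zero.\<close>
        have "f \<cdot> g \<noteq> idm s"
          using y(4) f g by (auto simp: is_iso_def is_inverse_def mor_def)
        then have dy: "dim (Hom y y) < dim (Hom s s)" using dim_End_less[OF f g] by blast
        have "j \<cdot> p \<noteq> idm s"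
        proof
          assume "j \<cdot> p = idm s"
          then have "f \<cdot> g = 0" using z(4) by simp
          then have "f = 0" using fgf m_assoc[OF f g(1) f] m_zero(1)[OF f s] by simp
          then show False using y by simp
        qed
        then have dz: "dim (Hom z z) < dim (Hom s s)" using dim_End_less[OF z(1,2,3)] by blast
        obtain n a ia pa where A: "\<forall>i<n. simple (a i)" "is_direct_sum n a y ia pa"
          using less.hyps[OF dy y(1)] by blast
        obtain k b ib pb where B: "\<forall>i<k. simple (b i)" "is_direct_sum k b z ib pb"
          using less.hyps[OF dz zO] by blast
        have sum: "f \<cdot> g + j \<cdot> p = idm s" using z(4) by simp
        have aO: "\<And>l. l < n \<Longrightarrow> a l \<in> Obj" "\<And>l. l < k \<Longrightarrow> b l \<in> Obj"
          using A(1) B(1) by (auto simp: simple_def)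
        have "\<forall>i<n + k. simple (if i < n then a i else b (i - n))"
          using A(1) B(1) by auto
        then show ?thesis
          using is_direct_sum_append[OF s f g z(1,2,3) gj pf sum A(2) aO(1) B(2) aO(2)]
          by (intro exI conjI) simp_all
      qed
    qed
  qed
qed

end

section \<open>Strictification of a tensor category\<close>

context tensor_category
begin

lemma mor_tens: "\<lbrakk>mor f x x'; mor g y y'\<rbrakk> \<Longrightarrow> mor (f \<odot> g) (x \<otimes> y) (x' \<otimes> y')"
  by (auto simp: mor_def intro: tmor_in_Hom tobj_in_Obj)

lemma m_tens_comp:
  "\<lbrakk>mor f' x' x''; mor f x x'; mor g' y' y''; mor g y y'\<rbrakk>
    \<Longrightarrow> (f' \<cdot> f) \<odot> (g' \<cdot> g) = (f' \<odot> g') \<cdot> (f \<odot> g)"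
  unfolding mor_def using tmor_comp by blast

lemma m_tens_comp_right:
  "\<lbrakk>x \<in> Obj; mor g' y' y''; mor g y y'\<rbrakk> \<Longrightarrow> idm x \<odot> (g' \<cdot> g) = (idm x \<odot> g') \<cdot> (idm x \<odot> g)"
  using m_tens_comp[OF mor_id mor_id] m_id(1)[OF mor_id] by metis

lemma m_tens_comp_left:
  "\<lbrakk>y \<in> Obj; mor f' x' x''; mor f x x'\<rbrakk> \<Longrightarrow> (f' \<cdot> f) \<odot> idm y = (f' \<odot> idm y) \<cdot> (f \<odot> idm y)"
  using m_tens_comp[OF _ _ mor_id mor_id] m_id(1)[OF mor_id] by metis

lemma m_tens_split:
  assumes "mor f x x'" "mor g y y'"
  shows "f \<odot> g = (f \<odot> idm y') \<cdot> (idm x \<odot> g)" "f \<odot> g = (idm x' \<odot> g) \<cdot> (f \<odot> idm y)"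
  using m_tens_comp[OF assms(1) mor_id mor_id assms(2)] m_tens_comp[OF mor_id assms(1) assms(2) mor_id]
    m_id[OF assms(1)] m_id[OF assms(2)] assms
  by (auto simp: mor_def)

lemma m_tens_diff_right:
  assumes "mor f x x'" "mor g y y'" "mor g' y y'"
  shows "f \<odot> (g - g') = f \<odot> g - f \<odot> g'"
proof -
  have "f \<odot> (g - g' + g') = f \<odot> (g - g') + f \<odot> g'"
    using tmor_add_right assms mor_diff[OF assms(2,3)] unfolding mor_def by blast
  then show ?thesis by simp
qed

lemma m_tens_zero_right: "\<lbrakk>mor f x x'; y \<in> Obj; y' \<in> Obj\<rbrakk> \<Longrightarrow> f \<odot> 0 = 0"
  using m_tens_diff_right[OF _ mor_zero mor_zero] by fastforce

lemma m_tens_scale: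
  assumes "mor f x x'" "mor g y y'"
  shows "scale C c f \<odot> g = scale C c (f \<odot> g)" "f \<odot> scale C c g = scale C c (f \<odot> g)"
  using assms tmor_scale_left tmor_scale_right unfolding mor_def by blast+

definition linv :: "'o \<Rightarrow> 'm" where "linv x = inv_mor (\<one> \<otimes> x) x (\<l> x)"
definition rinv :: "'o \<Rightarrow> 'm" where "rinv x = inv_mor (x \<otimes> \<one>) x (\<r> x)"

lemma mor_assoc:
  assumes "x \<in> Obj" "y \<in> Obj" "z \<in> Obj"
  shows "mor (\<a> x y z) ((x \<otimes> y) \<otimes> z) (x \<otimes> (y \<otimes> z))"
    "mor (assoc_inv x y z) (x \<otimes> (y \<otimes> z)) ((x \<otimes> y) \<otimes> z)"
    "assoc_inv x y z \<cdot> \<a> x y z = idm ((x \<otimes> y) \<otimes> z)"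
    "\<a> x y z \<cdot> assoc_inv x y z = idm (x \<otimes> (y \<otimes> z))"
  using inv_mor[OF _ _ assoc_iso[OF assms]] assms
  unfolding assoc_inv_def by (auto intro: tobj_in_Obj)

lemma mor_lunit:
  assumes "x \<in> Obj"
  shows "mor (\<l> x) (\<one> \<otimes> x) x" "mor (linv x) x (\<one> \<otimes> x)" "linv x \<cdot> \<l> x = idm (\<one> \<otimes> x)" "\<l> x \<cdot> linv x = idm x"
  using inv_mor[OF _ _ lunit_iso[OF assms]] assms
  unfolding linv_def by (auto intro: tobj_in_Obj unit_in_Obj)

lemma mor_runit:
  assumes "x \<in> Obj"
  shows "mor (\<r> x) (x \<otimes> \<one>) x" "mor (rinv x) x (x \<otimes> \<one>)" "rinv x \<cdot> \<r> x = idm (x \<otimes> \<one>)" "\<r> x \<cdot> rinv x = idm x"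
  using inv_mor[OF _ _ runit_iso[OF assms]] assms
  unfolding rinv_def by (auto intro: tobj_in_Obj unit_in_Obj)

lemma inverse_natural:
  assumes "mor a x y" "mor a' y x" "a \<cdot> a' = idm y" "mor b x' y'" "mor b' y' x'" "b' \<cdot> b = idm x'"
    and "mor f x x'" "mor g y y'" and nat: "b \<cdot> f = g \<cdot> a"
  shows "b' \<cdot> g = f \<cdot> a'"
proof -
  have ga: "mor (g \<cdot> a) x y'" using assms(8,1) by (rule mor_comp)
  have "b' \<cdot> g = b' \<cdot> ((g \<cdot> a) \<cdot> a')" using assms(3) m_assoc[OF assms(8,1,2)] m_id(2)[OF assms(8)] by simp
  also have "\<dots> = (b' \<cdot> (b \<cdot> f)) \<cdot> a'" using nat m_assoc[OF assms(5) ga assms(2)] by simp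
  also have "\<dots> = f \<cdot> a'" using m_assoc[OF assms(5,4,7)] assms(6) m_id(1)[OF assms(7)] by simp
  finally show ?thesis .
qed

lemma m_assoc_natural:
  assumes "mor f x x'" "mor g y y'" "mor h z z'"
  shows "\<a> x' y' z' \<cdot> ((f \<odot> g) \<odot> h) = (f \<odot> (g \<odot> h)) \<cdot> \<a> x y z"
    "assoc_inv x' y' z' \<cdot> (f \<odot> (g \<odot> h)) = ((f \<odot> g) \<odot> h) \<cdot> assoc_inv x y z"
proof -
  have O: "x \<in> Obj" "x' \<in> Obj" "y \<in> Obj" "y' \<in> Obj" "z \<in> Obj" "z' \<in> Obj"
    using assms by (auto simp: mor_def)
  show n: "\<a> x' y' z' \<cdot> ((f \<odot> g) \<odot> h) = (f \<odot> (g \<odot> h)) \<cdot> \<a> x y z"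
    using assoc_natural assms unfolding mor_def by blast
  show "assoc_inv x' y' z' \<cdot> (f \<odot> (g \<odot> h)) = ((f \<odot> g) \<odot> h) \<cdot> assoc_inv x y z"
    by (rule inverse_natural[OF mor_assoc(1,2,4) mor_assoc(1,2,3) _ _ n])
      (use O assms in \<open>auto intro: mor_tens\<close>)
qed

lemma m_lunit_natural:
  assumes "mor f x y"
  shows "\<l> y \<cdot> (idm \<one> \<odot> f) = f \<cdot> \<l> x" "linv y \<cdot> f = (idm \<one> \<odot> f) \<cdot> linv x"
proof -
  have O: "x \<in> Obj" "y \<in> Obj" using assms by (auto simp: mor_def)
  show n: "\<l> y \<cdot> (idm \<one> \<odot> f) = f \<cdot> \<l> x"
    using lunit_natural assms unfolding mor_def by blast
  show "linv y \<cdot> f = (idm \<one> \<odot> f) \<cdot> linv x"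
    by (rule inverse_natural[OF mor_lunit(1,2,4) mor_lunit(1,2,3) _ _ n])
      (use O assms unit_in_Obj in \<open>auto intro: mor_tens mor_id\<close>)
qed

lemma m_runit_natural:
  assumes "mor f x y"
  shows "\<r> y \<cdot> (f \<odot> idm \<one>) = f \<cdot> \<r> x" "rinv y \<cdot> f = (f \<odot> idm \<one>) \<cdot> rinv x"
proof -
  have O: "x \<in> Obj" "y \<in> Obj" using assms by (auto simp: mor_def)
  show n: "\<r> y \<cdot> (f \<odot> idm \<one>) = f \<cdot> \<r> x"
    using runit_natural assms unfolding mor_def by blast
  show "rinv y \<cdot> f = (f \<odot> idm \<one>) \<cdot> rinv x"
    by (rule inverse_natural[OF mor_runit(1,2,4) mor_runit(1,2,3) _ _ n])
      (use O assms unit_in_Obj in \<open>auto intro: mor_tens mor_id\<close>)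
qed

text \<open>Conjugation by \<open>\<l>\<close> turns \<open>idm \<one> \<odot> f\<close> back into
  \<open>f\<close>, so tensoring with the unit is faithful and equations may be checked after
  it.\<close>

lemma tens_unit_left_cancel:
  assumes "mor f x y" "mor g x y" "idm \<one> \<odot> f = idm \<one> \<odot> g"
  shows "f = g"
proof -
  have x: "x \<in> Obj" using assms by (simp add: mor_def)
  have "f \<cdot> \<l> x = g \<cdot> \<l> x" using m_lunit_natural(1) assms by metis
  then have "(f \<cdot> \<l> x) \<cdot> linv x = (g \<cdot> \<l> x) \<cdot> linv x" by simp
  then show ?thesis
    using m_assoc[OF assms(1) mor_lunit(1,2)[OF x]] m_assoc[OF assms(2) mor_lunit(1,2)[OF x]]
      mor_lunit(4)[OF x] m_id(2)[OF assms(1)] m_id(2)[OF assms(2)] by simp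
qed

lemma tens_unit_right_cancel:
  assumes "mor f x y" "mor g x y" "f \<odot> idm \<one> = g \<odot> idm \<one>"
  shows "f = g"
proof -
  have x: "x \<in> Obj" using assms by (simp add: mor_def)
  have "f \<cdot> \<r> x = g \<cdot> \<r> x" using m_runit_natural(1) assms by metis
  then have "(f \<cdot> \<r> x) \<cdot> rinv x = (g \<cdot> \<r> x) \<cdot> rinv x" by simp
  then show ?thesis
    using m_assoc[OF assms(1) mor_runit(1,2)[OF x]] m_assoc[OF assms(2) mor_runit(1,2)[OF x]]
      mor_runit(4)[OF x] m_id(2)[OF assms(1)] m_id(2)[OF assms(2)] by simp
qed

lemma epi_cancel:
  assumes "mor f y z" "mor g y z" "mor e x y" "mor e' y x" "e \<cdot> e' = idm y" "f \<cdot> e = g \<cdot> e"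
  shows "f = g"
  using m_assoc[OF assms(1,3,4)] m_assoc[OF assms(2,3,4)] assms(5,6) m_id(2)[OF assms(1)] m_id(2)[OF assms(2)]
  by argo

text \<open>Kelly's consequence of the pentagon and triangle axioms.\<close>

lemma lunit_tens:
  assumes "x \<in> Obj" "y \<in> Obj"
  shows "\<l> x \<odot> idm y = \<l> (x \<otimes> y) \<cdot> \<a> \<one> x y"
proof (rule tens_unit_left_cancel)
  note u = unit_in_Obj and o = tobj_in_Obj
  have xy: "x \<otimes> y \<in> Obj" "\<one> \<otimes> x \<in> Obj" "\<one> \<otimes> \<one> \<in> Obj" using assms u o by auto
  \<comment> \<open>The equation is checked after tensoring with \<open>\<one>\<close> and
    precomposing with the invertible \<open>?A \<cdot> ?B\<close>. There the pentagon for
    \<open>\<one>\<close>, \<open>\<one>\<close>, \<open>x\<close>, \<open>y\<close> applies, and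
    the triangle axiom expresses both left unitors through \<open>\<r> \<one>\<close>.\<close>
  let ?A = "\<a> \<one> (\<one> \<otimes> x) y" and ?A' = "assoc_inv \<one> (\<one> \<otimes> x) y"
  let ?B = "\<a> \<one> \<one> x \<odot> idm y" and ?B' = "assoc_inv \<one> \<one> x \<odot> idm y"
  have A: "mor ?A ((\<one> \<otimes> (\<one> \<otimes> x)) \<otimes> y) (\<one> \<otimes> ((\<one> \<otimes> x) \<otimes> y))"
      "mor ?A' (\<one> \<otimes> ((\<one> \<otimes> x) \<otimes> y)) ((\<one> \<otimes> (\<one> \<otimes> x)) \<otimes> y)" "?A \<cdot> ?A' = idm (\<one> \<otimes> ((\<one> \<otimes> x) \<otimes> y))"
    using mor_assoc[of \<one> "\<one> \<otimes> x" y] assms u o by auto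
  have B: "mor ?B (((\<one> \<otimes> \<one>) \<otimes> x) \<otimes> y) ((\<one> \<otimes> (\<one> \<otimes> x)) \<otimes> y)"
      "mor ?B' ((\<one> \<otimes> (\<one> \<otimes> x)) \<otimes> y) (((\<one> \<otimes> \<one>) \<otimes> x) \<otimes> y)"
    using mor_assoc[of \<one> \<one> x] assms u by (auto intro: mor_tens mor_id)
  have "?B \<cdot> ?B' = (\<a> \<one> \<one> x \<cdot> assoc_inv \<one> \<one> x) \<odot> idm y"
    using m_tens_comp_left[OF assms(2) mor_assoc(1,2)] assms u by simp
  then have BB: "?B \<cdot> ?B' = idm ((\<one> \<otimes> (\<one> \<otimes> x)) \<otimes> y)"
    using mor_assoc(4)[of \<one> \<one> x] assms u o tmor_id by simp
  have a: "mor (\<a> \<one> x y) ((\<one> \<otimes> x) \<otimes> y) (\<one> \<otimes> (x \<otimes> y))" using mor_assoc assms u by blast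
  have l: "mor (\<l> x) (\<one> \<otimes> x) x" "mor (\<l> (x \<otimes> y)) (\<one> \<otimes> (x \<otimes> y)) (x \<otimes> y)"
    using mor_lunit assms xy by blast+
  show L: "mor (\<l> x \<odot> idm y) ((\<one> \<otimes> x) \<otimes> y) (x \<otimes> y)" using l assms by (auto intro: mor_tens mor_id)
  show R: "mor (\<l> (x \<otimes> y) \<cdot> \<a> \<one> x y) ((\<one> \<otimes> x) \<otimes> y) (x \<otimes> y)" using l(2) a by (rule mor_comp)
  have L1: "mor (idm \<one> \<odot> (\<l> x \<odot> idm y)) (\<one> \<otimes> ((\<one> \<otimes> x) \<otimes> y)) (\<one> \<otimes> (x \<otimes> y))"
    using L u by (auto intro: mor_tens mor_id)
  have R1: "mor (idm \<one> \<odot> (\<l> (x \<otimes> y) \<cdot> \<a> \<one> x y)) (\<one> \<otimes> ((\<one> \<otimes> x) \<otimes> y)) (\<one> \<otimes> (x \<otimes> y))"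
    using R u by (auto intro: mor_tens mor_id)
  have ia: "mor (idm \<one> \<odot> \<a> \<one> x y) (\<one> \<otimes> ((\<one> \<otimes> x) \<otimes> y)) (\<one> \<otimes> (\<one> \<otimes> (x \<otimes> y)))"
    and il: "mor (idm \<one> \<odot> \<l> (x \<otimes> y)) (\<one> \<otimes> (\<one> \<otimes> (x \<otimes> y))) (\<one> \<otimes> (x \<otimes> y))"
    using a l u by (auto intro: mor_tens mor_id)
  have AB: "mor (?A \<cdot> ?B) (((\<one> \<otimes> \<one>) \<otimes> x) \<otimes> y) (\<one> \<otimes> ((\<one> \<otimes> x) \<otimes> y))" using A(1) B(1) by (rule mor_comp)
  have "(idm \<one> \<odot> (\<l> (x \<otimes> y) \<cdot> \<a> \<one> x y)) \<cdot> (?A \<cdot> ?B)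
      = (idm \<one> \<odot> \<l> (x \<otimes> y)) \<cdot> ((idm \<one> \<odot> \<a> \<one> x y) \<cdot> (?A \<cdot> ?B))"
    using m_tens_comp_right[OF u l(2) a] m_assoc[OF il ia AB] by simp
  also have "(idm \<one> \<odot> \<a> \<one> x y) \<cdot> (?A \<cdot> ?B) = \<a> \<one> \<one> (x \<otimes> y) \<cdot> \<a> (\<one> \<otimes> \<one>) x y"
    using pentagon[OF u u assms] m_assoc[OF ia A(1) B(1)] by simp
  also have "(idm \<one> \<odot> \<l> (x \<otimes> y)) \<cdot> (\<a> \<one> \<one> (x \<otimes> y) \<cdot> \<a> (\<one> \<otimes> \<one>) x y)
      = (\<r> \<one> \<odot> idm (x \<otimes> y)) \<cdot> \<a> (\<one> \<otimes> \<one>) x y"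
    using m_assoc[OF il mor_assoc(1)[OF u u xy(1)] mor_assoc(1)[OF xy(3) assms]] triangle[OF u xy(1)] by simp
  also have "\<dots> = \<a> \<one> x y \<cdot> ((\<r> \<one> \<odot> idm x) \<odot> idm y)"
    using m_assoc_natural(1)[OF mor_runit(1)[OF u] mor_id[OF assms(1)] mor_id[OF assms(2)]]
      tmor_id[OF assms] by simp
  also have "(\<r> \<one> \<odot> idm x) \<odot> idm y = ((idm \<one> \<odot> \<l> x) \<odot> idm y) \<cdot> ?B"
    using triangle[OF u assms(1)] m_tens_comp_left[OF assms(2) mor_tens[OF mor_id[OF u] l(1)]
      mor_assoc(1)[OF u u assms(1)]] by simp
  also have "\<a> \<one> x y \<cdot> (((idm \<one> \<odot> \<l> x) \<odot> idm y) \<cdot> ?B) = (\<a> \<one> x y \<cdot> ((idm \<one> \<odot> \<l> x) \<odot> idm y)) \<cdot> ?B"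
    using m_assoc[OF a _ B(1)] mor_tens[OF mor_tens[OF mor_id[OF u] l(1)] mor_id[OF assms(2)]] by simp
  also have "\<a> \<one> x y \<cdot> ((idm \<one> \<odot> \<l> x) \<odot> idm y) = (idm \<one> \<odot> (\<l> x \<odot> idm y)) \<cdot> ?A"
    using m_assoc_natural(1)[OF mor_id[OF u] l(1) mor_id[OF assms(2)]] .
  also have "(idm \<one> \<odot> (\<l> x \<odot> idm y)) \<cdot> ?A \<cdot> ?B = (idm \<one> \<odot> (\<l> x \<odot> idm y)) \<cdot> (?A \<cdot> ?B)"
    using m_assoc[OF L1 A(1) B(1)] .
  finally have "(idm \<one> \<odot> (\<l> (x \<otimes> y) \<cdot> \<a> \<one> x y)) \<cdot> ?A \<cdot> ?B = (idm \<one> \<odot> (\<l> x \<odot> idm y)) \<cdot> ?A \<cdot> ?B"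
    using m_assoc[OF L1 A(1) B(1)] m_assoc[OF R1 A(1) B(1)] by simp
  then have "(idm \<one> \<odot> (\<l> (x \<otimes> y) \<cdot> \<a> \<one> x y)) \<cdot> ?A = (idm \<one> \<odot> (\<l> x \<odot> idm y)) \<cdot> ?A"
    by (rule epi_cancel[OF mor_comp[OF R1 A(1)] mor_comp[OF L1 A(1)] B BB])
  then show "idm \<one> \<odot> (\<l> x \<odot> idm y) = idm \<one> \<odot> (\<l> (x \<otimes> y) \<cdot> \<a> \<one> x y)"
    using epi_cancel[OF R1 L1 A] by simp
qed

end

section \<open>The strict category of lists of objects and natural families\<close>

context tensor_category
begin

text \<open>A list stands for the endofunctor that tensors with its entries on the left, bracketed
  to the right. Concatenation of lists is then composition of functors, which is strictly
  associative and unital.\<close>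

primrec lact :: "'o list \<Rightarrow> 'o \<Rightarrow> 'o" where
  "lact [] y = y"
| "lact (x # l) y = x \<otimes> lact l y"

primrec lmap :: "'o list \<Rightarrow> 'm \<Rightarrow> 'm" where
  "lmap [] f = f"
| "lmap (x # l) f = idm x \<odot> lmap l f"

lemma lact_append: "lact (k @ l) y = lact k (lact l y)"
  by (induction k) auto

lemma lmap_append: "lmap (k @ l) f = lmap k (lmap l f)"
  by (induction k) auto

lemma lact_Obj: "\<lbrakk>set l \<subseteq> Obj; y \<in> Obj\<rbrakk> \<Longrightarrow> lact l y \<in> Obj"
  by (induction l) (auto intro: tobj_in_Obj)

lemma mor_lmap: "\<lbrakk>set l \<subseteq> Obj; mor f x y\<rbrakk> \<Longrightarrow> mor (lmap l f) (lact l x) (lact l y)"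
  by (induction l) (auto intro!: mor_tens mor_id)

lemma lmap_id: "\<lbrakk>set l \<subseteq> Obj; y \<in> Obj\<rbrakk> \<Longrightarrow> lmap l (idm y) = idm (lact l y)"
  by (induction l) (auto simp: tmor_id lact_Obj)

lemma lmap_comp:
  "\<lbrakk>set l \<subseteq> Obj; mor g y z; mor f x y\<rbrakk> \<Longrightarrow> lmap l (g \<cdot> f) = lmap l g \<cdot> lmap l f"
  by (induction l) (auto simp: m_tens_comp_right[OF _ mor_lmap mor_lmap])

text \<open>Arrows from \<open>l\<close> to \<open>l'\<close> in the strictification are families of morphisms
  \<open>lact l w \<rightarrow> lact l' w\<close> natural in \<open>w\<close>.  They are set to zero outside the category, so that
  equality of families is equality of functions.\<close>

definition sarr :: "'o list \<times> ('o \<Rightarrow> 'm) \<times> 'o list \<Rightarrow> bool" where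
  "sarr = (\<lambda>(l, F, l'). set l \<subseteq> Obj \<and> set l' \<subseteq> Obj \<and>
     (\<forall>w\<in>Obj. mor (F w) (lact l w) (lact l' w)) \<and>
     (\<forall>w w' f. mor f w w' \<longrightarrow> F w' \<cdot> lmap l f = lmap l' f \<cdot> F w) \<and>
     (\<forall>w. w \<notin> Obj \<longrightarrow> F w = 0))"

definition sdom :: "'o list \<times> ('o \<Rightarrow> 'm) \<times> 'o list \<Rightarrow> 'o list" where "sdom = fst"
definition scod :: "'o list \<times> ('o \<Rightarrow> 'm) \<times> 'o list \<Rightarrow> 'o list" where "scod = snd \<circ> snd"

definition scomp :: "'o list \<times> ('o \<Rightarrow> 'm) \<times> 'o list \<Rightarrow> 'o list \<times> ('o \<Rightarrow> 'm) \<times> 'o list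
    \<Rightarrow> 'o list \<times> ('o \<Rightarrow> 'm) \<times> 'o list" (infixr "\<circ>\<^sub>s" 65) where
  "g \<circ>\<^sub>s f = (fst f, \<lambda>w. if w \<in> Obj then fst (snd g) w \<cdot> fst (snd f) w else 0, snd (snd g))"

definition sid :: "'o list \<Rightarrow> 'o list \<times> ('o \<Rightarrow> 'm) \<times> 'o list" where
  "sid l = (l, \<lambda>w. if w \<in> Obj then idm (lact l w) else 0, l)"

text \<open>Whiskering: \<open>f\<close> tensored with the identity of \<open>k\<close> on the left
  and that of \<open>r\<close> on the right; evaluation at \<open>lact r w\<close> does the latter.
  A tensor product of two arrows is written as a composite of two whiskerings, so that equations
  become equations between words.\<close>

definition wh :: "'o list \<Rightarrow> 'o list \<times> ('o \<Rightarrow> 'm) \<times> 'o list \<Rightarrow> 'o list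
    \<Rightarrow> 'o list \<times> ('o \<Rightarrow> 'm) \<times> 'o list" where
  "wh k f r = (k @ fst f @ r, \<lambda>w. if w \<in> Obj then lmap k (fst (snd f) (lact r w)) else 0,
     k @ snd (snd f) @ r)"

lemma sdom_simps [simp]:
  "sdom (l, F, l') = l" "sdom (g \<circ>\<^sub>s f) = sdom f" "sdom (sid l) = l" "sdom (wh k f r) = k @ sdom f @ r"
  by (simp_all add: sdom_def scomp_def sid_def wh_def)

lemma scod_simps [simp]:
  "scod (l, F, l') = l'" "scod (g \<circ>\<^sub>s f) = scod g" "scod (sid l) = l" "scod (wh k f r) = k @ scod f @ r"
  by (simp_all add: scod_def scomp_def sid_def wh_def)

lemma sarrD:
  assumes "sarr (l, F, l')"
  shows "set l \<subseteq> Obj" "set l' \<subseteq> Obj" "w \<in> Obj \<Longrightarrow> mor (F w) (lact l w) (lact l' w)"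
    "mor f w w' \<Longrightarrow> F w' \<cdot> lmap l f = lmap l' f \<cdot> F w" "w \<notin> Obj \<Longrightarrow> F w = 0"
  using assms by (auto simp: sarr_def)

lemma sarr_Obj: "sarr f \<Longrightarrow> set (sdom f) \<subseteq> Obj" "sarr f \<Longrightarrow> set (scod f) \<subseteq> Obj"
  by (auto simp: sarr_def sdom_def scod_def)

lemma sarr_comp [simp]:
  assumes "sarr f" "sarr g" "scod f = sdom g"
  shows "sarr (g \<circ>\<^sub>s f)"
proof -
  obtain a F b where f: "f = (a, F, b)" by (cases f) auto
  obtain G c where g: "g = (b, G, c)" using assms(3) f by (cases g) auto
  note F = sarrD[OF assms(1)[unfolded f]] and G = sarrD[OF assms(2)[unfolded g]]
  have "(G w' \<cdot> F w') \<cdot> lmap a h = lmap c h \<cdot> (G w \<cdot> F w)" if h: "mor h w w'" for h w w'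
  proof -
    have w: "w \<in> Obj" "w' \<in> Obj" using h by (auto simp: mor_def)
    have "(G w' \<cdot> F w') \<cdot> lmap a h = G w' \<cdot> (lmap b h \<cdot> F w)"
      using m_assoc[OF G(3)[OF w(2)] F(3)[OF w(2)] mor_lmap[OF F(1) h]] F(4)[OF h] by simp
    also have "\<dots> = (lmap c h \<cdot> G w) \<cdot> F w"
      using m_assoc[OF G(3)[OF w(2)] mor_lmap[OF F(2) h] F(3)[OF w(1)]] G(4)[OF h] by simp
    also have "\<dots> = lmap c h \<cdot> (G w \<cdot> F w)"
      using m_assoc[OF mor_lmap[OF G(2) h] G(3)[OF w(1)] F(3)[OF w(1)]] .
    finally show ?thesis .
  qed
  then show ?thesis
    unfolding sarr_def scomp_def f g using F G mor_comp[OF G(3) F(3)] by (auto dest: mor_Obj)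
qed

lemma sarr_id [simp]: "set l \<subseteq> Obj \<Longrightarrow> sarr (sid l)"
  unfolding sarr_def sid_def
  using m_id(1)[OF mor_lmap] m_id(2)[OF mor_lmap] by (auto intro!: mor_id lact_Obj dest: mor_Obj)

lemma sarr_wh [simp]:
  assumes "sarr f" "set k \<subseteq> Obj" "set r \<subseteq> Obj"
  shows "sarr (wh k f r)"
proof -
  obtain a F b where f: "f = (a, F, b)" by (cases f) auto
  note F = sarrD[OF assms(1)[unfolded f]]
  have "lmap k (F (lact r w')) \<cdot> lmap (k @ a @ r) h = lmap (k @ b @ r) h \<cdot> lmap k (F (lact r w))"
    if h: "mor h w w'" for h w w'
  proof -
    have w: "lact r w \<in> Obj" "lact r w' \<in> Obj" using h assms by (auto simp: mor_def intro: lact_Obj)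
    note hr = mor_lmap[OF assms(3) h]
    have "lmap k (F (lact r w')) \<cdot> lmap (k @ a @ r) h = lmap k (F (lact r w') \<cdot> lmap a (lmap r h))"
      using lmap_comp[OF assms(2) F(3)[OF w(2)] mor_lmap[OF F(1) hr]] by (simp add: lmap_append)
    also have "\<dots> = lmap k (lmap b (lmap r h) \<cdot> F (lact r w))" using F(4)[OF hr] by simp
    also have "\<dots> = lmap (k @ b @ r) h \<cdot> lmap k (F (lact r w))"
      using lmap_comp[OF assms(2) mor_lmap[OF F(2) hr] F(3)[OF w(1)]] by (simp add: lmap_append)
    finally show ?thesis .
  qed
  then show ?thesis
    unfolding sarr_def wh_def f
    using F(1,2,4,5) assms mor_lmap[OF assms(2) F(3)[OF lact_Obj[OF assms(3)]]]
    by (auto simp: lact_append dest: mor_Obj)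
qed

text \<open>As a rewrite rule this nests composites to the right. Its side conditions on
  \<open>sdom\<close> and \<open>scod\<close> are themselves settled by rewriting, which is why
  arrows carry their source and target.\<close>

lemma sassoc [simp]:
  assumes "sarr f" "sarr g" "sarr h" "scod f = sdom g" "scod g = sdom h"
  shows "(h \<circ>\<^sub>s g) \<circ>\<^sub>s f = h \<circ>\<^sub>s g \<circ>\<^sub>s f"
proof -
  obtain a F b where f: "f = (a, F, b)" by (cases f) auto
  obtain G c where g: "g = (b, G, c)" using assms(4) f by (cases g) auto
  obtain H d where h: "h = (c, H, d)" using assms(5) g by (cases h) auto
  show ?thesis
    using m_assoc[OF sarrD(3)[OF assms(3)[unfolded h]] sarrD(3)[OF assms(2)[unfolded g]]
      sarrD(3)[OF assms(1)[unfolded f]]]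
    unfolding scomp_def f g h by (auto simp: fun_eq_iff)
qed

lemma sid_left [simp]: "\<lbrakk>sarr f; scod f = l\<rbrakk> \<Longrightarrow> sid l \<circ>\<^sub>s f = f"
  using m_id(1)[OF sarrD(3)] by (cases f) (auto simp: scomp_def sid_def fun_eq_iff sarrD(5))

lemma sid_right [simp]: "\<lbrakk>sarr f; sdom f = l\<rbrakk> \<Longrightarrow> f \<circ>\<^sub>s sid l = f"
  using m_id(2)[OF sarrD(3)] by (cases f) (auto simp: scomp_def sid_def fun_eq_iff sarrD(5))

lemma wh_comp [simp]:
  assumes "sarr f" "sarr g" "scod f = sdom g" "set k \<subseteq> Obj" "set r \<subseteq> Obj"
  shows "wh k (g \<circ>\<^sub>s f) r = wh k g r \<circ>\<^sub>s wh k f r"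
proof -
  obtain a F b where f: "f = (a, F, b)" by (cases f) auto
  obtain G c where g: "g = (b, G, c)" using assms(3) f by (cases g) auto
  show ?thesis
    using lmap_comp[OF assms(4) sarrD(3)[OF assms(2)[unfolded g]] sarrD(3)[OF assms(1)[unfolded f]]]
      lact_Obj[OF assms(5)]
    unfolding scomp_def wh_def f g by (auto simp: fun_eq_iff)
qed

lemma wh_id [simp]: "\<lbrakk>set k \<subseteq> Obj; set l \<subseteq> Obj; set r \<subseteq> Obj\<rbrakk> \<Longrightarrow> wh k (sid l) r = sid (k @ l @ r)"
  by (auto simp: wh_def sid_def fun_eq_iff lmap_id lact_append lact_Obj)

lemma wh_wh [simp]: "set r \<subseteq> Obj \<Longrightarrow> wh k (wh k' f r') r = wh (k @ k') f (r' @ r)"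
  by (auto simp: wh_def fun_eq_iff lmap_append lact_append lact_Obj)

lemma wh_nil [simp]: "sarr f \<Longrightarrow> wh [] f [] = f"
  by (cases f) (auto simp: wh_def fun_eq_iff sarrD(5))

text \<open>Naturality of \<open>f\<close> in the variable \<open>w\<close>, taken at the component
  of \<open>g\<close> whiskered by \<open>l\<close>. It is kept out of the rewrite rules because it
  is used in both directions, wherever two arrows have to slide past each other.\<close>

lemma interchange:
  assumes "sarr f" "sarr g" "set k \<subseteq> Obj" "set l \<subseteq> Obj" "set r \<subseteq> Obj"
  shows "wh k f (l @ scod g @ r) \<circ>\<^sub>s wh (k @ sdom f @ l) g r
    = wh (k @ scod f @ l) g r \<circ>\<^sub>s wh k f (l @ sdom g @ r)"
proof -
  obtain a F b where f: "f = (a, F, b)" by (cases f) auto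
  obtain c G d where g: "g = (c, G, d)" by (cases g) auto
  note F = sarrD[OF assms(1)[unfolded f]] and G = sarrD[OF assms(2)[unfolded g]]
  have "lmap k (F (lact (l @ d @ r) w)) \<cdot> lmap (k @ a @ l) (G (lact r w))
      = lmap (k @ b @ l) (G (lact r w)) \<cdot> lmap k (F (lact (l @ c @ r) w))" if "w \<in> Obj" for w
  proof -
    have w: "lact r w \<in> Obj" using that assms(5) by (rule lact_Obj[rotated])
    have gl: "mor (lmap l (G (lact r w))) (lact (l @ c @ r) w) (lact (l @ d @ r) w)"
      using mor_lmap[OF assms(4) G(3)[OF w]] by (simp add: lact_append)
    note F1 = F(3)[OF mor_Obj(1)[OF gl]] F(3)[OF mor_Obj(2)[OF gl]]
    show ?thesis
      using lmap_comp[OF assms(3) F1(2) mor_lmap[OF F(1) gl]] lmap_comp[OF assms(3) mor_lmap[OF F(2) gl] F1(1)]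
        F(4)[OF gl] by (simp add: lmap_append)
  qed
  then show ?thesis unfolding scomp_def wh_def f g by (auto simp: fun_eq_iff)
qed

text \<open>Bundling a morphism with its source and target makes typing conditions decidable by
  rewriting.\<close>

definition barr :: "'o \<times> 'm \<times> 'o \<Rightarrow> bool" where "barr = (\<lambda>(x, f, y). mor f x y)"
definition bcomp :: "'o \<times> 'm \<times> 'o \<Rightarrow> 'o \<times> 'm \<times> 'o \<Rightarrow> 'o \<times> 'm \<times> 'o" (infixr "\<circ>\<^sub>b" 65) where
  "g \<circ>\<^sub>b f = (fst f, fst (snd g) \<cdot> fst (snd f), snd (snd g))"
definition btens :: "'o \<times> 'm \<times> 'o \<Rightarrow> 'o \<times> 'm \<times> 'o \<Rightarrow> 'o \<times> 'm \<times> 'o" (infixr "\<otimes>\<^sub>b" 70) where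
  "f \<otimes>\<^sub>b g = (fst f \<otimes> fst g, fst (snd f) \<odot> fst (snd g), snd (snd f) \<otimes> snd (snd g))"
definition bid :: "'o \<Rightarrow> 'o \<times> 'm \<times> 'o" where "bid x = (x, idm x, x)"
definition bassoc where "bassoc x y z = ((x \<otimes> y) \<otimes> z, \<a> x y z, x \<otimes> (y \<otimes> z))"
definition bassoc' where "bassoc' x y z = (x \<otimes> (y \<otimes> z), assoc_inv x y z, (x \<otimes> y) \<otimes> z)"
definition blunit where "blunit x = (\<one> \<otimes> x, \<l> x, x)"
definition blunit' where "blunit' x = (x, linv x, \<one> \<otimes> x)"
definition brunit where "brunit x = (x \<otimes> \<one>, \<r> x, x)"
definition brunit' where "brunit' x = (x, rinv x, x \<otimes> \<one>)"
definition bdom :: "'o \<times> 'm \<times> 'o \<Rightarrow> 'o" where "bdom = fst"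
definition bcod :: "'o \<times> 'm \<times> 'o \<Rightarrow> 'o" where "bcod = snd \<circ> snd"

lemmas bdefs = bcomp_def btens_def bid_def bassoc_def bassoc'_def blunit_def blunit'_def brunit_def brunit'_def

lemma bdom_simps [simp]:
  "bdom (x, f, y) = x" "bdom (s \<circ>\<^sub>b t) = bdom t" "bdom (s \<otimes>\<^sub>b t) = bdom s \<otimes> bdom t" "bdom (bid x) = x"
  "bdom (bassoc x y z) = (x \<otimes> y) \<otimes> z" "bdom (bassoc' x y z) = x \<otimes> (y \<otimes> z)"
  "bdom (blunit x) = \<one> \<otimes> x" "bdom (blunit' x) = x" "bdom (brunit x) = x \<otimes> \<one>" "bdom (brunit' x) = x"
  by (simp_all add: bdom_def bdefs)

lemma bcod_simps [simp]:
  "bcod (x, f, y) = y" "bcod (s \<circ>\<^sub>b t) = bcod s" "bcod (s \<otimes>\<^sub>b t) = bcod s \<otimes> bcod t" "bcod (bid x) = x"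
  "bcod (bassoc x y z) = x \<otimes> (y \<otimes> z)" "bcod (bassoc' x y z) = (x \<otimes> y) \<otimes> z"
  "bcod (blunit x) = x" "bcod (blunit' x) = \<one> \<otimes> x" "bcod (brunit x) = x" "bcod (brunit' x) = x \<otimes> \<one>"
  by (simp_all add: bcod_def bdefs)

lemma barr_mor [simp]: "mor f x y \<Longrightarrow> barr (x, f, y)"
  by (simp add: barr_def)

lemma barr_Obj [simp]: "barr t \<Longrightarrow> bdom t \<in> Obj" "barr t \<Longrightarrow> bcod t \<in> Obj"
  by (auto simp: barr_def mor_def bdom_def bcod_def)

lemma barr_simps [simp]:
  "\<lbrakk>barr s; barr t; bcod t = bdom s\<rbrakk> \<Longrightarrow> barr (s \<circ>\<^sub>b t)"
  "\<lbrakk>barr s; barr t\<rbrakk> \<Longrightarrow> barr (s \<otimes>\<^sub>b t)"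
  "x \<in> Obj \<Longrightarrow> barr (bid x)"
  "\<lbrakk>x \<in> Obj; y \<in> Obj; z \<in> Obj\<rbrakk> \<Longrightarrow> barr (bassoc x y z)"
  "\<lbrakk>x \<in> Obj; y \<in> Obj; z \<in> Obj\<rbrakk> \<Longrightarrow> barr (bassoc' x y z)"
  "x \<in> Obj \<Longrightarrow> barr (blunit x)" "x \<in> Obj \<Longrightarrow> barr (blunit' x)"
  "x \<in> Obj \<Longrightarrow> barr (brunit x)" "x \<in> Obj \<Longrightarrow> barr (brunit' x)"
  by (auto simp: barr_def bdom_def bcod_def bdefs
      intro: mor_comp mor_tens mor_id mor_assoc mor_lunit mor_runit split: prod.splits)

text \<open>A Cayley-type embedding: \<open>x\<close> becomes the endofunctor of tensoring with
  \<open>x\<close> on the left, and a morphism becomes the induced natural transformation.\<close>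

definition emb :: "'o \<times> 'm \<times> 'o \<Rightarrow> 'o list \<times> ('o \<Rightarrow> 'm) \<times> 'o list" where
  "emb t = ([fst t], \<lambda>w. if w \<in> Obj then fst (snd t) \<odot> idm w else 0, [snd (snd t)])"

text \<open>The embedding is monoidal only up to isomorphism. These four families are its structure
  maps between \<open>[x, y]\<close> and \<open>[x \<otimes> y]\<close> and between
  \<open>[]\<close> and \<open>[\<one>]\<close>; their components are associators and left
  unitors.\<close>

definition join where "join x y = ([x, y], \<lambda>w. if w \<in> Obj then assoc_inv x y w else 0, [x \<otimes> y])"
definition unjoin where "unjoin x y = ([x \<otimes> y], \<lambda>w. if w \<in> Obj then \<a> x y w else 0, [x, y])"
definition punit where "punit = ([], \<lambda>w. if w \<in> Obj then linv w else 0, [\<one>])"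
definition unpunit where "unpunit = ([\<one>], \<lambda>w. if w \<in> Obj then \<l> w else 0, [])"

lemma emb_dom_cod [simp]:
  "sdom (emb t) = [bdom t]" "scod (emb t) = [bcod t]" "sdom (join x y) = [x, y]" "scod (join x y) = [x \<otimes> y]"
  "sdom (unjoin x y) = [x \<otimes> y]" "scod (unjoin x y) = [x, y]"
  "sdom punit = []" "scod punit = [\<one>]" "sdom unpunit = [\<one>]" "scod unpunit = []"
  by (simp_all add: emb_def bdom_def bcod_def join_def unjoin_def punit_def unpunit_def)

lemma sarr_emb [simp]:
  assumes "barr t"
  shows "sarr (emb t)"
proof -
  obtain x f y where t: "t = (x, f, y)" by (cases t) auto
  have f: "mor f x y" using assms t by (simp add: barr_def)
  then have O: "x \<in> Obj" "y \<in> Obj" by (auto simp: mor_def)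
  have "(f \<odot> idm w') \<cdot> (idm x \<odot> h) = (idm y \<odot> h) \<cdot> (f \<odot> idm w)" if h: "mor h w w'" for h w w'
    using m_tens_split[OF f h] by simp
  then show ?thesis
    unfolding sarr_def emb_def t using f O by (auto intro!: mor_tens mor_id dest: mor_Obj)
qed

lemma sarr_struct [simp]:
  "\<lbrakk>x \<in> Obj; y \<in> Obj\<rbrakk> \<Longrightarrow> sarr (join x y)" "\<lbrakk>x \<in> Obj; y \<in> Obj\<rbrakk> \<Longrightarrow> sarr (unjoin x y)"
  "sarr punit" "sarr unpunit"
proof -
  assume O: "x \<in> Obj" "y \<in> Obj"
  have nat: "\<a> x y w' \<cdot> (idm (x \<otimes> y) \<odot> h) = (idm x \<odot> (idm y \<odot> h)) \<cdot> \<a> x y w"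
    "assoc_inv x y w' \<cdot> (idm x \<odot> (idm y \<odot> h)) = (idm (x \<otimes> y) \<odot> h) \<cdot> assoc_inv x y w"
    if "mor h w w'" for h w w'
    using m_assoc_natural[OF mor_id[OF O(1)] mor_id[OF O(2)] that] tmor_id[OF O] by simp_all
  show "sarr (join x y)" "sarr (unjoin x y)"
    unfolding sarr_def join_def unjoin_def using O nat mor_assoc[OF O]
    by (auto intro: tobj_in_Obj dest: mor_Obj)
next
  show "sarr punit" "sarr unpunit"
    unfolding sarr_def punit_def unpunit_def using unit_in_Obj mor_lunit m_lunit_natural
    by (auto dest: mor_Obj)
qed

lemma join_unjoin [simp]:
  "\<lbrakk>x \<in> Obj; y \<in> Obj\<rbrakk> \<Longrightarrow> join x y \<circ>\<^sub>s unjoin x y = sid [x \<otimes> y]"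
  "\<lbrakk>x \<in> Obj; y \<in> Obj\<rbrakk> \<Longrightarrow> unjoin x y \<circ>\<^sub>s join x y = sid [x, y]"
  "punit \<circ>\<^sub>s unpunit = sid [\<one>]" "unpunit \<circ>\<^sub>s punit = sid []"
  using mor_assoc mor_lunit
  by (auto simp: scomp_def join_def unjoin_def punit_def unpunit_def sid_def fun_eq_iff)

text \<open>Right-nested composites hide an inverse pair from the plain equation
  \<open>g \<circ>\<^sub>s f = sid l\<close>; the form with a tail \<open>h\<close> lets rewriting
  cancel the pair in the middle of a word.\<close>

lemma cancel_left:
  assumes "sarr f" "sarr g" "scod f = sdom g" "g \<circ>\<^sub>s f = sid l" "sarr h" "scod h = l"
  shows "g \<circ>\<^sub>s f \<circ>\<^sub>s h = h"
proof -
  have "sdom f = l" using assms(4) by (metis sdom_simps(2,3))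
  then show ?thesis using sassoc[of h f g] assms by simp
qed

lemma cancel_wh:
  assumes "sarr f" "sarr g" "scod f = sdom g" "g \<circ>\<^sub>s f = sid l" "set k \<subseteq> Obj" "set r \<subseteq> Obj"
  shows "wh k g r \<circ>\<^sub>s wh k f r = sid (k @ l @ r)"
    "\<lbrakk>sarr h; scod h = k @ l @ r\<rbrakk> \<Longrightarrow> wh k g r \<circ>\<^sub>s wh k f r \<circ>\<^sub>s h = h"
proof -
  have l: "sdom f = l" using assms(4) by (metis sdom_simps(2,3))
  then have lO: "set l \<subseteq> Obj" using sarr_Obj(1)[OF assms(1)] by simp
  show *: "wh k g r \<circ>\<^sub>s wh k f r = sid (k @ l @ r)"
    using assms lO by (simp flip: wh_comp)
  show "wh k g r \<circ>\<^sub>s wh k f r \<circ>\<^sub>s h = h" if "sarr h" "scod h = k @ l @ r"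
    using assms that by (intro cancel_left[OF _ _ _ *]) simp_all
qed

lemma unit_Obj [simp]: "\<one> \<in> Obj" by (rule unit_in_Obj)
lemma tobj_Obj [simp]: "\<lbrakk>x \<in> Obj; y \<in> Obj\<rbrakk> \<Longrightarrow> x \<otimes> y \<in> Obj" by (rule tobj_in_Obj)

lemmas join_unjoin_cancel [simp] =
  cancel_left[OF sarr_struct(2) sarr_struct(1) _ join_unjoin(1), simplified]
  cancel_left[OF sarr_struct(1) sarr_struct(2) _ join_unjoin(2), simplified]
  cancel_left[OF sarr_struct(4) sarr_struct(3) _ join_unjoin(3), simplified]
  cancel_left[OF sarr_struct(3) sarr_struct(4) _ join_unjoin(4), simplified]
  cancel_wh[OF sarr_struct(2) sarr_struct(1) _ join_unjoin(1), simplified]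
  cancel_wh[OF sarr_struct(1) sarr_struct(2) _ join_unjoin(2), simplified]
  cancel_wh[OF sarr_struct(4) sarr_struct(3) _ join_unjoin(3), simplified]
  cancel_wh[OF sarr_struct(3) sarr_struct(4) _ join_unjoin(4), simplified]

text \<open>The component at \<open>\<one>\<close> is \<open>f \<odot> idm \<one>\<close>, which
  determines \<open>f\<close>. This is the step back from the strict category to the given
  one.\<close>

lemma emb_inject:
  assumes "barr s" "barr t" "bdom s = bdom t" "bcod s = bcod t" "emb s = emb t"
  shows "s = t"
proof -
  obtain x f y where s: "s = (x, f, y)" by (cases s) auto
  obtain g where t: "t = (x, g, y)" using assms(3,4) s by (cases t) auto
  have "f \<odot> idm \<one> = g \<odot> idm \<one>"
    using assms(5) unit_in_Obj unfolding emb_def s t by (auto simp: fun_eq_iff split: if_splits)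
  then have "f = g" using tens_unit_right_cancel assms(1,2) unfolding s t barr_def by blast
  then show ?thesis using s t by simp
qed

lemma emb_comp [simp]: "\<lbrakk>barr s; barr t; bcod t = bdom s\<rbrakk> \<Longrightarrow> emb (s \<circ>\<^sub>b t) = emb s \<circ>\<^sub>s emb t"
  by (auto simp: emb_def scomp_def bcomp_def barr_def bdom_def bcod_def fun_eq_iff m_tens_comp_left
      split: prod.splits)

lemma emb_id [simp]: "x \<in> Obj \<Longrightarrow> emb (bid x) = sid [x]"
  by (auto simp: emb_def bid_def sid_def fun_eq_iff tmor_id)

text \<open>Naturality of the associator at \<open>f\<close>, \<open>g\<close> and
  \<open>idm w\<close> moves the brackets; afterwards the tensor product is a word of whiskerings in
  which the right factor acts first.\<close>

lemma emb_tens [simp]: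
  assumes "barr s" "barr t"
  shows "emb (s \<otimes>\<^sub>b t) = join (bcod s) (bcod t) \<circ>\<^sub>s wh [] (emb s) [bcod t] \<circ>\<^sub>s wh [bdom s] (emb t) []
    \<circ>\<^sub>s unjoin (bdom s) (bdom t)"
proof -
  obtain x f x' where s: "s = (x, f, x')" by (cases s) auto
  obtain y g y' where t: "t = (y, g, y')" by (cases t) auto
  have f: "mor f x x'" and g: "mor g y y'" using assms by (auto simp: s t barr_def)
  then have O: "x \<in> Obj" "x' \<in> Obj" "y \<in> Obj" "y' \<in> Obj" by (auto simp: mor_def)
  have "(f \<odot> g) \<odot> idm w = assoc_inv x' y' w \<cdot> ((f \<odot> idm (y' \<otimes> w)) \<cdot> ((idm x \<odot> (g \<odot> idm w)) \<cdot> \<a> x y w))"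
    if w: "w \<in> Obj" for w
  proof -
    have gw: "mor (g \<odot> idm w) (y \<otimes> w) (y' \<otimes> w)" using g w by (auto intro: mor_tens mor_id)
    have 1: "mor (idm x \<odot> (g \<odot> idm w)) (x \<otimes> (y \<otimes> w)) (x \<otimes> (y' \<otimes> w))"
      and 2: "mor (f \<odot> idm (y' \<otimes> w)) (x \<otimes> (y' \<otimes> w)) (x' \<otimes> (y' \<otimes> w))"
      and 3: "mor ((f \<odot> g) \<odot> idm w) ((x \<otimes> y) \<otimes> w) ((x' \<otimes> y') \<otimes> w)"
      using f g gw w O by (auto intro!: mor_tens mor_id)
    have "(f \<odot> idm (y' \<otimes> w)) \<cdot> ((idm x \<odot> (g \<odot> idm w)) \<cdot> \<a> x y w) = (f \<odot> (g \<odot> idm w)) \<cdot> \<a> x y w"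
      using m_assoc[OF 2 1 mor_assoc(1)] O w m_tens_split(1)[OF f gw] by simp
    also have "\<dots> = \<a> x' y' w \<cdot> ((f \<odot> g) \<odot> idm w)"
      using m_assoc_natural(1)[OF f g mor_id[OF w]] by simp
    finally show ?thesis
      using m_assoc[OF mor_assoc(2,1) 3] mor_assoc(3)[of x' y' w] m_id(1)[OF 3] O w by simp
  qed
  then show ?thesis
    by (auto simp: emb_def s t scomp_def wh_def join_def unjoin_def fun_eq_iff O btens_def)
qed

text \<open>This is the pentagon with \<open>w\<close> as its last object. In the strict category
  the associator is a mere regrouping of list entries, which rewriting cancels.\<close>

lemma emb_assoc [simp]:
  assumes "x \<in> Obj" "y \<in> Obj" "z \<in> Obj"
  shows "emb (bassoc x y z) = join x (y \<otimes> z) \<circ>\<^sub>s wh [x] (join y z) [] \<circ>\<^sub>s wh [] (unjoin x y) [z]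
    \<circ>\<^sub>s unjoin (x \<otimes> y) z"
proof -
  have "\<a> x y z \<odot> idm w = assoc_inv x (y \<otimes> z) w \<cdot> ((idm x \<odot> assoc_inv y z w) \<cdot> (\<a> x y (z \<otimes> w) \<cdot> \<a> (x \<otimes> y) z w))"
    if w: "w \<in> Obj" for w
  proof -
    note O = assms w
    have 1: "mor (\<a> x y z \<odot> idm w) (((x \<otimes> y) \<otimes> z) \<otimes> w) ((x \<otimes> (y \<otimes> z)) \<otimes> w)"
      and 2: "mor (idm x \<odot> \<a> y z w) (x \<otimes> ((y \<otimes> z) \<otimes> w)) (x \<otimes> (y \<otimes> (z \<otimes> w)))"
      and 3: "mor (idm x \<odot> assoc_inv y z w) (x \<otimes> (y \<otimes> (z \<otimes> w))) (x \<otimes> ((y \<otimes> z) \<otimes> w))"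
      using O by (auto intro!: mor_tens mor_id mor_assoc)
    have 4: "mor (\<a> x (y \<otimes> z) w) ((x \<otimes> (y \<otimes> z)) \<otimes> w) (x \<otimes> ((y \<otimes> z) \<otimes> w))"
      and 5: "mor (assoc_inv x (y \<otimes> z) w) (x \<otimes> ((y \<otimes> z) \<otimes> w)) ((x \<otimes> (y \<otimes> z)) \<otimes> w)"
      and 6: "assoc_inv x (y \<otimes> z) w \<cdot> \<a> x (y \<otimes> z) w = idm ((x \<otimes> (y \<otimes> z)) \<otimes> w)"
      using mor_assoc[of x "y \<otimes> z" w] O by auto
    have 7: "(idm x \<odot> assoc_inv y z w) \<cdot> (idm x \<odot> \<a> y z w) = idm (x \<otimes> ((y \<otimes> z) \<otimes> w))"
      using m_tens_comp_right[OF O(1) mor_assoc(2)[OF O(2-4)] mor_assoc(1)[OF O(2-4)]] mor_assoc(3)[of y z w] tmor_id[of x "(y \<otimes> z) \<otimes> w"] O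
      by simp
    have "(idm x \<odot> assoc_inv y z w) \<cdot> (\<a> x y (z \<otimes> w) \<cdot> \<a> (x \<otimes> y) z w)
        = (idm x \<odot> assoc_inv y z w) \<cdot> ((idm x \<odot> \<a> y z w) \<cdot> (\<a> x (y \<otimes> z) w \<cdot> (\<a> x y z \<odot> idm w)))"
      using pentagon[OF O] m_assoc[OF 2 4 1] by simp
    also have "\<dots> = \<a> x (y \<otimes> z) w \<cdot> (\<a> x y z \<odot> idm w)"
      using m_assoc[OF 3 2 mor_comp[OF 4 1]] 7 m_id(1)[OF mor_comp[OF 4 1]] by simp
    finally show ?thesis using m_assoc[OF 5 4 1] 6 m_id(1)[OF 1] by simp
  qed
  then show ?thesis
    by (auto simp: emb_def scomp_def wh_def join_def unjoin_def fun_eq_iff assms bassoc_def)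
qed

text \<open>Kelly's identity \<open>lunit_tens\<close>, read at every \<open>w\<close>. For the
  right unitor the triangle axiom takes its place.\<close>

lemma emb_lunit [simp]:
  assumes "x \<in> Obj"
  shows "emb (blunit x) = wh [] unpunit [x] \<circ>\<^sub>s unjoin \<one> x"
  using lunit_tens[OF assms]
  by (auto simp: emb_def scomp_def wh_def unpunit_def unjoin_def fun_eq_iff assms blunit_def)

lemma emb_runit [simp]:
  assumes "x \<in> Obj"
  shows "emb (brunit x) = wh [x] unpunit [] \<circ>\<^sub>s unjoin x \<one>"
  using triangle[OF assms]
  by (auto simp: emb_def scomp_def wh_def unpunit_def unjoin_def fun_eq_iff assms brunit_def)

lemma inverse_unique:
  assumes "sarr f" "sarr g" "sarr h" "sdom g = scod f" "scod g = sdom f" "sdom h = scod f" "scod h = sdom f"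
    "g \<circ>\<^sub>s f = sid (sdom f)" "f \<circ>\<^sub>s h = sid (scod f)"
  shows "g = h"
proof -
  have "g \<circ>\<^sub>s f \<circ>\<^sub>s h = (g \<circ>\<^sub>s f) \<circ>\<^sub>s h" using sassoc[OF assms(3,1,2)] assms(5-7) assms(4) by simp
  then show ?thesis using assms by simp
qed

text \<open>Images of the inverse coherence maps follow from the images of the maps themselves by
  uniqueness of inverses, without a second appeal to the coherence axioms.\<close>

lemma emb_inverse:
  assumes "barr s" "barr t" "bdom t = bcod s" "bcod t = bdom s" "t \<circ>\<^sub>b s = bid (bdom s)"
    and "sarr h" "sdom h = [bcod s]" "scod h = [bdom s]" "emb s \<circ>\<^sub>s h = sid [bcod s]"
  shows "emb t = h"
proof (rule inverse_unique[of "emb s"])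
  have "emb t \<circ>\<^sub>s emb s = emb (t \<circ>\<^sub>b s)"
    by (rule emb_comp[symmetric]) (use assms in simp_all)
  also have "\<dots> = sid [bdom s]"
    unfolding assms(5) using assms(1) by simp
  finally show "emb t \<circ>\<^sub>s emb s = sid (sdom (emb s))" by simp
qed (use assms in auto)

lemma b_inverses:
  "\<lbrakk>x \<in> Obj; y \<in> Obj; z \<in> Obj\<rbrakk> \<Longrightarrow> bassoc' x y z \<circ>\<^sub>b bassoc x y z = bid ((x \<otimes> y) \<otimes> z)"
  "x \<in> Obj \<Longrightarrow> blunit' x \<circ>\<^sub>b blunit x = bid (\<one> \<otimes> x)"
  "x \<in> Obj \<Longrightarrow> brunit' x \<circ>\<^sub>b brunit x = bid (x \<otimes> \<one>)"
  using mor_assoc mor_lunit mor_runit by (simp_all add: bdefs)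

lemma emb_assoc' [simp]:
  assumes "x \<in> Obj" "y \<in> Obj" "z \<in> Obj"
  shows "emb (bassoc' x y z) = join (x \<otimes> y) z \<circ>\<^sub>s wh [] (join x y) [z] \<circ>\<^sub>s wh [x] (unjoin y z) []
    \<circ>\<^sub>s unjoin x (y \<otimes> z)"
  by (rule emb_inverse[of "bassoc x y z"]) (use assms in \<open>simp_all add: b_inverses\<close>)

lemma emb_lunit' [simp]: "x \<in> Obj \<Longrightarrow> emb (blunit' x) = join \<one> x \<circ>\<^sub>s wh [] punit [x]"
  by (rule emb_inverse[of "blunit x"]) (simp_all add: b_inverses)

lemma emb_runit' [simp]: "x \<in> Obj \<Longrightarrow> emb (brunit' x) = join x \<one> \<circ>\<^sub>s wh [x] punit []"
  by (rule emb_inverse[of "brunit x"]) (simp_all add: b_inverses)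

end

section \<open>Modules over an algebra as algebras over a monad\<close>

context linear_category
begin

text \<open>Appends a tail to an equation between composites while keeping both sides nested to the
  right, as the equation chains below require.\<close>

lemma m_ext:
  assumes "mor g y z" "mor f x y" "mor g' y' z" "mor f' x y'" "g \<cdot> f = g' \<cdot> f'" "mor h w x"
  shows "g \<cdot> (f \<cdot> h) = g' \<cdot> (f' \<cdot> h)"
  using m_assoc[OF assms(1,2,6)] m_assoc[OF assms(3,4,6)] assms(5) by simp

end

context abelian_category
begin

text \<open>\<open>j\<close> is the kernel of \<open>idm x - e\<close>. That map kills
  \<open>e\<close>, so \<open>e\<close> factors as \<open>j \<cdot> p\<close>, and uniqueness of the
  factorisation of \<open>j\<close> through itself gives \<open>p \<cdot> j = idm k\<close>.\<close>

lemma idempotent_splits: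
  assumes e: "mor e x x" "e \<cdot> e = e"
  obtains k j p where "mor j k x" "mor p x k" "p \<cdot> j = idm k" "j \<cdot> p = e"
proof -
  have x: "x \<in> Obj" using e by (simp add: mor_def)
  let ?f = "idm x - e"
  have f: "mor ?f x x" using mor_id[OF x] e(1) by (rule mor_diff)
  obtain k j where k: "is_kernel x x ?f k j" using kernels[OF x x mor_Hom[OF f]] by blast
  then have kO: "k \<in> Obj" and j: "mor j k x" and fj: "?f \<cdot> j = 0"
    using x by (auto simp: is_kernel_def mor_def)
  have U: "\<exists>!h. h \<in> Hom w k \<and> j \<cdot> h = g" if "w \<in> Obj" "g \<in> Hom w x" "?f \<cdot> g = 0" for w g
    using k that by (auto simp: is_kernel_def)
  have ej: "e \<cdot> j = j" using fj m_diff(1)[OF mor_id[OF x] e(1) j] m_id(1)[OF j] by simp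
  have "?f \<cdot> e = 0" using m_diff(1)[OF mor_id[OF x] e(1) e(1)] m_id(1)[OF e(1)] e(2) by simp
  then obtain p where p: "mor p x k" "j \<cdot> p = e"
    using U[OF x mor_Hom[OF e(1)]] x kO by (auto simp: mor_def)
  have pj: "mor (p \<cdot> j) k k" using p(1) j by (rule mor_comp)
  have "j \<cdot> (p \<cdot> j) = j" using m_assoc[OF j p(1) j] p(2) ej by simp
  then have "p \<cdot> j = idm k"
    using U[OF kO mor_Hom[OF j] fj] mor_Hom[OF pj] id_in_Hom[OF kO] m_id(2)[OF j] by metis
  then show ?thesis using that j p by blast
qed

end

context algebra_object
begin

lemma A_Obj [simp]: "A \<in> Obj" by (rule alg_in_Obj)

lemma mor_m: "mor m (A \<otimes> A) A" and mor_i: "mor i \<one> A"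
  using mult_in_Hom unit_in_Hom by (simp_all add: mor_def)

lemma barr_alg [simp]: "barr (A \<otimes> A, m, A)" "barr (\<one>, i, A)" 
  using mor_m mor_i by simp_all

text \<open>\<open>m\<close> and \<open>i\<close> as arrows \<open>[A, A] \<rightarrow> [A]\<close>
  and \<open>[] \<rightarrow> [A]\<close>; in this form the algebra laws contain neither associators
  nor unitors.\<close>

definition mhat where "mhat = emb (A \<otimes> A, m, A) \<circ>\<^sub>s join A A"
definition ihat where "ihat = emb (\<one>, i, A) \<circ>\<^sub>s punit"

lemma mhat_simps [simp]: "sarr mhat" "sdom mhat = [A, A]" "scod mhat = [A]"
  "sarr ihat" "sdom ihat = []" "scod ihat = [A]"
  by (simp_all add: mhat_def ihat_def)

lemma emb_mi: "emb (A \<otimes> A, m, A) = mhat \<circ>\<^sub>s unjoin A A" "emb (\<one>, i, A) = ihat \<circ>\<^sub>s unpunit"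
  by (simp_all add: mhat_def ihat_def)

lemma mhat_assoc: "mhat \<circ>\<^sub>s wh [] mhat [A] = mhat \<circ>\<^sub>s wh [A] mhat []"
proof -
  \<comment> \<open>\<open>?J\<close> regroups \<open>[A, A, A]\<close> into the object
    \<open>(A \<otimes> A) \<otimes> A\<close>; precomposing with it cancels all bracketing maps at
    the source.\<close>
  let ?M = "(A \<otimes> A, m, A)" and ?J = "join (A \<otimes> A) A \<circ>\<^sub>s wh [] (join A A) [A]"
  have "?M \<circ>\<^sub>b (?M \<otimes>\<^sub>b bid A) = (?M \<circ>\<^sub>b (bid A \<otimes>\<^sub>b ?M)) \<circ>\<^sub>b bassoc A A A"
    using mult_assoc by (simp add: bdefs)
  then have "emb (?M \<circ>\<^sub>b (?M \<otimes>\<^sub>b bid A)) \<circ>\<^sub>s ?J = emb ((?M \<circ>\<^sub>b (bid A \<otimes>\<^sub>b ?M)) \<circ>\<^sub>b bassoc A A A) \<circ>\<^sub>s ?J"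
    by simp
  then show ?thesis by (simp add: emb_mi)
qed

lemma mhat_unit: "mhat \<circ>\<^sub>s wh [] ihat [A] = sid [A]" "mhat \<circ>\<^sub>s wh [A] ihat [] = sid [A]"
proof -
  let ?M = "(A \<otimes> A, m, A)" and ?I = "(\<one>, i, A)"
  have "?M \<circ>\<^sub>b (?I \<otimes>\<^sub>b bid A) = blunit A" "?M \<circ>\<^sub>b (bid A \<otimes>\<^sub>b ?I) = brunit A"
    using mult_unit_left mult_unit_right by (simp_all add: bdefs)
  then have "emb (?M \<circ>\<^sub>b (?I \<otimes>\<^sub>b bid A)) \<circ>\<^sub>s join \<one> A \<circ>\<^sub>s wh [] punit [A]
      = emb (blunit A) \<circ>\<^sub>s join \<one> A \<circ>\<^sub>s wh [] punit [A]"
    and "emb (?M \<circ>\<^sub>b (bid A \<otimes>\<^sub>b ?I)) \<circ>\<^sub>s join A \<one> \<circ>\<^sub>s wh [A] punit []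
      = emb (brunit A) \<circ>\<^sub>s join A \<one> \<circ>\<^sub>s wh [A] punit []"
    by simp_all
  then show "mhat \<circ>\<^sub>s wh [] ihat [A] = sid [A]" "mhat \<circ>\<^sub>s wh [A] ihat [] = sid [A]"
    by (simp_all add: emb_mi)
qed

lemma mhat_wh:
  assumes "set k \<subseteq> Obj" "set r \<subseteq> Obj"
  shows "wh k mhat r \<circ>\<^sub>s wh k mhat (A # r) = wh k mhat r \<circ>\<^sub>s wh (k @ [A]) mhat r"
    "wh k mhat r \<circ>\<^sub>s wh k ihat (A # r) = sid (k @ [A] @ r)"
    "wh k mhat r \<circ>\<^sub>s wh (k @ [A]) ihat r = sid (k @ [A] @ r)"
  using arg_cong[OF mhat_assoc, of "\<lambda>f. wh k f r"] arg_cong[OF mhat_unit(1), of "\<lambda>f. wh k f r"]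
    arg_cong[OF mhat_unit(2), of "\<lambda>f. wh k f r"] assms
  by simp_all

text \<open>Multiplication and unit of the monad of tensoring with \<open>A\<close> on the left. The
  associator and the unitor are absorbed here once, so that modules become algebras over a
  monad.\<close>

definition fmult :: "'o \<Rightarrow> 'm" where "fmult x = (m \<odot> idm x) \<cdot> assoc_inv A A x"
definition funit :: "'o \<Rightarrow> 'm" where "funit x = (i \<odot> idm x) \<cdot> linv x"
abbreviation T :: "'m \<Rightarrow> 'm" where "T f \<equiv> idm A \<odot> f"

lemma bfree:
  "(A \<otimes> (A \<otimes> x), fmult x, A \<otimes> x) = ((A \<otimes> A, m, A) \<otimes>\<^sub>b bid x) \<circ>\<^sub>b bassoc' A A x"
  "(x, funit x, A \<otimes> x) = ((\<one>, i, A) \<otimes>\<^sub>b bid x) \<circ>\<^sub>b blunit' x"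
  by (simp_all add: bdefs fmult_def funit_def)

lemma mor_T: "mor f x y \<Longrightarrow> mor (T f) (A \<otimes> x) (A \<otimes> y)"
  by (rule mor_tens[OF mor_id]) simp_all

lemma T_comp: "\<lbrakk>mor g y z; mor f x y\<rbrakk> \<Longrightarrow> T (g \<cdot> f) = T g \<cdot> T f"
  by (rule m_tens_comp_right) simp_all

lemma T_id: "x \<in> Obj \<Longrightarrow> T (idm x) = idm (A \<otimes> x)"
  by (simp add: tmor_id)

lemma mor_fmult: "x \<in> Obj \<Longrightarrow> mor (fmult x) (A \<otimes> (A \<otimes> x)) (A \<otimes> x)"
  unfolding fmult_def by (rule mor_comp[OF mor_tens[OF mor_m mor_id] mor_assoc(2)]) simp_all

lemma mor_funit: "x \<in> Obj \<Longrightarrow> mor (funit x) x (A \<otimes> x)"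
  unfolding funit_def by (rule mor_comp[OF mor_tens[OF mor_i mor_id] mor_lunit(2)]) simp_all

lemma emb_free [simp]:
  assumes "x \<in> Obj"
  shows "emb (A \<otimes> (A \<otimes> x), fmult x, A \<otimes> x)
      = join A x \<circ>\<^sub>s wh [] mhat [x] \<circ>\<^sub>s wh [A] (unjoin A x) [] \<circ>\<^sub>s unjoin A (A \<otimes> x)"
    "emb (x, funit x, A \<otimes> x) = join A x \<circ>\<^sub>s wh [] ihat [x]"
  unfolding bfree using assms by (simp_all add: emb_mi)

lemma fmult_natural:
  assumes f: "mor f x y"
  shows "fmult y \<cdot> T (T f) = T f \<cdot> fmult x"
proof -
  have x: "x \<in> Obj" and y: "y \<in> Obj" using f by (auto simp: mor_def)
  have mx: "mor (m \<odot> idm x) ((A \<otimes> A) \<otimes> x) (A \<otimes> x)" and my: "mor (m \<odot> idm y) ((A \<otimes> A) \<otimes> y) (A \<otimes> y)"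
    and af: "mor (idm (A \<otimes> A) \<odot> f) ((A \<otimes> A) \<otimes> x) ((A \<otimes> A) \<otimes> y)"
    using x y f by (auto intro!: mor_tens mor_id mor_m)
  have "fmult y \<cdot> T (T f) = (m \<odot> idm y) \<cdot> (assoc_inv A A y \<cdot> T (T f))"
    unfolding fmult_def using m_assoc[OF my mor_assoc(2) mor_T[OF mor_T[OF f]]] y by simp
  also have "assoc_inv A A y \<cdot> T (T f) = (idm (A \<otimes> A) \<odot> f) \<cdot> assoc_inv A A x"
    using m_assoc_natural(2)[OF mor_id mor_id f, of A A] tmor_id[of A A] by simp
  also have "(m \<odot> idm y) \<cdot> \<dots> = ((m \<odot> idm y) \<cdot> (idm (A \<otimes> A) \<odot> f)) \<cdot> assoc_inv A A x"
    using m_assoc[OF my af mor_assoc(2)] x by simp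
  also have "(m \<odot> idm y) \<cdot> (idm (A \<otimes> A) \<odot> f) = T f \<cdot> (m \<odot> idm x)"
    using m_tens_split[OF mor_m f] by simp
  finally show ?thesis
    unfolding fmult_def using m_assoc[OF mor_T[OF f] mx mor_assoc(2)] x by simp
qed

lemma funit_natural:
  assumes f: "mor f x y"
  shows "funit y \<cdot> f = T f \<cdot> funit x"
proof -
  have x: "x \<in> Obj" and y: "y \<in> Obj" using f by (auto simp: mor_def)
  have ix: "mor (i \<odot> idm x) (\<one> \<otimes> x) (A \<otimes> x)" and iy: "mor (i \<odot> idm y) (\<one> \<otimes> y) (A \<otimes> y)"
    and af: "mor (idm \<one> \<odot> f) (\<one> \<otimes> x) (\<one> \<otimes> y)"
    using x y f by (auto intro!: mor_tens mor_id mor_i)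
  have "funit y \<cdot> f = (i \<odot> idm y) \<cdot> (linv y \<cdot> f)"
    unfolding funit_def using m_assoc[OF iy mor_lunit(2) f] y by simp
  also have "linv y \<cdot> f = (idm \<one> \<odot> f) \<cdot> linv x" using m_lunit_natural(2)[OF f] .
  also have "(i \<odot> idm y) \<cdot> \<dots> = ((i \<odot> idm y) \<cdot> (idm \<one> \<odot> f)) \<cdot> linv x"
    using m_assoc[OF iy af mor_lunit(2)] x by simp
  also have "(i \<odot> idm y) \<cdot> (idm \<one> \<odot> f) = T f \<cdot> (i \<odot> idm x)"
    using m_tens_split[OF mor_i f] by simp
  finally show ?thesis
    unfolding funit_def using m_assoc[OF mor_T[OF f] ix mor_lunit(2)] x by simp
qed

text \<open>In the strict category these are the laws of \<open>mhat\<close> whiskered by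
  \<open>[x]\<close>, once interchange has moved the bracketing map \<open>unjoin A x\<close> past
  the arrow acting on its left.\<close>

lemma monad_laws:
  assumes x: "x \<in> Obj"
  shows "fmult x \<cdot> fmult (A \<otimes> x) = fmult x \<cdot> T (fmult x)"
    "fmult x \<cdot> funit (A \<otimes> x) = idm (A \<otimes> x)"
    "fmult x \<cdot> T (funit x) = idm (A \<otimes> x)"
proof -
  let ?\<mu> = "\<lambda>x. (A \<otimes> (A \<otimes> x), fmult x, A \<otimes> x)" and ?\<eta> = "\<lambda>x. (x, funit x, A \<otimes> x)"
  have b [simp]: "barr (?\<mu> x)" "barr (?\<mu> (A \<otimes> x))" "barr (?\<eta> x)" "barr (?\<eta> (A \<otimes> x))"
    using x mor_fmult mor_funit by simp_all
  have w: "wh [] mhat [x] \<circ>\<^sub>s wh [] mhat [A, x] = wh [] mhat [x] \<circ>\<^sub>s wh [A] mhat [x]"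
    "wh [] mhat [x] \<circ>\<^sub>s wh [] ihat [A, x] = sid [A, x]" "wh [] mhat [x] \<circ>\<^sub>s wh [A] ihat [x] = sid [A, x]"
    using mhat_wh[of "[]" "[x]"] x by simp_all
  have w': "wh [] mhat [x] \<circ>\<^sub>s wh [] mhat [A, x] \<circ>\<^sub>s h = wh [] mhat [x] \<circ>\<^sub>s wh [A] mhat [x] \<circ>\<^sub>s h"
    if "sarr h" "scod h = [A, A, A, x]" for h
    using arg_cong[OF w(1), of "\<lambda>f. f \<circ>\<^sub>s h"] that x by simp
  have w'': "wh [] mhat [x] \<circ>\<^sub>s wh [] ihat [A, x] \<circ>\<^sub>s h = h"
    "wh [] mhat [x] \<circ>\<^sub>s wh [A] ihat [x] \<circ>\<^sub>s h = h"
    if "sarr h" "scod h = [A, x]" for h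
    using arg_cong[OF w(2), of "\<lambda>f. f \<circ>\<^sub>s h"] arg_cong[OF w(3), of "\<lambda>f. f \<circ>\<^sub>s h"] that x by simp_all
  have ic: "wh [A] (unjoin A x) [] \<circ>\<^sub>s wh [] mhat [A \<otimes> x] = wh [] mhat [A, x] \<circ>\<^sub>s wh [A, A] (unjoin A x) []"
    using interchange[of mhat "unjoin A x" "[]" "[]" "[]"] x by simp
  have ic': "wh [A] (unjoin A x) [] \<circ>\<^sub>s wh [] mhat [A \<otimes> x] \<circ>\<^sub>s h
      = wh [] mhat [A, x] \<circ>\<^sub>s wh [A, A] (unjoin A x) [] \<circ>\<^sub>s h" if "sarr h" "scod h = [A, A, A \<otimes> x]" for h
    using arg_cong[OF ic, of "\<lambda>f. f \<circ>\<^sub>s h"] that x by simp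
  have jc: "wh [A] (unjoin A x) [] \<circ>\<^sub>s wh [] ihat [A \<otimes> x] = wh [] ihat [A, x] \<circ>\<^sub>s unjoin A x"
    using interchange[of ihat "unjoin A x" "[]" "[]" "[]"] x by simp
  have "emb (?\<mu> x \<circ>\<^sub>b ?\<mu> (A \<otimes> x)) = emb (?\<mu> x \<circ>\<^sub>b (bid A \<otimes>\<^sub>b ?\<mu> x))"
    using x by (simp add: w' ic')
  then have "?\<mu> x \<circ>\<^sub>b ?\<mu> (A \<otimes> x) = ?\<mu> x \<circ>\<^sub>b (bid A \<otimes>\<^sub>b ?\<mu> x)"
    using x by (intro emb_inject) simp_all
  then show "fmult x \<cdot> fmult (A \<otimes> x) = fmult x \<cdot> T (fmult x)" by (simp add: bdefs)
  have "emb (?\<mu> x \<circ>\<^sub>b ?\<eta> (A \<otimes> x)) = emb (bid (A \<otimes> x))"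
    using x by (simp add: w'' jc)
  then have "?\<mu> x \<circ>\<^sub>b ?\<eta> (A \<otimes> x) = bid (A \<otimes> x)"
    using x by (intro emb_inject) simp_all
  then show "fmult x \<cdot> funit (A \<otimes> x) = idm (A \<otimes> x)" by (simp add: bdefs)
  have "emb (?\<mu> x \<circ>\<^sub>b (bid A \<otimes>\<^sub>b ?\<eta> x)) = emb (bid (A \<otimes> x))"
    using x by (simp add: w'')
  then have "?\<mu> x \<circ>\<^sub>b (bid A \<otimes>\<^sub>b ?\<eta> x) = bid (A \<otimes> x)"
    using x by (intro emb_inject) simp_all
  then show "fmult x \<cdot> T (funit x) = idm (A \<otimes> x)" by (simp add: bdefs)
qed

text \<open>The associator and the left unitor are invertible, so composing with them or with their
  inverses passes between the two forms of each module axiom.\<close>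

lemma is_left_module_iff:
  "is_left_module x act \<longleftrightarrow> mor act (A \<otimes> x) x \<and> act \<cdot> T act = act \<cdot> fmult x \<and> act \<cdot> funit x = idm x"
proof (cases "mor act (A \<otimes> x) x")
  case act: True
  then have x: "x \<in> Obj" by (simp add: mor_def)
  note a = mor_assoc[OF A_Obj A_Obj x] and l = mor_lunit[OF x]
  have mx: "mor (m \<odot> idm x) ((A \<otimes> A) \<otimes> x) (A \<otimes> x)" and ix: "mor (i \<odot> idm x) (\<one> \<otimes> x) (A \<otimes> x)"
    using x by (auto intro!: mor_tens mor_id mor_m mor_i)
  have am: "mor (act \<cdot> (m \<odot> idm x)) ((A \<otimes> A) \<otimes> x) x" and ai: "mor (act \<cdot> (i \<odot> idm x)) (\<one> \<otimes> x) x"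
    using act mx ix by (blast intro: mor_comp)+
  have aa: "mor (act \<cdot> T act) (A \<otimes> (A \<otimes> x)) x" using act mor_T[OF act] by (rule mor_comp)
  have "act \<cdot> (m \<odot> idm x) = act \<cdot> T act \<cdot> \<a> A A x \<longleftrightarrow> act \<cdot> T act = act \<cdot> fmult x"
  proof
    assume "act \<cdot> (m \<odot> idm x) = act \<cdot> T act \<cdot> \<a> A A x"
    then have "act \<cdot> (m \<odot> idm x) \<cdot> assoc_inv A A x = act \<cdot> T act"
      using m_assoc[OF aa a(1,2)] a(4) m_id(2)[OF aa] by simp
    then show "act \<cdot> T act = act \<cdot> fmult x" unfolding fmult_def using m_assoc[OF act mx a(2)] by simp
  next
    assume "act \<cdot> T act = act \<cdot> fmult x"
    then have "act \<cdot> T act = act \<cdot> (m \<odot> idm x) \<cdot> assoc_inv A A x"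
      unfolding fmult_def using m_assoc[OF act mx a(2)] by simp
    then show "act \<cdot> (m \<odot> idm x) = act \<cdot> T act \<cdot> \<a> A A x"
      using m_assoc[OF am a(2,1)] a(3) m_id(2)[OF am] by simp
  qed
  moreover have "act \<cdot> (i \<odot> idm x) = \<l> x \<longleftrightarrow> act \<cdot> funit x = idm x"
  proof
    assume "act \<cdot> (i \<odot> idm x) = \<l> x"
    then show "act \<cdot> funit x = idm x" unfolding funit_def using m_assoc[OF act ix l(2)] l(4) by simp
  next
    assume "act \<cdot> funit x = idm x"
    then have "act \<cdot> (i \<odot> idm x) \<cdot> linv x \<cdot> \<l> x = \<l> x"
      unfolding funit_def using m_assoc[OF act ix l(2)] m_id(1)[OF l(1)] by simp
    then show "act \<cdot> (i \<odot> idm x) = \<l> x" using m_assoc[OF ai l(2,1)] l(3) m_id(2)[OF ai] by simp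
  qed
  ultimately show ?thesis using act x by (auto simp: is_left_module_def mor_def)
qed (auto simp: is_left_module_def mor_def)

end

section \<open>The linear category of modules, free modules and Kleisli composition\<close>

context algebra_object
begin

lemma module_category_simps [simp]:
  "objects module_category = {(x, act). is_left_module x act}"
  "compose module_category = compose C"
  "scale module_category = scale C"
  "identity module_category (x, act) = idm x"
  by (simp_all add: module_category_def)

lemma module_homset: "f \<in> homset module_category (x, act) (y, act')
    \<longleftrightarrow> f \<in> Hom x y \<and> f \<cdot> act = act' \<cdot> T f"
  by (simp add: module_category_def)

lemma moduleD:
  assumes "is_left_module x act"
  shows "x \<in> Obj" "mor act (A \<otimes> x) x" "act \<cdot> T act = act \<cdot> fmult x" "act \<cdot> funit x = idm x"
  using assms by (auto simp: is_left_module_iff mor_def)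

lemma subspace_module_hom:
  assumes x: "is_left_module x a" and y: "is_left_module y b"
  shows "subspace (homset module_category (x, a) (y, b))"
proof -
  note X = moduleD[OF x] and Y = moduleD[OF y]
  have M: "mor f x y" if "f \<in> Hom x y" for f using that X Y by (simp add: mor_def)
  have sub: "subspace (Hom x y)" using Hom_subspace X Y by blast
  have add: "(f + g) \<cdot> a = b \<cdot> T (f + g)" if "f \<in> Hom x y" "g \<in> Hom x y" "f \<cdot> a = b \<cdot> T f" "g \<cdot> a = b \<cdot> T g" for f g
    using m_add(1)[OF M M X(2)] m_add(2)[OF Y(2) mor_T mor_T, OF M M] that
      tmor_add_right[OF A_Obj A_Obj X(1) Y(1) id_in_Hom[OF A_Obj]] by simp
  have sc: "scale C c f \<cdot> a = b \<cdot> T (scale C c f)" if "f \<in> Hom x y" "f \<cdot> a = b \<cdot> T f" for f c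
    using m_scale(1)[OF M X(2)] m_scale(2)[OF Y(2) mor_T, OF M] that
      m_tens_scale(2)[OF mor_id[OF A_Obj] M] by simp
  have "homset module_category (x, a) (y, b) = {f \<in> Hom x y. f \<cdot> a = b \<cdot> T f}"
    by (auto simp: module_homset)
  then show ?thesis
    unfolding subspace_def
    using subspace_0[OF sub] subspace_add[OF sub] subspace_scale[OF sub] add sc
      m_zero(1)[OF X(2) Y(1)] m_zero(2)[OF Y(2), of "A \<otimes> x"] X(1)
      m_tens_zero_right[OF mor_id[OF A_Obj] X(1) Y(1)]
    by simp
qed

text \<open>The given finite spanning set need not lie in \<open>V\<close>, so a basis of
  \<open>V\<close> is chosen anew; independence inside a finitely spanned space bounds it. It serves
  the spaces of module maps inside Hom spaces.\<close>

lemma finite_basis_subspace: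
  assumes "finite B0" "subspace V" "V \<subseteq> span B0"
  shows "\<exists>B. finite B \<and> span B = V"
proof -
  obtain B where B: "B \<subseteq> V" "independent B" "V \<subseteq> span B"
    using basis_exists[of V] by metis
  have "finite B"
    using independent_card_le_dim_finite(1)[OF assms(1) refl subset_trans[OF B(1) assms(3)] B(2)] .
  moreover have "span B = V" using span_minimal[OF B(1) assms(2)] B(3) by (rule subset_antisym)
  ultimately show ?thesis by (intro exI[of _ B]) (rule conjI)
qed

lemma linear_module_category: "linear_category module_category"
proof -
  have M: "mor f x y" if "f \<in> Hom x y" "is_left_module x a" "is_left_module y b" for f x y a b
    using that moduleD(1) by (simp add: mor_def)
  have fin: "\<exists>B. finite B \<and> span B = homset module_category X Y"
    if X: "X \<in> objects module_category" and Y: "Y \<in> objects module_category" for X Y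
  proof -
    obtain x a y b where eq: "X = (x, a)" "Y = (y, b)" by (cases X, cases Y)
    have x: "is_left_module x a" and y: "is_left_module y b" using X Y eq by simp_all
    obtain B0 where B0: "finite B0" "span B0 = Hom x y"
      using Hom_finite_dim[OF moduleD(1)[OF x] moduleD(1)[OF y]] by metis
    have "homset module_category (x, a) (y, b) \<subseteq> span B0"
      unfolding B0(2) by (auto simp: module_homset)
    from finite_basis_subspace[OF B0(1) subspace_module_hom[OF x y] this]
    show ?thesis unfolding eq .
  qed
  have idh: "identity module_category X \<in> homset module_category X X" if "X \<in> objects module_category" for X
    using that m_id[OF moduleD(2)] moduleD(1)
    by (cases X) (auto simp: module_homset id_in_Hom T_id)
  have cmp: "g \<cdot> f \<in> homset module_category X Z"
    if O: "X \<in> objects module_category" "Y \<in> objects module_category" "Z \<in> objects module_category"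
      and g: "g \<in> homset module_category Y Z" and f: "f \<in> homset module_category X Y" for X Y Z f g
  proof -
    obtain x a y b z c where eq: "X = (x, a)" "Y = (y, b)" "Z = (z, c)" by (cases X, cases Y, cases Z)
    have a: "mor a (A \<otimes> x) x" and b: "mor b (A \<otimes> y) y" and c: "mor c (A \<otimes> z) z" and f': "mor f x y" and g': "mor g y z"
      using O eq f g M moduleD by (auto simp: module_homset)
    have "g \<cdot> f \<cdot> a = g \<cdot> (b \<cdot> T f)" using m_assoc[OF g' f' a] f eq by (simp add: module_homset)
    also have "\<dots> = c \<cdot> T g \<cdot> T f" using m_assoc[OF g' b mor_T[OF f']] g eq by (simp add: module_homset)
    also have "\<dots> = c \<cdot> T (g \<cdot> f)" using m_assoc[OF c mor_T[OF g'] mor_T[OF f']] T_comp[OF g' f'] by simp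
    finally show ?thesis using mor_Hom[OF mor_comp[OF g' f']] eq by (simp add: module_homset)
  qed
  show ?thesis
  proof (unfold_locales, unfold module_category_simps(2,3))
    fix X Y assume O: "X \<in> objects module_category" "Y \<in> objects module_category"
    show "subspace (homset module_category X Y)"
      using subspace_module_hom O by (cases X, cases Y) auto
    fix f assume f: "f \<in> homset module_category X Y"
    show "identity module_category Y \<cdot> f = f" "f \<cdot> identity module_category X = f"
      using f O m_id[OF M] by (cases X, cases Y; auto simp: module_homset)+
  next
    fix W X Y Z h g f
    assume O: "W \<in> objects module_category" "X \<in> objects module_category" "Y \<in> objects module_category"
        "Z \<in> objects module_category"
      and h: "h \<in> homset module_category Y Z" and g: "g \<in> homset module_category X Y"
      and f: "f \<in> homset module_category W X"
    show "h \<cdot> g \<cdot> f = h \<cdot> (g \<cdot> f)"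
      using O h g f m_assoc[OF M M M]
      by (cases W, cases X, cases Y, cases Z) (auto simp: module_homset)
  next
    fix X Y Z g g' f
    assume O: "X \<in> objects module_category" "Y \<in> objects module_category" "Z \<in> objects module_category"
      and g: "g \<in> homset module_category Y Z" "g' \<in> homset module_category Y Z"
      and f: "f \<in> homset module_category X Y"
    show "(g + g') \<cdot> f = g \<cdot> f + g' \<cdot> f"
      using O g f m_add(1)[OF M M M] by (cases X, cases Y, cases Z) (auto simp: module_homset)
  next
    fix X Y Z g f f'
    assume O: "X \<in> objects module_category" "Y \<in> objects module_category" "Z \<in> objects module_category"
      and g: "g \<in> homset module_category Y Z"
      and f: "f \<in> homset module_category X Y" "f' \<in> homset module_category X Y"
    show "g \<cdot> (f + f') = g \<cdot> f + g \<cdot> f'"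
      using O g f m_add(2)[OF M M M] by (cases X, cases Y, cases Z) (auto simp: module_homset)
  next
    fix X Y Z g f c
    assume O: "X \<in> objects module_category" "Y \<in> objects module_category" "Z \<in> objects module_category"
      and g: "g \<in> homset module_category Y Z" and f: "f \<in> homset module_category X Y"
    show "scale C c g \<cdot> f = scale C c (g \<cdot> f)" "g \<cdot> scale C c f = scale C c (g \<cdot> f)"
      using O g f m_scale[OF M M] by (cases X, cases Y, cases Z; auto simp: module_homset)+
  qed (use fin idh cmp in \<open>auto simp: scale_right_distrib scale_left_distrib\<close>)
qed

sublocale Mod: linear_category module_category
  by (rule linear_module_category)

lemma Mod_mor: "Mod.mor f (x, a) (y, b)
    \<longleftrightarrow> is_left_module x a \<and> is_left_module y b \<and> mor f x y \<and> f \<cdot> a = b \<cdot> T f"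
  using moduleD(1) by (auto simp: Mod.mor_def mor_def module_homset)

lemma free_module: "x \<in> Obj \<Longrightarrow> is_left_module (A \<otimes> x) (fmult x)"
  using monad_laws mor_fmult by (simp add: is_left_module_iff)

text \<open>The existence half of the universal property of the free module on \<open>c\<close>:
  \<open>f\<close> extends along \<open>funit c\<close> to a module map. Uniqueness is
  \<open>Mod_mor_free_eq\<close>.\<close>

lemma Mod_mor_free:
  assumes x: "is_left_module x a" and f: "mor f c x"
  shows "Mod.mor (a \<cdot> T f) (A \<otimes> c, fmult c) (x, a)" "(a \<cdot> T f) \<cdot> funit c = f"
proof -
  note X = moduleD[OF x]
  have c: "c \<in> Obj" using f by (simp add: mor_def)
  note Tf = mor_T[OF f] and TTf = mor_T[OF mor_T[OF f]] and Ta = mor_T[OF X(2)]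
  have aTf: "mor (a \<cdot> T f) (A \<otimes> c) x" using X(2) Tf by (rule mor_comp)
  have "a \<cdot> T f \<cdot> fmult c = a \<cdot> (fmult x \<cdot> T (T f))"
    using m_assoc[OF X(2) Tf mor_fmult[OF c]] fmult_natural[OF f] by simp
  also have "\<dots> = a \<cdot> (T a \<cdot> T (T f))"
    using m_ext[OF X(2) mor_fmult[OF X(1)] X(2) Ta X(3)[symmetric] TTf] .
  also have "\<dots> = a \<cdot> T (a \<cdot> T f)" using T_comp[OF X(2) Tf] by simp
  finally show "Mod.mor (a \<cdot> T f) (A \<otimes> c, fmult c) (x, a)"
    using free_module[OF c] x aTf by (simp add: Mod_mor)
  have "a \<cdot> T f \<cdot> funit c = a \<cdot> (funit x \<cdot> f)"
    using m_assoc[OF X(2) Tf mor_funit[OF c]] funit_natural[OF f] by simp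
  also have "\<dots> = f" using m_assoc[OF X(2) mor_funit[OF X(1)] f] X(4) m_id(1)[OF f] by simp
  finally show "(a \<cdot> T f) \<cdot> funit c = f" .
qed

lemma Mod_mor_free_eq:
  assumes F: "Mod.mor F (A \<otimes> c, fmult c) (x, a)" and c: "c \<in> Obj"
  shows "F = a \<cdot> T (F \<cdot> funit c)"
proof -
  have x: "is_left_module x a" and F': "mor F (A \<otimes> c) x" and FM: "F \<cdot> fmult c = a \<cdot> T F"
    using F by (auto simp: Mod_mor)
  note X = moduleD[OF x]
  have "a \<cdot> T (F \<cdot> funit c) = a \<cdot> T F \<cdot> T (funit c)"
    using T_comp[OF F' mor_funit[OF c]] m_assoc[OF X(2) mor_T[OF F'] mor_T[OF mor_funit[OF c]]] by simp
  also have "\<dots> = F \<cdot> (fmult c \<cdot> T (funit c))"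
    using FM m_assoc[OF F' mor_fmult[OF c] mor_T[OF mor_funit[OF c]]] by simp
  also have "\<dots> = F" using monad_laws(3)[OF c] m_id(2)[OF F'] by simp
  finally show ?thesis by simp
qed

text \<open>Kleisli composition of \<open>g\<close> after \<open>h\<close>. A morphism from
  \<open>d\<close> to \<open>A \<otimes> b\<close> stands for a module map from the free module on
  \<open>d\<close> to the free module on \<open>b\<close>.\<close>

definition kleisli :: "'o \<Rightarrow> 'm \<Rightarrow> 'm \<Rightarrow> 'm" where
  "kleisli c g h = fmult c \<cdot> (T g \<cdot> h)"

definition kleisli_regular :: "'o \<Rightarrow> 'o \<Rightarrow> 'm \<Rightarrow> bool" where
  "kleisli_regular c b h \<longleftrightarrow> (\<exists>g. mor g b (A \<otimes> c) \<and> kleisli b h (kleisli c g h) = h)"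

lemma mor_kleisli: "\<lbrakk>mor h d (A \<otimes> b); mor g b (A \<otimes> c); c \<in> Obj\<rbrakk> \<Longrightarrow> mor (kleisli c g h) d (A \<otimes> c)"
  unfolding kleisli_def by (rule mor_comp[OF mor_fmult mor_comp[OF mor_T]])

text \<open>Extending \<open>h\<close> to \<open>fmult b \<cdot> T h\<close> is inverse to
  precomposing with \<open>funit c\<close> and turns Kleisli composition into composition of module
  maps; hence quasi-inverses correspond.\<close>

lemma regular_free_iff:
  assumes h: "mor h c (A \<otimes> b)" and b: "b \<in> Obj"
  shows "Mod.regular (A \<otimes> c, fmult c) (A \<otimes> b, fmult b) (fmult b \<cdot> T h) \<longleftrightarrow> kleisli_regular c b h"
proof -
  have c: "c \<in> Obj" using h by (simp add: mor_def)
  note mb = mor_fmult[OF b] and mc = mor_fmult[OF c]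
  let ?H = "fmult b \<cdot> T h"
  have H: "Mod.mor ?H (A \<otimes> c, fmult c) (A \<otimes> b, fmult b)" and Hu: "?H \<cdot> funit c = h"
    using Mod_mor_free[OF free_module[OF b] h] by auto
  have H': "mor ?H (A \<otimes> c) (A \<otimes> b)" using H by (simp add: Mod_mor)
  show ?thesis
  proof
    assume "Mod.regular (A \<otimes> c, fmult c) (A \<otimes> b, fmult b) ?H"
    then obtain G where G: "Mod.mor G (A \<otimes> b, fmult b) (A \<otimes> c, fmult c)" "?H \<cdot> (G \<cdot> ?H) = ?H"
      by (auto simp: Mod.regular_def)
    have G': "mor G (A \<otimes> b) (A \<otimes> c)" using G by (simp add: Mod_mor)
    let ?g = "G \<cdot> funit b"
    have g: "mor ?g b (A \<otimes> c)" using G' mor_funit[OF b] by (rule mor_comp)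
    have Ge: "G = fmult c \<cdot> T ?g" using Mod_mor_free_eq[OF G(1) b] .
    have "kleisli c ?g h = G \<cdot> h"
      unfolding kleisli_def using m_assoc[OF mc mor_T[OF g] h] Ge by simp
    then have "kleisli b h (kleisli c ?g h) = ?H \<cdot> (G \<cdot> h)"
      unfolding kleisli_def using m_assoc[OF mb mor_T[OF h] mor_comp[OF G' h]] by simp
    also have "\<dots> = ?H \<cdot> ((G \<cdot> ?H) \<cdot> funit c)" using m_assoc[OF G' H' mor_funit[OF c]] Hu by simp
    also have "\<dots> = (?H \<cdot> (G \<cdot> ?H)) \<cdot> funit c"
      using m_assoc[OF H' mor_comp[OF G' H'] mor_funit[OF c]] by simp
    finally have "kleisli b h (kleisli c ?g h) = h" using G(2) Hu by simp
    then show "kleisli_regular c b h" using g by (auto simp: kleisli_regular_def)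
  next
    assume "kleisli_regular c b h"
    then obtain g where g: "mor g b (A \<otimes> c)" "kleisli b h (kleisli c g h) = h"
      by (auto simp: kleisli_regular_def)
    let ?G = "fmult c \<cdot> T g"
    have G: "Mod.mor ?G (A \<otimes> b, fmult b) (A \<otimes> c, fmult c)"
      using Mod_mor_free[OF free_module[OF c] g(1)] by auto
    have G': "mor ?G (A \<otimes> b) (A \<otimes> c)" using G by (simp add: Mod_mor)
    have HGH: "Mod.mor (?H \<cdot> (?G \<cdot> ?H)) (A \<otimes> c, fmult c) (A \<otimes> b, fmult b)"
      using Mod.mor_comp[OF H Mod.mor_comp[OF G H]] by simp
    have "(?H \<cdot> (?G \<cdot> ?H)) \<cdot> funit c = ?H \<cdot> (?G \<cdot> h)"
      using m_assoc[OF H' mor_comp[OF G' H'] mor_funit[OF c]] m_assoc[OF G' H' mor_funit[OF c]] Hu by simp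
    also have "?G \<cdot> h = kleisli c g h"
      unfolding kleisli_def using m_assoc[OF mc mor_T[OF g(1)] h] by simp
    also have "?H \<cdot> \<dots> = kleisli b h (kleisli c g h)"
      using m_assoc[OF mb mor_T[OF h] mor_kleisli[OF h g(1) c]] by (simp add: kleisli_def[of b])
    finally have "(?H \<cdot> (?G \<cdot> ?H)) \<cdot> funit c = h" using g(2) by simp
    then have "?H \<cdot> (?G \<cdot> ?H) = ?H" using Mod_mor_free_eq[OF HGH c] by simp
    then show "Mod.regular (A \<otimes> c, fmult c) (A \<otimes> b, fmult b) ?H"
      using H G by (auto simp: Mod.regular_def)
  qed
qed

lemma regular_free:
  assumes K: "\<And>c b h. \<lbrakk>b \<in> Obj; mor h c (A \<otimes> b)\<rbrakk> \<Longrightarrow> kleisli_regular c b h"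
    and F: "Mod.mor F (A \<otimes> c, fmult c) (A \<otimes> b, fmult b)" and O: "b \<in> Obj" "c \<in> Obj"
  shows "Mod.regular (A \<otimes> c, fmult c) (A \<otimes> b, fmult b) F"
proof -
  have h: "mor (F \<cdot> funit c) c (A \<otimes> b)"
    using F O by (auto simp: Mod_mor intro: mor_comp mor_funit)
  show ?thesis
    using regular_free_iff[OF h O(1)] K[OF O(1) h] Mod_mor_free_eq[OF F O(2)] by simp
qed

text \<open>The coequalizer \<open>A \<otimes> (A \<otimes> x) \<rightrightarrows> A \<otimes> x \<rightarrow> x\<close> presenting a module is split in the base
  category; regularity of the difference of the two parallel arrows makes it split as modules.\<close>

lemma module_retract_of_free:
  assumes K: "\<And>c b h. \<lbrakk>b \<in> Obj; mor h c (A \<otimes> b)\<rbrakk> \<Longrightarrow> kleisli_regular c b h"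
    and x: "is_left_module x a"
  obtains s where "Mod.mor s (x, a) (A \<otimes> x, fmult x)" "a \<cdot> s = idm x"
    "Mod.mor a (A \<otimes> x, fmult x) (x, a)"
proof -
  note X = moduleD[OF x]
  have Ax: "A \<otimes> x \<in> Obj" using X by simp
  note mx = mor_fmult[OF X(1)] and Ta = mor_T[OF X(2)] and ux = mor_funit[OF X(1)] and uAx = mor_funit[OF Ax]
  note fx = free_module[OF X(1)] and fAx = free_module[OF Ax]
  have a: "Mod.mor a (A \<otimes> x, fmult x) (x, a)" using fx x X by (simp add: Mod_mor)
  have mM: "Mod.mor (fmult x) (A \<otimes> (A \<otimes> x), fmult (A \<otimes> x)) (A \<otimes> x, fmult x)"
    using monad_laws(1)[OF X(1)] mx fx fAx by (simp add: Mod_mor)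
  have TaM: "Mod.mor (T a) (A \<otimes> (A \<otimes> x), fmult (A \<otimes> x)) (A \<otimes> x, fmult x)"
    using fmult_natural[OF X(2)] Ta fx fAx by (simp add: Mod_mor)
  \<comment> \<open>The difference of the two parallel arrows with coequalizer \<open>a\<close>, so
    that \<open>a\<close> is seen as a cokernel and regularity of a single map between free modules
    can be used.\<close>
  let ?h = "fmult x - T a"
  have hM: "Mod.mor ?h (A \<otimes> (A \<otimes> x), fmult (A \<otimes> x)) (A \<otimes> x, fmult x)"
    using Mod.mor_diff[OF mM TaM] .
  obtain g where gM: "Mod.mor g (A \<otimes> x, fmult x) (A \<otimes> (A \<otimes> x), fmult (A \<otimes> x))" and hgh: "?h \<cdot> (g \<cdot> ?h) = ?h"
    using regular_free[OF K hM X(1) Ax] by (auto simp: Mod.regular_def)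
  have h: "mor ?h (A \<otimes> (A \<otimes> x)) (A \<otimes> x)" and g: "mor g (A \<otimes> x) (A \<otimes> (A \<otimes> x))"
    using hM gM by (auto simp: Mod_mor)
  have hg: "mor (?h \<cdot> g) (A \<otimes> x) (A \<otimes> x)" using h g by (rule mor_comp)
  have i: "mor (idm (A \<otimes> x)) (A \<otimes> x) (A \<otimes> x)" using Ax by (rule mor_id)
  \<comment> \<open>\<open>r\<close> satisfies \<open>r \<cdot> ?h = 0\<close>, and
    \<open>a \<cdot> r = a\<close> because \<open>a \<cdot> ?h = 0\<close>. The section of
    \<open>a\<close> is the map that \<open>r\<close> induces on the cokernel \<open>x\<close>;
    since \<open>funit x\<close> splits \<open>a\<close> in the base category, this map is
    \<open>r \<cdot> funit x\<close>.\<close>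
  define r where "r = idm (A \<otimes> x) - ?h \<cdot> g"
  have r: "mor r (A \<otimes> x) (A \<otimes> x)" unfolding r_def using i hg by (rule mor_diff)
  have rM: "Mod.mor r (A \<otimes> x, fmult x) (A \<otimes> x, fmult x)"
    unfolding r_def using Mod.mor_diff[OF Mod.mor_id Mod.mor_comp[OF hM gM]] fx by simp
  have rh: "r \<cdot> ?h = 0"
    unfolding r_def using m_diff(1)[OF i hg h] m_id(1)[OF h] m_assoc[OF h g h] hgh by simp
  have ah: "a \<cdot> ?h = 0" using m_diff(2)[OF X(2) mx Ta] X(3) by simp
  define s where "s = r \<cdot> funit x"
  have s: "mor s x (A \<otimes> x)" unfolding s_def using r ux by (rule mor_comp)
  \<comment> \<open>The splitting of the coequalizer in the base category. Applying \<open>r\<close>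
    makes the left side vanish and leaves \<open>r = (r \<cdot> funit x) \<cdot> a\<close>, so that
    \<open>r\<close> factors through \<open>a\<close>.\<close>
  have "?h \<cdot> funit (A \<otimes> x) = idm (A \<otimes> x) - funit x \<cdot> a"
    using m_diff(1)[OF mx Ta uAx] monad_laws(2)[OF X(1)] funit_natural[OF X(2)] by simp
  moreover have "r \<cdot> (?h \<cdot> funit (A \<otimes> x)) = 0"
    using m_assoc[OF r h uAx] rh m_zero(1)[OF uAx Ax] by simp
  ultimately have sa: "s \<cdot> a = r"
    using m_diff(2)[OF r i mor_comp[OF ux X(2)]] m_id(2)[OF r] m_assoc[OF r ux X(2)]
    unfolding s_def by simp
  have "fmult x \<cdot> T s = fmult x \<cdot> (T r \<cdot> T (funit x))" unfolding s_def using T_comp[OF r ux] by simp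
  also have "\<dots> = r \<cdot> (fmult x \<cdot> T (funit x))"
    using m_ext[OF mx mor_T[OF r] r mx _ mor_T[OF ux]] rM by (simp add: Mod_mor)
  also have "\<dots> = s \<cdot> a" using monad_laws(3)[OF X(1)] m_id(2)[OF r] sa by simp
  finally have sM: "Mod.mor s (x, a) (A \<otimes> x, fmult x)" using x fx s by (simp add: Mod_mor)
  have "a \<cdot> (?h \<cdot> (g \<cdot> funit x)) = 0"
    using m_assoc[OF X(2) h mor_comp[OF g ux]] ah m_zero(1)[OF mor_comp[OF g ux] X(1)] by simp
  then have "a \<cdot> s = idm x"
    unfolding s_def r_def
    using m_diff(1)[OF i hg ux] m_assoc[OF h g ux] m_id(1)[OF ux]
      m_diff(2)[OF X(2) ux mor_comp[OF h mor_comp[OF g ux]]] X(4) by simp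
  then show ?thesis using that sM a by blast
qed

text \<open>Both modules are retracts of free ones, so \<open>f\<close> is a retract of the map
  \<open>t \<cdot> (f \<cdot> a)\<close> between free modules.\<close>

lemma Mod_regular:
  assumes K: "\<And>c b h. \<lbrakk>b \<in> Obj; mor h c (A \<otimes> b)\<rbrakk> \<Longrightarrow> kleisli_regular c b h"
    and f: "Mod.mor f X Y"
  shows "Mod.regular X Y f"
proof -
  obtain x a y b where eq: "X = (x, a)" "Y = (y, b)" by (cases X, cases Y)
  have x: "is_left_module x a" and y: "is_left_module y b" using f eq by (auto simp: Mod_mor)
  obtain s where s: "Mod.mor s (x, a) (A \<otimes> x, fmult x)" "a \<cdot> s = idm x" "Mod.mor a (A \<otimes> x, fmult x) (x, a)"
    using module_retract_of_free[OF K x] by blast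
  obtain t where t: "Mod.mor t (y, b) (A \<otimes> y, fmult y)" "b \<cdot> t = idm y" "Mod.mor b (A \<otimes> y, fmult y) (y, b)"
    using module_retract_of_free[OF K y] by blast
  have "Mod.mor (t \<cdot> (f \<cdot> a)) (A \<otimes> x, fmult x) (A \<otimes> y, fmult y)"
    using Mod.mor_comp[OF t(1) Mod.mor_comp[OF f[unfolded eq] s(3)]] by simp
  from regular_free[OF K this moduleD(1)[OF y] moduleD(1)[OF x]]
  show ?thesis
    using Mod.regular_retract[OF f[unfolded eq] s(3,1) _ t(1,3)] s(2) t(2) eq by simp
qed

text \<open>A splitting in the base category carries the action
  \<open>p \<cdot> (a \<cdot> T j)\<close>; because \<open>e\<close> commutes with \<open>a\<close>,
  both \<open>j\<close> and \<open>p\<close> become module maps.\<close>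

lemma Mod_idempotent_splits:
  assumes C: "semisimple_category C" and e: "Mod.mor e X X" "e \<cdot> e = e"
  shows "\<exists>Y j p. Mod.mor j Y X \<and> Mod.mor p X Y \<and> p \<cdot> j = identity module_category Y \<and> j \<cdot> p = e"
proof -
  interpret semisimple_category C by (rule C)
  obtain x a where X: "X = (x, a)" by (cases X)
  have x: "is_left_module x a" and e': "mor e x x" and ea: "e \<cdot> a = a \<cdot> T e"
    using e(1) X by (auto simp: Mod_mor)
  note M = moduleD[OF x]
  obtain k j p where j: "mor j k x" and p: "mor p x k" and pj: "p \<cdot> j = idm k" and jp: "j \<cdot> p = e"
    using idempotent_splits[OF e' e(2)] by blast
  have k: "k \<in> Obj" using j by (simp add: mor_def)
  have ej: "e \<cdot> j = j" using m_assoc[OF j p j] pj jp m_id(2)[OF j] by simp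
  have pe: "p \<cdot> e = p" using m_assoc[OF p j p] pj jp m_id(1)[OF p] by simp
  let ?b = "p \<cdot> (a \<cdot> T j)"
  note Tj = mor_T[OF j] and Tp = mor_T[OF p] and Te = mor_T[OF e'] and Ta = mor_T[OF M(2)]
  note TTj = mor_T[OF Tj]
  have aTj: "mor (a \<cdot> T j) (A \<otimes> k) x" using M(2) Tj by (rule mor_comp)
  have b: "mor ?b (A \<otimes> k) k" using p aTj by (rule mor_comp)
  have aTe: "p \<cdot> (a \<cdot> T e) = p \<cdot> a" using ea m_assoc[OF p e' M(2)] pe by simp
  have jb: "j \<cdot> ?b = a \<cdot> T j"
  proof -
    have "j \<cdot> ?b = e \<cdot> (a \<cdot> T j)" using m_assoc[OF j p aTj] jp by simp
    also have "\<dots> = a \<cdot> (T e \<cdot> T j)" using m_ext[OF e' M(2) M(2) Te ea Tj] .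
    also have "\<dots> = a \<cdot> T j" using T_comp[OF e' j] ej by simp
    finally show ?thesis .
  qed
  have bp: "?b \<cdot> T p = p \<cdot> a"
    using m_assoc[OF p aTj Tp] m_assoc[OF M(2) Tj Tp] T_comp[OF j p] jp aTe by simp
  have "?b \<cdot> T ?b = p \<cdot> (a \<cdot> (T j \<cdot> T ?b))" using m_assoc[OF p aTj mor_T[OF b]] m_assoc[OF M(2) Tj mor_T[OF b]] by simp
  also have "T j \<cdot> T ?b = T a \<cdot> T (T j)" using T_comp[OF j b] T_comp[OF M(2) Tj] jb by simp
  also have "a \<cdot> (T a \<cdot> T (T j)) = a \<cdot> (fmult x \<cdot> T (T j))"
    using m_ext[OF M(2) Ta M(2) mor_fmult[OF M(1)] M(3) TTj] .
  also have "\<dots> = (a \<cdot> T j) \<cdot> fmult k"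
    using fmult_natural[OF j] m_assoc[OF M(2) Tj mor_fmult[OF k]] by simp
  also have "p \<cdot> ((a \<cdot> T j) \<cdot> fmult k) = ?b \<cdot> fmult k" using m_assoc[OF p aTj mor_fmult[OF k]] by simp
  finally have 1: "?b \<cdot> T ?b = ?b \<cdot> fmult k" .
  have "?b \<cdot> funit k = p \<cdot> (a \<cdot> (T j \<cdot> funit k))"
    using m_assoc[OF p aTj mor_funit[OF k]] m_assoc[OF M(2) Tj mor_funit[OF k]] by simp
  also have "T j \<cdot> funit k = funit x \<cdot> j" using funit_natural[OF j] by simp
  also have "a \<cdot> (funit x \<cdot> j) = j" using m_assoc[OF M(2) mor_funit[OF M(1)] j] M(4) m_id(1)[OF j] by simp
  finally have "?b \<cdot> funit k = idm k" using pj by simp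
  then have kM: "is_left_module k ?b" using b 1 by (simp add: is_left_module_iff)
  have "Mod.mor j (k, ?b) X" "Mod.mor p X (k, ?b)"
    using kM x j p jb bp X by (simp_all add: Mod_mor)
  then show ?thesis using pj jp by (intro exI[of _ "(k, ?b)"] exI[of _ j] exI[of _ p]) simp
qed

lemma Mod_direct_sums:
  assumes C: "semisimple_category C" and X: "\<And>l. l < n \<Longrightarrow> X l \<in> objects module_category"
  shows "\<exists>S incl proj. Mod.is_direct_sum n X S incl proj"
proof -
  interpret semisimple_category C by (rule C)
  define xs as where "xs l = fst (X l)" and "as l = snd (X l)" for l
  have Xl: "X l = (xs l, as l)" for l by (simp add: xs_def as_def)
  have M: "is_left_module (xs l) (as l)" if "l < n" for l using X[OF that] Xl[of l] by simp
  note xO = moduleD(1)[OF M] and a = moduleD(2)[OF M]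
  obtain s i p where D: "is_direct_sum n xs s i p" using direct_sums[of n xs] xO by blast
  then have s: "s \<in> Obj" and sum: "(\<Sum>l<n. i l \<cdot> p l) = idm s" by (auto simp: is_direct_sum_def)
  have i: "mor (i l) (xs l) s" and p: "mor (p l) s (xs l)" if "l < n" for l
    using D that s xO by (auto simp: is_direct_sum_def mor_def)
  have pi: "p l \<cdot> i l' = (if l = l' then idm (xs l) else 0)" if "l < n" "l' < n" for l l'
    using D that by (auto simp: is_direct_sum_def)
  have As: "A \<otimes> s \<in> Obj" using s by simp
  note Ti = mor_T[OF i] and Tp = mor_T[OF p]
  have aTp: "mor (as l \<cdot> T (p l)) (A \<otimes> s) (xs l)" if "l < n" for l using a[OF that] Tp[OF that] by (rule mor_comp)
  have iap: "mor (i l \<cdot> (as l \<cdot> T (p l))) (A \<otimes> s) s" if "l < n" for l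
    using i[OF that] aTp[OF that] by (rule mor_comp)
  \<comment> \<open>The action that is forced once every projection is to be a module map.\<close>
  define b where "b = (\<Sum>l<n. i l \<cdot> (as l \<cdot> T (p l)))"
  have b: "mor b (A \<otimes> s) s" unfolding b_def using iap by (intro mor_sum As s) auto
  \<comment> \<open>The projections are jointly monic, so the module laws for \<open>b\<close> and
    the linearity of the inclusions are checked one component at a time, where the laws of the
    summands apply.\<close>
  have joint: "f = g" if fg: "mor f w s" "mor g w s" "\<And>l. l < n \<Longrightarrow> p l \<cdot> f = p l \<cdot> g" for f g w
  proof -
    have *: "f = (\<Sum>l<n. i l \<cdot> (p l \<cdot> f))" if f: "mor f w s" for f
    proof -
      have "f = (\<Sum>l<n. i l \<cdot> p l) \<cdot> f" using sum m_id(1)[OF f] by simp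
      also have "\<dots> = (\<Sum>l<n. i l \<cdot> p l \<cdot> f)" by (rule m_sum[OF s s f]) (use mor_comp[OF i p] in auto)
      also have "\<dots> = (\<Sum>l<n. i l \<cdot> (p l \<cdot> f))" using m_assoc[OF i p f] by simp
      finally show ?thesis .
    qed
    have "(\<Sum>l<n. i l \<cdot> (p l \<cdot> f)) = (\<Sum>l<n. i l \<cdot> (p l \<cdot> g))"
      using fg(3) by (intro sum.cong) auto
    then show ?thesis using *[OF fg(1)] *[OF fg(2)] by simp
  qed
  have pb: "p l \<cdot> b = as l \<cdot> T (p l)" if l: "l < n" for l
  proof -
    have "p l \<cdot> b = (\<Sum>l'<n. p l \<cdot> (i l' \<cdot> (as l' \<cdot> T (p l'))))"
      unfolding b_def by (rule m_sum'[OF As s p[OF l]]) (use iap in auto)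
    also have "\<dots> = (\<Sum>l'<n. if l' = l then as l \<cdot> T (p l) else 0)"
    proof (rule sum.cong)
      fix l' assume "l' \<in> {..<n}"
      then have l': "l' < n" by simp
      have "p l \<cdot> (i l' \<cdot> (as l' \<cdot> T (p l'))) = (p l \<cdot> i l') \<cdot> (as l' \<cdot> T (p l'))"
        using m_assoc[OF p[OF l] i[OF l'] aTp[OF l']] by simp
      then show "p l \<cdot> (i l' \<cdot> (as l' \<cdot> T (p l'))) = (if l' = l then as l \<cdot> T (p l) else 0)"
        using pi[OF l l'] m_id(1)[OF aTp[OF l']] m_zero(1)[OF aTp[OF l'] xO[OF l]] by auto
    qed simp
    also have "\<dots> = as l \<cdot> T (p l)" using l by simp
    finally show ?thesis .
  qed
  have "b \<cdot> T b = b \<cdot> fmult s"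
  proof (rule joint)
    show "mor (b \<cdot> T b) (A \<otimes> (A \<otimes> s)) s" using b mor_T[OF b] by (rule mor_comp)
    show "mor (b \<cdot> fmult s) (A \<otimes> (A \<otimes> s)) s" using b mor_fmult[OF s] by (rule mor_comp)
    fix l assume l: "l < n"
    note al = a[OF l] and pl = p[OF l] and Tpl = Tp[OF l]
    have "p l \<cdot> (b \<cdot> T b) = (as l \<cdot> T (p l)) \<cdot> T b" using m_assoc[OF pl b mor_T[OF b]] pb[OF l] by simp
    also have "\<dots> = as l \<cdot> (T (as l) \<cdot> T (T (p l)))"
      using m_assoc[OF al Tpl mor_T[OF b]] T_comp[OF pl b] T_comp[OF al Tpl] pb[OF l] by simp
    also have "\<dots> = as l \<cdot> (fmult (xs l) \<cdot> T (T (p l)))"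
      using m_ext[OF al mor_T[OF al] al mor_fmult[OF xO[OF l]] moduleD(3)[OF M[OF l]] mor_T[OF Tpl]] .
    also have "\<dots> = (as l \<cdot> T (p l)) \<cdot> fmult s"
      using fmult_natural[OF pl] m_assoc[OF al Tpl mor_fmult[OF s]] by simp
    also have "\<dots> = p l \<cdot> (b \<cdot> fmult s)" using m_assoc[OF pl b mor_fmult[OF s]] pb[OF l] by simp
    finally show "p l \<cdot> (b \<cdot> T b) = p l \<cdot> (b \<cdot> fmult s)" .
  qed
  moreover have "b \<cdot> funit s = idm s"
  proof (rule joint)
    show "mor (b \<cdot> funit s) s s" using b mor_funit[OF s] by (rule mor_comp)
    show "mor (idm s) s s" using s by (rule mor_id)
    fix l assume l: "l < n"
    note al = a[OF l] and pl = p[OF l] and Tpl = Tp[OF l] and u = mor_funit[OF xO[OF l]]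
    have "p l \<cdot> (b \<cdot> funit s) = as l \<cdot> (T (p l) \<cdot> funit s)"
      using m_assoc[OF pl b mor_funit[OF s]] pb[OF l] m_assoc[OF al Tpl mor_funit[OF s]] by simp
    also have "\<dots> = p l"
      using funit_natural[OF pl] m_assoc[OF al u pl] moduleD(4)[OF M[OF l]] m_id(1)[OF pl] by simp
    finally show "p l \<cdot> (b \<cdot> funit s) = p l \<cdot> idm s" using m_id(2)[OF pl] by simp
  qed
  ultimately have sM: "is_left_module s b" using b by (simp add: is_left_module_iff)
  have bi: "i l \<cdot> as l = b \<cdot> T (i l)" if l: "l < n" for l
  proof (rule joint)
    show "mor (i l \<cdot> as l) (A \<otimes> xs l) s" using i[OF l] a[OF l] by (rule mor_comp)
    show "mor (b \<cdot> T (i l)) (A \<otimes> xs l) s" using b Ti[OF l] by (rule mor_comp)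
    fix l' assume l': "l' < n"
    have "p l' \<cdot> (b \<cdot> T (i l)) = as l' \<cdot> (T (p l') \<cdot> T (i l))"
      using m_assoc[OF p[OF l'] b Ti[OF l]] m_assoc[OF a[OF l'] Tp[OF l'] Ti[OF l]] pb[OF l'] by simp
    also have "T (p l') \<cdot> T (i l) = T (p l' \<cdot> i l)" using T_comp[OF p[OF l'] i[OF l]] by simp
    also have "as l' \<cdot> \<dots> = (p l' \<cdot> i l) \<cdot> as l"
      using pi[OF l' l] T_id[OF xO[OF l]] m_id[OF a[OF l]] m_zero(1)[OF a[OF l] xO[OF l']]
        m_zero(2)[OF a[OF l'], of "A \<otimes> xs l"] m_tens_zero_right[OF mor_id[OF A_Obj] xO[OF l] xO[OF l']] xO[OF l]
      by auto
    also have "\<dots> = p l' \<cdot> (i l \<cdot> as l)" using m_assoc[OF p[OF l'] i[OF l] a[OF l]] .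
    finally show "p l' \<cdot> (i l \<cdot> as l) = p l' \<cdot> (b \<cdot> T (i l))" by simp
  qed
  have "Mod.is_direct_sum n X (s, b) i p"
    unfolding Mod.is_direct_sum_def
    using sM sum i p pb bi pi mor_Hom by (auto simp: Xl module_homset)
  then show ?thesis by blast
qed

theorem semisimple_if_kleisli_regular:
  assumes "semisimple_category C"
    and "\<And>c b h. \<lbrakk>b \<in> Obj; mor h c (A \<otimes> b)\<rbrakk> \<Longrightarrow> kleisli_regular c b h"
  shows "semisimple_category module_category"
  by (rule Mod.semisimple_category_if_regular)
    (use Mod_direct_sums[OF assms(1)] Mod_idempotent_splits[OF assms(1)] Mod_regular[OF assms(2)] in \<open>simp_all\<close>)

theorem kleisli_regular_if_semisimple:
  assumes ss: "semisimple_category module_category" and b: "b \<in> Obj" and h: "mor h c (A \<otimes> b)"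
  shows "kleisli_regular c b h"
proof -
  interpret S: semisimple_category module_category by (rule ss)
  show ?thesis
    using S.regular[OF Mod_mor_free(1)[OF free_module[OF b] h]] regular_free_iff[OF h b] by simp
qed

end

section \<open>Duals\<close>

context tensor_category
begin

lemma scomp_eq_cancel:
  assumes "f \<circ>\<^sub>s u = g \<circ>\<^sub>s u" "u \<circ>\<^sub>s v = sid (sdom f)" "sarr f" "sarr g" "sarr u" "sarr v"
    "sdom g = sdom f" "scod u = sdom f" "scod v = sdom u"
  shows "f = g"
proof -
  have "f = (f \<circ>\<^sub>s u) \<circ>\<^sub>s v"
    using sassoc[of v u f] assms(2-) by simp
  also have "\<dots> = (g \<circ>\<^sub>s u) \<circ>\<^sub>s v" unfolding assms(1) ..
  also have "\<dots> = g"
    using sassoc[of v u g] assms(2-) by simp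
  finally show ?thesis .
qed

lemma scomp_cancel_iff:
  assumes "u \<circ>\<^sub>s v = sid (sdom f)" "sarr f" "sarr g" "sarr u" "sarr v"
    "sdom g = sdom f" "scod u = sdom f" "scod v = sdom u"
  shows "f \<circ>\<^sub>s u = g \<circ>\<^sub>s u \<longleftrightarrow> f = g"
  using scomp_eq_cancel[OF _ assms] by blast

text \<open>Evaluation and coevaluation as arrows \<open>[b, a] \<rightarrow> []\<close> and
  \<open>[] \<rightarrow> [a, b]\<close>, for which the zig-zag equations need no coherence maps.
  \<open>evhat\<close> is later applied to arbitrary pairings as well.\<close>

definition evhat where "evhat a b e = unpunit \<circ>\<^sub>s emb (b \<otimes> a, e, \<one>) \<circ>\<^sub>s join b a"
definition coevhat where "coevhat a b c = unjoin a b \<circ>\<^sub>s emb (\<one>, c, a \<otimes> b) \<circ>\<^sub>s punit"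

lemma evhat_simps [simp]:
  "sdom (evhat a b e) = [b, a]" "scod (evhat a b e) = []" "sdom (coevhat a b c) = []" "scod (coevhat a b c) = [a, b]"
  "\<lbrakk>a \<in> Obj; b \<in> Obj; mor e (b \<otimes> a) \<one>\<rbrakk> \<Longrightarrow> sarr (evhat a b e)"
  "\<lbrakk>a \<in> Obj; b \<in> Obj; mor c \<one> (a \<otimes> b)\<rbrakk> \<Longrightarrow> sarr (coevhat a b c)"
  by (simp_all add: evhat_def coevhat_def)

lemma emb_ev:
  "\<lbrakk>a \<in> Obj; b \<in> Obj; mor e (b \<otimes> a) \<one>\<rbrakk> \<Longrightarrow> emb (b \<otimes> a, e, \<one>) = punit \<circ>\<^sub>s evhat a b e \<circ>\<^sub>s unjoin b a"
  "\<lbrakk>a \<in> Obj; b \<in> Obj; mor c \<one> (a \<otimes> b)\<rbrakk> \<Longrightarrow> emb (\<one>, c, a \<otimes> b) = join a b \<circ>\<^sub>s coevhat a b c \<circ>\<^sub>s unpunit"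
  by (simp_all add: evhat_def coevhat_def)

text \<open>The embedding is faithful, and each strict zig-zag differs from the image of the given
  composite only by the image of a unitor at the source, which is invertible and cancels.\<close>

lemma is_dual_iff:
  "is_dual a b e c \<longleftrightarrow> a \<in> Obj \<and> b \<in> Obj \<and> mor e (b \<otimes> a) \<one> \<and> mor c \<one> (a \<otimes> b) \<and>
    wh [a] (evhat a b e) [] \<circ>\<^sub>s wh [] (coevhat a b c) [a] = sid [a] \<and>
    wh [] (evhat a b e) [b] \<circ>\<^sub>s wh [b] (coevhat a b c) [] = sid [b]"
proof (cases "a \<in> Obj \<and> b \<in> Obj \<and> mor e (b \<otimes> a) \<one> \<and> mor c \<one> (a \<otimes> b)")
  case True
  then have O [simp]: "a \<in> Obj" "b \<in> Obj" and M [simp]: "mor e (b \<otimes> a) \<one>" "mor c \<one> (a \<otimes> b)" by auto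
  let ?e = "(b \<otimes> a, e, \<one>)" and ?c = "(\<one>, c, a \<otimes> b)"
  let ?L = "((brunit a \<circ>\<^sub>b (bid a \<otimes>\<^sub>b ?e)) \<circ>\<^sub>b bassoc a b a) \<circ>\<^sub>b (?c \<otimes>\<^sub>b bid a)"
  let ?R = "((blunit b \<circ>\<^sub>b (?e \<otimes>\<^sub>b bid b)) \<circ>\<^sub>b bassoc' b a b) \<circ>\<^sub>b (bid b \<otimes>\<^sub>b ?c)"
  have L: "emb ?L = (wh [a] (evhat a b e) [] \<circ>\<^sub>s wh [] (coevhat a b c) [a]) \<circ>\<^sub>s emb (blunit a)"
    and R: "emb ?R = (wh [] (evhat a b e) [b] \<circ>\<^sub>s wh [b] (coevhat a b c) []) \<circ>\<^sub>s emb (brunit b)"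
    by (simp_all add: emb_ev)
  have "\<r> a \<cdot> (idm a \<odot> e) \<cdot> \<a> a b a \<cdot> (c \<odot> idm a) = \<l> a \<longleftrightarrow> ?L = blunit a"
    by (simp add: bdefs)
  also have "\<dots> \<longleftrightarrow> emb ?L = emb (blunit a)"
    by (rule iffI, erule arg_cong, erule emb_inject[rotated 4]) simp_all
  also have "\<dots> \<longleftrightarrow> (wh [a] (evhat a b e) [] \<circ>\<^sub>s wh [] (coevhat a b c) [a]) \<circ>\<^sub>s emb (blunit a) = sid [a] \<circ>\<^sub>s emb (blunit a)"
    unfolding L by simp
  also have "\<dots> \<longleftrightarrow> wh [a] (evhat a b e) [] \<circ>\<^sub>s wh [] (coevhat a b c) [a] = sid [a]"
    by (rule scomp_cancel_iff[of _ "join \<one> a \<circ>\<^sub>s wh [] punit [a]"]) simp_all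
  finally have 1: "\<r> a \<cdot> (idm a \<odot> e) \<cdot> \<a> a b a \<cdot> (c \<odot> idm a) = \<l> a
    \<longleftrightarrow> wh [a] (evhat a b e) [] \<circ>\<^sub>s wh [] (coevhat a b c) [a] = sid [a]" .
  have "\<l> b \<cdot> (e \<odot> idm b) \<cdot> assoc_inv b a b \<cdot> (idm b \<odot> c) = \<r> b \<longleftrightarrow> ?R = brunit b"
    by (simp add: bdefs)
  also have "\<dots> \<longleftrightarrow> emb ?R = emb (brunit b)"
    by (rule iffI, erule arg_cong, erule emb_inject[rotated 4]) simp_all
  also have "\<dots> \<longleftrightarrow> (wh [] (evhat a b e) [b] \<circ>\<^sub>s wh [b] (coevhat a b c) []) \<circ>\<^sub>s emb (brunit b) = sid [b] \<circ>\<^sub>s emb (brunit b)"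
    unfolding R by simp
  also have "\<dots> \<longleftrightarrow> wh [] (evhat a b e) [b] \<circ>\<^sub>s wh [b] (coevhat a b c) [] = sid [b]"
    by (rule scomp_cancel_iff[of _ "join b \<one> \<circ>\<^sub>s wh [b] punit []"]) simp_all
  finally show ?thesis using 1 M[unfolded mor_def] by (auto simp: is_dual_def mor_def)
qed (auto simp: is_dual_def mor_def)

text \<open>In each zig-zag, interchange brings one of the two inverse pairs together, where it
  cancels; what is left is the original zig-zag conjugated by the other pair.\<close>

lemma is_dual_transport:
  assumes "is_dual a b e c" and f: "mor f a' a" "mor f' a a'" "f' \<cdot> f = idm a'" "f \<cdot> f' = idm a"
    and g: "mor g b' b" "mor g' b b'" "g' \<cdot> g = idm b'" "g \<cdot> g' = idm b"
  shows "is_dual a' b' (e \<cdot> (g \<odot> f)) ((f' \<odot> g') \<cdot> c)"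
proof -
  have O [simp]: "a \<in> Obj" "b \<in> Obj" "a' \<in> Obj" "b' \<in> Obj" and M [simp]: "mor e (b \<otimes> a) \<one>" "mor c \<one> (a \<otimes> b)"
    and z: "wh [a] (evhat a b e) [] \<circ>\<^sub>s wh [] (coevhat a b c) [a] = sid [a]"
      "wh [] (evhat a b e) [b] \<circ>\<^sub>s wh [b] (coevhat a b c) [] = sid [b]"
    using assms by (auto simp: is_dual_iff mor_def)
  let ?f = "emb (a', f, a)" and ?f' = "emb (a, f', a')" and ?g = "emb (b', g, b)" and ?g' = "emb (b, g', b')"
  let ?e = "evhat a b e" and ?c = "coevhat a b c"
  have [simp]: "barr (a', f, a)" "barr (a, f', a')" "barr (b', g, b)" "barr (b, g', b')" using f g by simp_all
  have M': "mor (e \<cdot> (g \<odot> f)) (b' \<otimes> a') \<one>" "mor ((f' \<odot> g') \<cdot> c) \<one> (a' \<otimes> b')"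
    using mor_comp[OF M(1) mor_tens[OF g(1) f(1)]] mor_comp[OF mor_tens[OF f(2) g(2)] M(2)] .
  have "(b' \<otimes> a', e \<cdot> (g \<odot> f), \<one>) = (b \<otimes> a, e, \<one>) \<circ>\<^sub>b ((b', g, b) \<otimes>\<^sub>b (a', f, a))"
    "(\<one>, (f' \<odot> g') \<cdot> c, a' \<otimes> b') = ((a, f', a') \<otimes>\<^sub>b (b, g', b')) \<circ>\<^sub>b (\<one>, c, a \<otimes> b)"
    by (simp_all add: bdefs)
  then have ev: "evhat a' b' (e \<cdot> (g \<odot> f)) = ?e \<circ>\<^sub>s wh [] ?g [a] \<circ>\<^sub>s wh [b'] ?f []"
    and coev: "coevhat a' b' ((f' \<odot> g') \<cdot> c) = wh [] ?f' [b'] \<circ>\<^sub>s wh [a] ?g' [] \<circ>\<^sub>s ?c"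
    unfolding evhat_def[of a' b'] coevhat_def[of a' b'] by (simp_all add: emb_ev)
  have ff: "?f' \<circ>\<^sub>s ?f = sid [a']" "?f \<circ>\<^sub>s ?f' = sid [a]" "?g' \<circ>\<^sub>s ?g = sid [b']" "?g \<circ>\<^sub>s ?g' = sid [b]"
  proof -
    have "(a, f', a') \<circ>\<^sub>b (a', f, a) = bid a'" "(a', f, a) \<circ>\<^sub>b (a, f', a') = bid a"
      "(b, g', b') \<circ>\<^sub>b (b', g, b) = bid b'" "(b', g, b) \<circ>\<^sub>b (b, g', b') = bid b"
      using f g by (simp_all add: bdefs)
    from this[THEN arg_cong[of _ _ emb]]
    show "?f' \<circ>\<^sub>s ?f = sid [a']" "?f \<circ>\<^sub>s ?f' = sid [a]" "?g' \<circ>\<^sub>s ?g = sid [b']" "?g \<circ>\<^sub>s ?g' = sid [b]"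
      by simp_all
  qed
  note gg = cancel_wh[OF _ _ _ ff(4), simplified]
  note ff2 = cancel_wh[OF _ _ _ ff(2), simplified]
  have "wh [a'] (evhat a' b' (e \<cdot> (g \<odot> f))) [] \<circ>\<^sub>s wh [] (coevhat a' b' ((f' \<odot> g') \<cdot> c)) [a']
     = wh [a'] ?e [] \<circ>\<^sub>s wh [a'] ?g [a] \<circ>\<^sub>s (wh [a', b'] ?f [] \<circ>\<^sub>s wh [] ?f' [b', a'])
       \<circ>\<^sub>s wh [a] ?g' [a'] \<circ>\<^sub>s wh [] ?c [a']"
    by (simp add: ev coev)
  also have "wh [a', b'] ?f [] \<circ>\<^sub>s wh [] ?f' [b', a'] = wh [] ?f' [b', a] \<circ>\<^sub>s wh [a, b'] ?f []"
    using interchange[of ?f' ?f "[]" "[b']" "[]"] by simp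
  also have "wh [a'] ?e [] \<circ>\<^sub>s wh [a'] ?g [a] \<circ>\<^sub>s (wh [] ?f' [b', a] \<circ>\<^sub>s wh [a, b'] ?f []) \<circ>\<^sub>s wh [a] ?g' [a'] \<circ>\<^sub>s wh [] ?c [a']
    = wh [a'] ?e [] \<circ>\<^sub>s (wh [a'] ?g [a] \<circ>\<^sub>s wh [] ?f' [b', a]) \<circ>\<^sub>s (wh [a, b'] ?f [] \<circ>\<^sub>s wh [a] ?g' [a']) \<circ>\<^sub>s wh [] ?c [a']"
    by simp
  also have "wh [a'] ?g [a] \<circ>\<^sub>s wh [] ?f' [b', a] = wh [] ?f' [b, a] \<circ>\<^sub>s wh [a] ?g [a]"
    using interchange[of ?f' ?g "[]" "[]" "[a]"] by simp
  also have "wh [a, b'] ?f [] \<circ>\<^sub>s wh [a] ?g' [a'] = wh [a] ?g' [a] \<circ>\<^sub>s wh [a, b] ?f []"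
    using interchange[of ?g' ?f "[a]" "[]" "[]"] by simp
  also have "wh [a'] ?e [] \<circ>\<^sub>s (wh [] ?f' [b, a] \<circ>\<^sub>s wh [a] ?g [a]) \<circ>\<^sub>s (wh [a] ?g' [a] \<circ>\<^sub>s wh [a, b] ?f []) \<circ>\<^sub>s wh [] ?c [a']
    = (wh [a'] ?e [] \<circ>\<^sub>s wh [] ?f' [b, a]) \<circ>\<^sub>s (wh [a, b] ?f [] \<circ>\<^sub>s wh [] ?c [a'])"
    by (simp add: gg)
  also have "wh [a, b] ?f [] \<circ>\<^sub>s wh [] ?c [a'] = wh [] ?c [a] \<circ>\<^sub>s ?f"
    using interchange[of ?c ?f "[]" "[]" "[]"] by simp
  also have "wh [a'] ?e [] \<circ>\<^sub>s wh [] ?f' [b, a] = ?f' \<circ>\<^sub>s wh [a] ?e []"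
    using interchange[of ?f' ?e "[]" "[]" "[]"] by simp
  also have "(?f' \<circ>\<^sub>s wh [a] ?e []) \<circ>\<^sub>s wh [] ?c [a] \<circ>\<^sub>s ?f = ?f' \<circ>\<^sub>s (wh [a] ?e [] \<circ>\<^sub>s wh [] ?c [a]) \<circ>\<^sub>s ?f"
    by simp
  also have "\<dots> = sid [a']" by (simp add: z ff)
  finally have 1: "wh [a'] (evhat a' b' (e \<cdot> (g \<odot> f))) [] \<circ>\<^sub>s wh [] (coevhat a' b' ((f' \<odot> g') \<cdot> c)) [a'] = sid [a']" .
  have "wh [] (evhat a' b' (e \<cdot> (g \<odot> f))) [b'] \<circ>\<^sub>s wh [b'] (coevhat a' b' ((f' \<odot> g') \<cdot> c)) []
     = wh [] ?e [b'] \<circ>\<^sub>s wh [] ?g [a, b'] \<circ>\<^sub>s (wh [b'] ?f [b'] \<circ>\<^sub>s wh [b'] ?f' [b'])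
       \<circ>\<^sub>s wh [b', a] ?g' [] \<circ>\<^sub>s wh [b'] ?c []"
    by (simp add: ev coev)
  also have "\<dots> = wh [] ?e [b'] \<circ>\<^sub>s (wh [] ?g [a, b'] \<circ>\<^sub>s wh [b', a] ?g' []) \<circ>\<^sub>s wh [b'] ?c []"
    by (simp add: ff2)
  also have "wh [] ?g [a, b'] \<circ>\<^sub>s wh [b', a] ?g' [] = wh [b, a] ?g' [] \<circ>\<^sub>s wh [] ?g [a, b]"
    using interchange[of ?g ?g' "[]" "[a]" "[]"] by simp
  also have "wh [] ?e [b'] \<circ>\<^sub>s (wh [b, a] ?g' [] \<circ>\<^sub>s wh [] ?g [a, b]) \<circ>\<^sub>s wh [b'] ?c []
    = (wh [] ?e [b'] \<circ>\<^sub>s wh [b, a] ?g' []) \<circ>\<^sub>s (wh [] ?g [a, b] \<circ>\<^sub>s wh [b'] ?c [])"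
    by simp
  also have "wh [] ?g [a, b] \<circ>\<^sub>s wh [b'] ?c [] = wh [b] ?c [] \<circ>\<^sub>s ?g"
    using interchange[of ?g ?c "[]" "[]" "[]"] by simp
  also have "wh [] ?e [b'] \<circ>\<^sub>s wh [b, a] ?g' [] = ?g' \<circ>\<^sub>s wh [] ?e [b]"
    using interchange[of ?e ?g' "[]" "[]" "[]"] by simp
  also have "(?g' \<circ>\<^sub>s wh [] ?e [b]) \<circ>\<^sub>s wh [b] ?c [] \<circ>\<^sub>s ?g = ?g' \<circ>\<^sub>s (wh [] ?e [b] \<circ>\<^sub>s wh [b] ?c []) \<circ>\<^sub>s ?g"
    by simp
  also have "\<dots> = sid [b']" by (simp add: z ff)
  finally show ?thesis using 1 M' by (simp add: is_dual_iff)
qed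

text \<open>When \<open>c\<close> is dual to \<open>z\<close>, tensoring with \<open>z\<close> on
  the right is left adjoint to tensoring with \<open>c\<close> on the right. \<open>sharp\<close>
  bends \<open>c\<close> down, from \<open>Hom d (x \<otimes> c)\<close> to
  \<open>Hom (d \<otimes> z) x\<close>, and \<open>flat\<close> bends it back up.\<close>

definition sharp :: "'o \<Rightarrow> 'o \<Rightarrow> 'm \<Rightarrow> 'o \<Rightarrow> 'm \<Rightarrow> 'm" where
  "sharp z c e x f = \<r> x \<cdot> ((idm x \<odot> e) \<cdot> (\<a> x c z \<cdot> (f \<odot> idm z)))"

definition flat :: "'o \<Rightarrow> 'o \<Rightarrow> 'm \<Rightarrow> 'o \<Rightarrow> 'm \<Rightarrow> 'm" where
  "flat z c k d f = (f \<odot> idm c) \<cdot> (assoc_inv d z c \<cdot> ((idm d \<odot> k) \<cdot> rinv d))"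

lemma bsharp: "(d \<otimes> z, sharp z c e x f, x)
    = brunit x \<circ>\<^sub>b (bid x \<otimes>\<^sub>b (c \<otimes> z, e, \<one>)) \<circ>\<^sub>b bassoc x c z \<circ>\<^sub>b ((d, f, x \<otimes> c) \<otimes>\<^sub>b bid z)"
  by (simp add: bdefs sharp_def)

lemma bflat: "(d, flat z c k d f, x \<otimes> c)
    = ((d \<otimes> z, f, x) \<otimes>\<^sub>b bid c) \<circ>\<^sub>b bassoc' d z c \<circ>\<^sub>b (bid d \<otimes>\<^sub>b (\<one>, k, z \<otimes> c)) \<circ>\<^sub>b brunit' d"
  by (simp add: bdefs flat_def)

text \<open>Interchange slides the given morphism out of the way, and one zig-zag remains in each
  round trip: that of \<open>c\<close> for \<open>flat\<close> after \<open>sharp\<close>, that of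
  \<open>z\<close> for \<open>sharp\<close> after \<open>flat\<close>.\<close>

lemma sharp_flat:
  assumes "is_dual z c e k" and x [simp]: "x \<in> Obj"
  shows "mor f d (x \<otimes> c) \<Longrightarrow> mor (sharp z c e x f) (d \<otimes> z) x"
    "\<lbrakk>mor g (d \<otimes> z) x; d \<in> Obj\<rbrakk> \<Longrightarrow> mor (flat z c k d g) d (x \<otimes> c)"
    "mor f d (x \<otimes> c) \<Longrightarrow> flat z c k d (sharp z c e x f) = f"
    "\<lbrakk>mor g (d \<otimes> z) x; d \<in> Obj\<rbrakk> \<Longrightarrow> sharp z c e x (flat z c k d g) = g"
proof -
  have O [simp]: "z \<in> Obj" "c \<in> Obj" and M [simp]: "mor e (c \<otimes> z) \<one>" "mor k \<one> (z \<otimes> c)"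
    and Z: "wh [z] (evhat z c e) [] \<circ>\<^sub>s wh [] (coevhat z c k) [z] = sid [z]"
      "wh [] (evhat z c e) [c] \<circ>\<^sub>s wh [c] (coevhat z c k) [] = sid [c]"
    using assms(1) by (auto simp: is_dual_iff)
  let ?e = "evhat z c e" and ?k = "coevhat z c k"
  show s: "mor (sharp z c e x f) (d \<otimes> z) x" if "mor f d (x \<otimes> c)" for f d
  proof -
    have [simp]: "d \<in> Obj" using that by (simp add: mor_def)
    have "barr (d \<otimes> z, sharp z c e x f, x)" unfolding bsharp using that by simp
    then show ?thesis by (simp add: barr_def)
  qed
  show t: "mor (flat z c k d g) d (x \<otimes> c)" if "mor g (d \<otimes> z) x" "d \<in> Obj" for g d
  proof -
    have "barr (d, flat z c k d g, x \<otimes> c)" unfolding bflat using that by simp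
    then show ?thesis by (simp add: barr_def)
  qed
  have es: "emb (d \<otimes> z, sharp z c e x f, x)
      = wh [x] ?e [] \<circ>\<^sub>s wh [] (unjoin x c) [z] \<circ>\<^sub>s wh [] (emb (d, f, x \<otimes> c)) [z] \<circ>\<^sub>s unjoin d z"
    if "mor f d (x \<otimes> c)" for f d
  proof -
    have [simp]: "d \<in> Obj" using that by (simp add: mor_def)
    show ?thesis unfolding bsharp using that by (simp add: emb_ev)
  qed
  have et: "emb (d, flat z c k d g, x \<otimes> c)
      = join x c \<circ>\<^sub>s wh [] (emb (d \<otimes> z, g, x)) [c] \<circ>\<^sub>s wh [] (join d z) [c] \<circ>\<^sub>s wh [d] ?k []"
    if "mor g (d \<otimes> z) x" "d \<in> Obj" for g d
    unfolding bflat using that by (simp add: emb_ev)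
  show "flat z c k d (sharp z c e x f) = f" if f: "mor f d (x \<otimes> c)" for f d
  proof -
    have d [simp]: "d \<in> Obj" using f by (simp add: mor_def)
    let ?f = "unjoin x c \<circ>\<^sub>s emb (d, f, x \<otimes> c)"
    have f' [simp]: "sarr ?f" using f by simp
    have "emb (d, flat z c k d (sharp z c e x f), x \<otimes> c)
        = join x c \<circ>\<^sub>s wh [x] ?e [c] \<circ>\<^sub>s (wh [] ?f [z, c] \<circ>\<^sub>s wh [d] ?k [])"
      using f by (simp add: et[OF s[OF f] d] es[OF f])
    also have "wh [] ?f [z, c] \<circ>\<^sub>s wh [d] ?k [] = wh [x, c] ?k [] \<circ>\<^sub>s ?f"
      using interchange[of ?f ?k "[]" "[]" "[]"] f by simp
    also have "join x c \<circ>\<^sub>s wh [x] ?e [c] \<circ>\<^sub>s wh [x, c] ?k [] \<circ>\<^sub>s ?f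
        = join x c \<circ>\<^sub>s wh [x] (wh [] ?e [c] \<circ>\<^sub>s wh [c] ?k []) [] \<circ>\<^sub>s ?f"
      using f by simp
    also have "\<dots> = emb (d, f, x \<otimes> c)" unfolding Z using f by simp
    finally have "(d, flat z c k d (sharp z c e x f), x \<otimes> c) = (d, f, x \<otimes> c)"
      using t[OF s[OF f] d] f by (intro emb_inject) simp_all
    then show ?thesis by simp
  qed
  show "sharp z c e x (flat z c k d g) = g" if g: "mor g (d \<otimes> z) x" and d [simp]: "d \<in> Obj" for g d
  proof -
    let ?g = "emb (d \<otimes> z, g, x) \<circ>\<^sub>s join d z"
    have g' [simp]: "sarr ?g" using g by simp
    have "emb (d \<otimes> z, sharp z c e x (flat z c k d g), x)
        = (wh [x] ?e [] \<circ>\<^sub>s wh [] ?g [c, z]) \<circ>\<^sub>s wh [d] ?k [z] \<circ>\<^sub>s unjoin d z"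
      using g by (simp add: es[OF t[OF g d]] et[OF g d])
    also have "wh [x] ?e [] \<circ>\<^sub>s wh [] ?g [c, z] = ?g \<circ>\<^sub>s wh [d, z] ?e []"
      using interchange[of ?g ?e "[]" "[]" "[]"] g by simp
    also have "(?g \<circ>\<^sub>s wh [d, z] ?e []) \<circ>\<^sub>s wh [d] ?k [z] \<circ>\<^sub>s unjoin d z
        = ?g \<circ>\<^sub>s wh [d] (wh [z] ?e [] \<circ>\<^sub>s wh [] ?k [z]) [] \<circ>\<^sub>s unjoin d z"
      using g by simp
    also have "\<dots> = emb (d \<otimes> z, g, x)" unfolding Z using g by simp
    finally have "(d \<otimes> z, sharp z c e x (flat z c k d g), x) = (d \<otimes> z, g, x)"
      using s[OF t[OF g d]] g by (intro emb_inject) simp_all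
    then show ?thesis by simp
  qed
qed

end

context rigid_tensor_category
begin

text \<open>The second rigidity axiom: \<open>b\<close> is isomorphic to the dual of some
  \<open>a\<close>, and transport along the isomorphism makes \<open>b\<close> itself a dual of
  \<open>a\<close>.\<close>

lemma has_left_dual:
  assumes "b \<in> Obj"
  obtains z e k where "is_dual z b e k"
proof -
  obtain a b' e c where d: "is_dual a b' e c" and "isomorphic b b'" using iso_to_dual[OF assms] by blast
  then obtain g g' where g: "is_inverse b b' g g'" by (auto simp: isomorphic_def is_iso_def)
  have O: "a \<in> Obj" "b' \<in> Obj" using d by (auto simp: is_dual_def)
  from is_dual_transport[OF d mor_id mor_id] m_id(1)[OF mor_id] is_inverse_mor[OF assms O(2) g] O
  show ?thesis using that by metis
qed

end

section \<open>Strong monoidal functors into the strictification\<close>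

context tensor_functor
begin

notation D.scomp (infixr "\<circ>\<^sub>d" 65)
notation C.bcomp (infixr "\<circ>\<^sub>b" 65)
notation C.btens (infixr "\<otimes>\<^sub>b" 70)

lemma F_Obj [simp]: "x \<in> Obj\<^bsub>C\<^esub> \<Longrightarrow> fobj F x \<in> Obj\<^bsub>D\<^esub>"
  by (rule fobj_in_Obj)

lemma F_mor: "C.mor f x y \<Longrightarrow> D.mor (fmor F f) (fobj F x) (fobj F y)"
  using fobj_in_Obj fmor_in_Hom by (auto simp: C.mor_def D.mor_def)

lemma F_comp: "\<lbrakk>C.mor g y z; C.mor f x y\<rbrakk> \<Longrightarrow> fmor F (g \<cdot>\<^bsub>C\<^esub> f) = fmor F g \<cdot>\<^bsub>D\<^esub> fmor F f"
  using fmor_comp unfolding C.mor_def by blast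

definition bmap :: "'o \<times> 'm \<times> 'o \<Rightarrow> 'p \<times> 'n \<times> 'p" where
  "bmap t = (fobj F (fst t), fmor F (fst (snd t)), fobj F (snd (snd t)))"

definition tens_inv :: "'o \<Rightarrow> 'o \<Rightarrow> 'n" where
  "tens_inv x y = D.inv_mor (fobj F x \<otimes>\<^bsub>D\<^esub> fobj F y) (fobj F (x \<otimes>\<^bsub>C\<^esub> y)) (tensorator F x y)"
definition unitor_inv :: 'n where
  "unitor_inv = D.inv_mor \<one>\<^bsub>D\<^esub> (fobj F \<one>\<^bsub>C\<^esub>) (unitor F)"

lemma mor_tens_inv:
  assumes "x \<in> Obj\<^bsub>C\<^esub>" "y \<in> Obj\<^bsub>C\<^esub>"
  shows "D.mor (tensorator F x y) (fobj F x \<otimes>\<^bsub>D\<^esub> fobj F y) (fobj F (x \<otimes>\<^bsub>C\<^esub> y))"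
    "D.mor (tens_inv x y) (fobj F (x \<otimes>\<^bsub>C\<^esub> y)) (fobj F x \<otimes>\<^bsub>D\<^esub> fobj F y)"
    "tens_inv x y \<cdot>\<^bsub>D\<^esub> tensorator F x y = idm\<^bsub>D\<^esub> (fobj F x \<otimes>\<^bsub>D\<^esub> fobj F y)"
    "tensorator F x y \<cdot>\<^bsub>D\<^esub> tens_inv x y = idm\<^bsub>D\<^esub> (fobj F (x \<otimes>\<^bsub>C\<^esub> y))"
  using D.inv_mor[OF _ _ tensorator_iso[OF assms]] assms unfolding tens_inv_def by auto

lemma mor_unitor_inv:
  "D.mor (unitor F) \<one>\<^bsub>D\<^esub> (fobj F \<one>\<^bsub>C\<^esub>)" "D.mor unitor_inv (fobj F \<one>\<^bsub>C\<^esub>) \<one>\<^bsub>D\<^esub>"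
  "unitor_inv \<cdot>\<^bsub>D\<^esub> unitor F = idm\<^bsub>D\<^esub> \<one>\<^bsub>D\<^esub>" "unitor F \<cdot>\<^bsub>D\<^esub> unitor_inv = idm\<^bsub>D\<^esub> (fobj F \<one>\<^bsub>C\<^esub>)"
  using D.inv_mor[OF _ _ unitor_iso] unfolding unitor_inv_def by auto

definition bt where "bt x y = (fobj F x \<otimes>\<^bsub>D\<^esub> fobj F y, tensorator F x y, fobj F (x \<otimes>\<^bsub>C\<^esub> y))"
definition bt' where "bt' x y = (fobj F (x \<otimes>\<^bsub>C\<^esub> y), tens_inv x y, fobj F x \<otimes>\<^bsub>D\<^esub> fobj F y)"
definition bu where "bu = (\<one>\<^bsub>D\<^esub>, unitor F, fobj F \<one>\<^bsub>C\<^esub>)"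
definition bu' where "bu' = (fobj F \<one>\<^bsub>C\<^esub>, unitor_inv, \<one>\<^bsub>D\<^esub>)"

lemma bmap_simps [simp]:
  "D.bdom (bmap t) = fobj F (C.bdom t)" "D.bcod (bmap t) = fobj F (C.bcod t)"
  "C.barr t \<Longrightarrow> D.barr (bmap t)"
  "D.bdom (bt x y) = fobj F x \<otimes>\<^bsub>D\<^esub> fobj F y" "D.bcod (bt x y) = fobj F (x \<otimes>\<^bsub>C\<^esub> y)"
  "D.bdom (bt' x y) = fobj F (x \<otimes>\<^bsub>C\<^esub> y)" "D.bcod (bt' x y) = fobj F x \<otimes>\<^bsub>D\<^esub> fobj F y"
  "D.bdom bu = \<one>\<^bsub>D\<^esub>" "D.bcod bu = fobj F \<one>\<^bsub>C\<^esub>" "D.bdom bu' = fobj F \<one>\<^bsub>C\<^esub>" "D.bcod bu' = \<one>\<^bsub>D\<^esub>"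
  "\<lbrakk>x \<in> Obj\<^bsub>C\<^esub>; y \<in> Obj\<^bsub>C\<^esub>\<rbrakk> \<Longrightarrow> D.barr (bt x y)" "\<lbrakk>x \<in> Obj\<^bsub>C\<^esub>; y \<in> Obj\<^bsub>C\<^esub>\<rbrakk> \<Longrightarrow> D.barr (bt' x y)"
  "D.barr bu" "D.barr bu'"
  using F_mor mor_tens_inv mor_unitor_inv
  by (auto simp: bmap_def bt_def bt'_def bu_def bu'_def D.bdom_def D.bcod_def C.bdom_def C.bcod_def
      D.barr_def C.barr_def split: prod.splits)

lemma bt_inverse:
  "\<lbrakk>x \<in> Obj\<^bsub>C\<^esub>; y \<in> Obj\<^bsub>C\<^esub>\<rbrakk> \<Longrightarrow> D.emb (bt x y) \<circ>\<^sub>d D.emb (bt' x y) = D.sid [fobj F (x \<otimes>\<^bsub>C\<^esub> y)]"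
  "\<lbrakk>x \<in> Obj\<^bsub>C\<^esub>; y \<in> Obj\<^bsub>C\<^esub>\<rbrakk> \<Longrightarrow> D.emb (bt' x y) \<circ>\<^sub>d D.emb (bt x y) = D.sid [fobj F x \<otimes>\<^bsub>D\<^esub> fobj F y]"
  "D.emb bu \<circ>\<^sub>d D.emb bu' = D.sid [fobj F \<one>\<^bsub>C\<^esub>]"
  "D.emb bu' \<circ>\<^sub>d D.emb bu = D.sid [\<one>\<^bsub>D\<^esub>]"
proof -
  have "D.bcomp bu bu' = D.bid (fobj F \<one>\<^bsub>C\<^esub>)" "D.bcomp bu' bu = D.bid \<one>\<^bsub>D\<^esub>"
    by (simp_all add: bu_def bu'_def D.bdefs mor_unitor_inv)
  from this[THEN arg_cong[of _ _ D.emb]]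
  show "D.emb bu \<circ>\<^sub>d D.emb bu' = D.sid [fobj F \<one>\<^bsub>C\<^esub>]" "D.emb bu' \<circ>\<^sub>d D.emb bu = D.sid [\<one>\<^bsub>D\<^esub>]"
    by simp_all
  assume O: "x \<in> Obj\<^bsub>C\<^esub>" "y \<in> Obj\<^bsub>C\<^esub>"
  then have "D.bcomp (bt x y) (bt' x y) = D.bid (fobj F (x \<otimes>\<^bsub>C\<^esub> y))"
    "D.bcomp (bt' x y) (bt x y) = D.bid (fobj F x \<otimes>\<^bsub>D\<^esub> fobj F y)"
    by (simp_all add: bt_def bt'_def D.bdefs mor_tens_inv)
  from this[THEN arg_cong[of _ _ D.emb]] O
  show "D.emb (bt x y) \<circ>\<^sub>d D.emb (bt' x y) = D.sid [fobj F (x \<otimes>\<^bsub>C\<^esub> y)]"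
    "D.emb (bt' x y) \<circ>\<^sub>d D.emb (bt x y) = D.sid [fobj F x \<otimes>\<^bsub>D\<^esub> fobj F y]"
    by simp_all
qed

lemmas bt_cancel =
  bt_inverse
  D.cancel_left[OF _ _ _ bt_inverse(1), simplified] D.cancel_left[OF _ _ _ bt_inverse(2), simplified]
  D.cancel_left[OF _ _ _ bt_inverse(3), simplified] D.cancel_left[OF _ _ _ bt_inverse(4), simplified]
  D.cancel_wh[OF _ _ _ bt_inverse(1), simplified] D.cancel_wh[OF _ _ _ bt_inverse(2), simplified]
  D.cancel_wh[OF _ _ _ bt_inverse(3), simplified] D.cancel_wh[OF _ _ _ bt_inverse(4), simplified]

text \<open>The functor followed by the embedding of its target. \<open>Fjoin\<close> and
  \<open>Fpunit\<close> combine the tensorator and unitor with the structure maps of the embedding,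
  so that coherence of the functor takes the shape of the rules for \<open>emb\<close>.\<close>

definition Femb where "Femb t = D.emb (bmap t)"
definition Fjoin where "Fjoin x y = D.emb (bt x y) \<circ>\<^sub>d D.join (fobj F x) (fobj F y)"
definition Funjoin where "Funjoin x y = D.unjoin (fobj F x) (fobj F y) \<circ>\<^sub>d D.emb (bt' x y)"
definition Fpunit where "Fpunit = D.emb bu \<circ>\<^sub>d D.punit"
definition Funpunit where "Funpunit = D.unpunit \<circ>\<^sub>d D.emb bu'"

lemma Femb_simps [simp]:
  "D.sdom (Femb t) = [fobj F (C.bdom t)]" "D.scod (Femb t) = [fobj F (C.bcod t)]"
  "C.barr t \<Longrightarrow> D.sarr (Femb t)"
  "D.sdom (Fjoin x y) = [fobj F x, fobj F y]" "D.scod (Fjoin x y) = [fobj F (x \<otimes>\<^bsub>C\<^esub> y)]"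
  "D.sdom (Funjoin x y) = [fobj F (x \<otimes>\<^bsub>C\<^esub> y)]" "D.scod (Funjoin x y) = [fobj F x, fobj F y]"
  "D.sdom Fpunit = []" "D.scod Fpunit = [fobj F \<one>\<^bsub>C\<^esub>]" "D.sdom Funpunit = [fobj F \<one>\<^bsub>C\<^esub>]" "D.scod Funpunit = []"
  "\<lbrakk>x \<in> Obj\<^bsub>C\<^esub>; y \<in> Obj\<^bsub>C\<^esub>\<rbrakk> \<Longrightarrow> D.sarr (Fjoin x y)" "\<lbrakk>x \<in> Obj\<^bsub>C\<^esub>; y \<in> Obj\<^bsub>C\<^esub>\<rbrakk> \<Longrightarrow> D.sarr (Funjoin x y)"
  "D.sarr Fpunit" "D.sarr Funpunit"
  by (simp_all add: Femb_def Fjoin_def Funjoin_def Fpunit_def Funpunit_def)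

lemma Fjoin_inverse [simp]:
  "\<lbrakk>x \<in> Obj\<^bsub>C\<^esub>; y \<in> Obj\<^bsub>C\<^esub>\<rbrakk> \<Longrightarrow> Fjoin x y \<circ>\<^sub>d Funjoin x y = D.sid [fobj F (x \<otimes>\<^bsub>C\<^esub> y)]"
  "\<lbrakk>x \<in> Obj\<^bsub>C\<^esub>; y \<in> Obj\<^bsub>C\<^esub>\<rbrakk> \<Longrightarrow> Funjoin x y \<circ>\<^sub>d Fjoin x y = D.sid [fobj F x, fobj F y]"
  "Fpunit \<circ>\<^sub>d Funpunit = D.sid [fobj F \<one>\<^bsub>C\<^esub>]"
  "Funpunit \<circ>\<^sub>d Fpunit = D.sid []"
  by (simp_all add: Fjoin_def Funjoin_def Fpunit_def Funpunit_def bt_cancel)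

lemmas Fjoin_cancel [simp] =
  D.cancel_left[OF _ _ _ Fjoin_inverse(1), simplified] D.cancel_left[OF _ _ _ Fjoin_inverse(2), simplified]
  D.cancel_left[OF _ _ _ Fjoin_inverse(3), simplified] D.cancel_left[OF _ _ _ Fjoin_inverse(4), simplified]
  D.cancel_wh[OF _ _ _ Fjoin_inverse(1), simplified] D.cancel_wh[OF _ _ _ Fjoin_inverse(2), simplified]
  D.cancel_wh[OF _ _ _ Fjoin_inverse(3), simplified] D.cancel_wh[OF _ _ _ Fjoin_inverse(4), simplified]

lemma bmap_comp:
  assumes "C.barr s" "C.barr t" "C.bcod t = C.bdom s"
  shows "bmap (s \<circ>\<^sub>b t) = D.bcomp (bmap s) (bmap t)"
  using assms F_comp
  by (auto simp: bmap_def C.bcomp_def D.bcomp_def C.barr_def C.bdom_def C.bcod_def split: prod.splits)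

lemma Femb_comp [simp]:
  "\<lbrakk>C.barr s; C.barr t; C.bcod t = C.bdom s\<rbrakk> \<Longrightarrow> Femb (s \<circ>\<^sub>b t) = Femb s \<circ>\<^sub>d Femb t"
  by (simp add: Femb_def bmap_comp)

lemma Femb_id [simp]: "x \<in> Obj\<^bsub>C\<^esub> \<Longrightarrow> Femb (C.bid x) = D.sid [fobj F x]"
  using D.emb_id by (simp add: Femb_def bmap_def C.bid_def D.bid_def fmor_id)

text \<open>Naturality of the tensorator, with the tensorator at the source moved to the other side
  by its inverse.\<close>

lemma Femb_tens [simp]:
  assumes s: "C.barr s" and t: "C.barr t"
  shows "Femb (s \<otimes>\<^sub>b t) = Fjoin (C.bcod s) (C.bcod t) \<circ>\<^sub>d D.wh [] (Femb s) [fobj F (C.bcod t)]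
    \<circ>\<^sub>d D.wh [fobj F (C.bdom s)] (Femb t) [] \<circ>\<^sub>d Funjoin (C.bdom s) (C.bdom t)"
proof -
  have "D.bcomp (bt (C.bcod s) (C.bcod t)) (D.btens (bmap s) (bmap t))
      = D.bcomp (bmap (s \<otimes>\<^sub>b t)) (bt (C.bdom s) (C.bdom t))"
    using s t tensorator_natural
    by (auto simp: bmap_def bt_def C.btens_def D.bcomp_def D.btens_def C.barr_def C.mor_def
        C.bdom_def C.bcod_def split: prod.splits)
  then have "D.emb (D.bcomp (bt (C.bcod s) (C.bcod t)) (D.btens (bmap s) (bmap t))) \<circ>\<^sub>d D.emb (bt' (C.bdom s) (C.bdom t))
      = D.emb (D.bcomp (bmap (s \<otimes>\<^sub>b t)) (bt (C.bdom s) (C.bdom t))) \<circ>\<^sub>d D.emb (bt' (C.bdom s) (C.bdom t))"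
    by simp
  then show ?thesis
    using s t by (simp add: Femb_def bt_cancel Fjoin_def Funjoin_def)
qed

text \<open>Compatibility of the tensorator with the associators; precomposing with
  \<open>?j'\<close> undoes the regrouping at the source and isolates the image of the
  associator.\<close>

lemma Femb_assoc [simp]:
  assumes O: "x \<in> Obj\<^bsub>C\<^esub>" "y \<in> Obj\<^bsub>C\<^esub>" "z \<in> Obj\<^bsub>C\<^esub>"
  shows "Femb (C.bassoc x y z) = Fjoin x (y \<otimes>\<^bsub>C\<^esub> z) \<circ>\<^sub>d D.wh [fobj F x] (Fjoin y z) []
    \<circ>\<^sub>d D.wh [] (Funjoin x y) [fobj F z] \<circ>\<^sub>d Funjoin (x \<otimes>\<^bsub>C\<^esub> y) z"
proof -
  let ?L = "D.bcomp (D.bcomp (bmap (C.bassoc x y z)) (bt (x \<otimes>\<^bsub>C\<^esub> y) z)) (D.btens (bt x y) (D.bid (fobj F z)))"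
    and ?R = "D.bcomp (D.bcomp (bt x (y \<otimes>\<^bsub>C\<^esub> z)) (D.btens (D.bid (fobj F x)) (bt y z)))
      (D.bassoc (fobj F x) (fobj F y) (fobj F z))"
  let ?j = "D.join (fobj F x \<otimes>\<^bsub>D\<^esub> fobj F y) (fobj F z) \<circ>\<^sub>d D.wh [] (Funjoin x y) [fobj F z]
    \<circ>\<^sub>d Funjoin (x \<otimes>\<^bsub>C\<^esub> y) z"
  let ?j' = "D.join (fobj F x \<otimes>\<^bsub>D\<^esub> fobj F y) (fobj F z) \<circ>\<^sub>d D.wh [] (D.join (fobj F x) (fobj F y)) [fobj F z]
    \<circ>\<^sub>d D.wh [] (Funjoin x y) [fobj F z] \<circ>\<^sub>d Funjoin (x \<otimes>\<^bsub>C\<^esub> y) z"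
  have "?L = ?R" using tensorator_assoc[OF O] by (simp add: bmap_def bt_def C.bdefs D.bdefs)
  then have "D.emb ?L \<circ>\<^sub>d ?j' = D.emb ?R \<circ>\<^sub>d ?j'" by simp
  then show ?thesis
    using O by (simp add: Femb_def bt_cancel Fjoin_def Funjoin_def)
qed

lemma Femb_assoc' [simp]:
  assumes O: "x \<in> Obj\<^bsub>C\<^esub>" "y \<in> Obj\<^bsub>C\<^esub>" "z \<in> Obj\<^bsub>C\<^esub>"
  shows "Femb (C.bassoc' x y z) = Fjoin (x \<otimes>\<^bsub>C\<^esub> y) z \<circ>\<^sub>d D.wh [] (Fjoin x y) [fobj F z]
    \<circ>\<^sub>d D.wh [fobj F x] (Funjoin y z) [] \<circ>\<^sub>d Funjoin x (y \<otimes>\<^bsub>C\<^esub> z)"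
proof (rule D.inverse_unique[of "Femb (C.bassoc x y z)"])
  have "Femb (C.bassoc' x y z) \<circ>\<^sub>d Femb (C.bassoc x y z) = Femb (C.bassoc' x y z \<circ>\<^sub>b C.bassoc x y z)"
    by (rule Femb_comp[symmetric]) (use O in simp_all)
  also have "\<dots> = D.sid [fobj F ((x \<otimes>\<^bsub>C\<^esub> y) \<otimes>\<^bsub>C\<^esub> z)]"
    unfolding C.b_inverses(1)[OF O] using O by simp
  finally show "Femb (C.bassoc' x y z) \<circ>\<^sub>d Femb (C.bassoc x y z) = D.sid (D.sdom (Femb (C.bassoc x y z)))"
    by simp
qed (use O in simp_all)

lemma Femb_lunit [simp]:
  assumes x: "x \<in> Obj\<^bsub>C\<^esub>"
  shows "Femb (C.blunit x) = D.wh [] Funpunit [fobj F x] \<circ>\<^sub>d Funjoin \<one>\<^bsub>C\<^esub> x"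
proof -
  let ?L = "D.bcomp (D.bcomp (bmap (C.blunit x)) (bt \<one>\<^bsub>C\<^esub> x)) (D.btens bu (D.bid (fobj F x)))"
  let ?j = "D.join \<one>\<^bsub>D\<^esub> (fobj F x) \<circ>\<^sub>d D.wh [] (D.emb bu') [fobj F x] \<circ>\<^sub>d Funjoin \<one>\<^bsub>C\<^esub> x"
  have "?L = D.blunit (fobj F x)" using unitor_left[OF x] by (simp add: bmap_def bt_def bu_def C.bdefs D.bdefs)
  then have "D.emb ?L \<circ>\<^sub>d ?j = D.emb (D.blunit (fobj F x)) \<circ>\<^sub>d ?j" by simp
  then show ?thesis
    using x by (simp add: Femb_def bt_cancel Fjoin_def Funjoin_def Funpunit_def)
qed

lemma Femb_runit [simp]:
  assumes x: "x \<in> Obj\<^bsub>C\<^esub>"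
  shows "Femb (C.brunit x) = D.wh [fobj F x] Funpunit [] \<circ>\<^sub>d Funjoin x \<one>\<^bsub>C\<^esub>"
proof -
  let ?L = "D.bcomp (D.bcomp (bmap (C.brunit x)) (bt x \<one>\<^bsub>C\<^esub>)) (D.btens (D.bid (fobj F x)) bu)"
  let ?j = "D.join (fobj F x) \<one>\<^bsub>D\<^esub> \<circ>\<^sub>d D.wh [fobj F x] (D.emb bu') [] \<circ>\<^sub>d Funjoin x \<one>\<^bsub>C\<^esub>"
  have "?L = D.brunit (fobj F x)" using unitor_right[OF x] by (simp add: bmap_def bt_def bu_def C.bdefs D.bdefs)
  then have "D.emb ?L \<circ>\<^sub>d ?j = D.emb (D.brunit (fobj F x)) \<circ>\<^sub>d ?j" by simp
  then show ?thesis
    using x by (simp add: Femb_def bt_cancel Fjoin_def Funjoin_def Funpunit_def)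
qed

definition Fev where "Fev a b e = Funpunit \<circ>\<^sub>d Femb (b \<otimes>\<^bsub>C\<^esub> a, e, \<one>\<^bsub>C\<^esub>) \<circ>\<^sub>d Fjoin b a"
definition Fcoev where "Fcoev a b c = Funjoin a b \<circ>\<^sub>d Femb (\<one>\<^bsub>C\<^esub>, c, a \<otimes>\<^bsub>C\<^esub> b) \<circ>\<^sub>d Fpunit"

lemma Fev_simps [simp]:
  "D.sdom (Fev a b e) = [fobj F b, fobj F a]" "D.scod (Fev a b e) = []"
  "D.sdom (Fcoev a b c) = []" "D.scod (Fcoev a b c) = [fobj F a, fobj F b]"
  "\<lbrakk>a \<in> Obj\<^bsub>C\<^esub>; b \<in> Obj\<^bsub>C\<^esub>; C.mor e (b \<otimes>\<^bsub>C\<^esub> a) \<one>\<^bsub>C\<^esub>\<rbrakk> \<Longrightarrow> D.sarr (Fev a b e)"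
  "\<lbrakk>a \<in> Obj\<^bsub>C\<^esub>; b \<in> Obj\<^bsub>C\<^esub>; C.mor c \<one>\<^bsub>C\<^esub> (a \<otimes>\<^bsub>C\<^esub> b)\<rbrakk> \<Longrightarrow> D.sarr (Fcoev a b c)"
  by (simp_all add: Fev_def Fcoev_def)

lemma Femb_ev:
  "\<lbrakk>a \<in> Obj\<^bsub>C\<^esub>; b \<in> Obj\<^bsub>C\<^esub>; C.mor e (b \<otimes>\<^bsub>C\<^esub> a) \<one>\<^bsub>C\<^esub>\<rbrakk>
    \<Longrightarrow> Femb (b \<otimes>\<^bsub>C\<^esub> a, e, \<one>\<^bsub>C\<^esub>) = Fpunit \<circ>\<^sub>d Fev a b e \<circ>\<^sub>d Funjoin b a"
  "\<lbrakk>a \<in> Obj\<^bsub>C\<^esub>; b \<in> Obj\<^bsub>C\<^esub>; C.mor c \<one>\<^bsub>C\<^esub> (a \<otimes>\<^bsub>C\<^esub> b)\<rbrakk>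
    \<Longrightarrow> Femb (\<one>\<^bsub>C\<^esub>, c, a \<otimes>\<^bsub>C\<^esub> b) = Fjoin a b \<circ>\<^sub>d Fcoev a b c \<circ>\<^sub>d Funpunit"
  by (simp_all add: Fev_def Fcoev_def)

text \<open>Strong monoidal functors preserve duals: the zig-zag on \<open>b\<close> is mapped to a
  zig-zag on the image of \<open>b\<close>. In the projection formula it straightens arrows that
  have been bent in the target category.\<close>

lemma Fdual:
  assumes "C.is_dual a b e c"
  shows "D.wh [] (Fev a b e) [fobj F b] \<circ>\<^sub>d D.wh [fobj F b] (Fcoev a b c) [] = D.sid [fobj F b]"
proof -
  have O [simp]: "a \<in> Obj\<^bsub>C\<^esub>" "b \<in> Obj\<^bsub>C\<^esub>"
    and M [simp]: "C.mor e (b \<otimes>\<^bsub>C\<^esub> a) \<one>\<^bsub>C\<^esub>" "C.mor c \<one>\<^bsub>C\<^esub> (a \<otimes>\<^bsub>C\<^esub> b)"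
    using assms by (auto simp: C.is_dual_iff)
  let ?e = "(b \<otimes>\<^bsub>C\<^esub> a, e, \<one>\<^bsub>C\<^esub>)" and ?c = "(\<one>\<^bsub>C\<^esub>, c, a \<otimes>\<^bsub>C\<^esub> b)"
  let ?R = "((C.blunit b \<circ>\<^sub>b (?e \<otimes>\<^sub>b C.bid b)) \<circ>\<^sub>b C.bassoc' b a b) \<circ>\<^sub>b (C.bid b \<otimes>\<^sub>b ?c)"
  have "?R = C.brunit b" using assms by (simp add: C.bdefs C.is_dual_def)
  then have "Femb ?R \<circ>\<^sub>d Fjoin b \<one>\<^bsub>C\<^esub> \<circ>\<^sub>d D.wh [fobj F b] Fpunit []
      = Femb (C.brunit b) \<circ>\<^sub>d Fjoin b \<one>\<^bsub>C\<^esub> \<circ>\<^sub>d D.wh [fobj F b] Fpunit []" by simp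
  then show ?thesis by (simp add: Femb_ev)
qed

end

section \<open>The algebra structure on the image of the right adjoint\<close>

context vector_space_pair
begin

lemma dim_le_of_injective:
  assumes V: "vs1.subspace V" and W: "finite B0" "vs2.span B0 = W"
    and maps: "\<And>v. v \<in> V \<Longrightarrow> f v \<in> W"
    and add: "\<And>u v. \<lbrakk>u \<in> V; v \<in> V\<rbrakk> \<Longrightarrow> f (u + v) = f u + f v"
    and scale: "\<And>c v. v \<in> V \<Longrightarrow> f (s1 c v) = s2 c (f v)"
    and inj: "\<And>v. \<lbrakk>v \<in> V; f v = 0\<rbrakk> \<Longrightarrow> v = 0"
  shows "vs1.dim V \<le> vs2.dim W"
proof -
  obtain B where B: "B \<subseteq> V" "vs1.independent B" "V \<subseteq> vs1.span B" "card B = vs1.dim V"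
    using vs1.basis_exists by blast
  have im: "vs2.independent (f ` B)" "inj_on f B"
    by (rule independent_image_on_subspace[of V B f, OF V B(1,2)]; rule add scale inj; assumption)+
  have "f ` B \<subseteq> W" using B(1) maps by auto
  from vs2.independent_card_le_dim_finite(2)[OF W this im(1)] show ?thesis
    unfolding card_image[OF im(2)] B(4) .
qed

end

context tensor_functor_right_adjoint
begin

lemma Tr_Obj [simp]: "x \<in> Obj\<^bsub>M\<^esub> \<Longrightarrow> fobj Tr x \<in> Obj\<^bsub>C\<^esub>"
  by (rule G.fobj_in_Obj)

lemma Tr_mor: "D.mor f x y \<Longrightarrow> C.mor (fmor Tr f) (fobj Tr x) (fobj Tr y)"
  using G.fobj_in_Obj G.fmor_in_Hom by (auto simp: C.mor_def D.mor_def)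

lemma Tr_comp: "\<lbrakk>D.mor g y z; D.mor f x y\<rbrakk> \<Longrightarrow> fmor Tr (g \<cdot>\<^bsub>M\<^esub> f) = fmor Tr g \<cdot>\<^bsub>C\<^esub> fmor Tr f"
  using G.fmor_comp unfolding D.mor_def by blast

lemma mor_counit: "x \<in> Obj\<^bsub>M\<^esub> \<Longrightarrow> D.mor (\<epsilon> x) (fobj \<Phi> (fobj Tr x)) x"
  using counit_in_Hom by (simp add: D.mor_def)

lemma mor_unit: "c \<in> Obj\<^bsub>C\<^esub> \<Longrightarrow> C.mor (\<eta> c) c (fobj Tr (fobj \<Phi> c))"
  using unit_in_Hom by (simp add: C.mor_def)

text \<open>Naturality of the unit and a triangle identity recover \<open>f\<close> from its
  transpose \<open>\<epsilon> x \<cdot> \<Phi> f\<close>, by applying \<open>Tr\<close> and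
  precomposing with \<open>\<eta> c\<close>.\<close>

lemma transpose_inj:
  assumes x: "x \<in> Obj\<^bsub>M\<^esub>" and f: "C.mor f c (fobj Tr x)" and g: "C.mor g c (fobj Tr x)"
    and eq: "\<epsilon> x \<cdot>\<^bsub>M\<^esub> fmor \<Phi> f = \<epsilon> x \<cdot>\<^bsub>M\<^esub> fmor \<Phi> g"
  shows "f = g"
proof -
  have "f = fmor Tr (\<epsilon> x \<cdot>\<^bsub>M\<^esub> fmor \<Phi> f) \<cdot>\<^bsub>C\<^esub> \<eta> c" if f: "C.mor f c (fobj Tr x)" for f
  proof -
    have c: "c \<in> Obj\<^bsub>C\<^esub>" using f by (simp add: C.mor_def)
    note e = mor_counit[OF x] and u = mor_unit[OF c] and u' = mor_unit[OF Tr_Obj[OF x]]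
    have "fmor Tr (\<epsilon> x \<cdot>\<^bsub>M\<^esub> fmor \<Phi> f) \<cdot>\<^bsub>C\<^esub> \<eta> c = fmor Tr (\<epsilon> x) \<cdot>\<^bsub>C\<^esub> (fmor Tr (fmor \<Phi> f) \<cdot>\<^bsub>C\<^esub> \<eta> c)"
      using Tr_comp[OF e F_mor[OF f]] C.m_assoc[OF Tr_mor[OF e] Tr_mor[OF F_mor[OF f]] u] by simp
    also have "\<dots> = fmor Tr (\<epsilon> x) \<cdot>\<^bsub>C\<^esub> (\<eta> (fobj Tr x) \<cdot>\<^bsub>C\<^esub> f)"
      using unit_natural[OF c Tr_Obj[OF x]] f by (simp add: C.mor_def)
    also have "\<dots> = f"
      using C.m_assoc[OF Tr_mor[OF e] u' f] triangle_right[OF x] C.m_id(1)[OF f] by simp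
    finally show ?thesis by simp
  qed
  from this[OF f] this[OF g] eq show ?thesis by simp
qed

lemma transpose_surj:
  assumes c: "c \<in> Obj\<^bsub>C\<^esub>" and g: "D.mor g (fobj \<Phi> c) x"
  shows "C.mor (fmor Tr g \<cdot>\<^bsub>C\<^esub> \<eta> c) c (fobj Tr x)"
    "\<epsilon> x \<cdot>\<^bsub>M\<^esub> fmor \<Phi> (fmor Tr g \<cdot>\<^bsub>C\<^esub> \<eta> c) = g"
proof -
  note u = mor_unit[OF c] and Tg = Tr_mor[OF g]
  have x: "x \<in> Obj\<^bsub>M\<^esub>" using g by (simp add: D.mor_def)
  note e = mor_counit[OF x] and e' = mor_counit[OF F_Obj[OF c]]
  show "C.mor (fmor Tr g \<cdot>\<^bsub>C\<^esub> \<eta> c) c (fobj Tr x)" using Tg u by (rule C.mor_comp)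
  have "\<epsilon> x \<cdot>\<^bsub>M\<^esub> fmor \<Phi> (fmor Tr g \<cdot>\<^bsub>C\<^esub> \<eta> c) = (\<epsilon> x \<cdot>\<^bsub>M\<^esub> fmor \<Phi> (fmor Tr g)) \<cdot>\<^bsub>M\<^esub> fmor \<Phi> (\<eta> c)"
    using F_comp[OF Tg u] D.m_assoc[OF e F_mor[OF Tg] F_mor[OF u]] by simp
  also have "\<epsilon> x \<cdot>\<^bsub>M\<^esub> fmor \<Phi> (fmor Tr g) = g \<cdot>\<^bsub>M\<^esub> \<epsilon> (fobj \<Phi> c)"
    using counit_natural[OF F_Obj[OF c] x] g by (simp add: D.mor_def)
  also have "g \<cdot>\<^bsub>M\<^esub> \<epsilon> (fobj \<Phi> c) \<cdot>\<^bsub>M\<^esub> fmor \<Phi> (\<eta> c) = g"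
    using D.m_assoc[OF g e' F_mor[OF u]] triangle_left[OF c] D.m_id(2)[OF g] by simp
  finally show "\<epsilon> x \<cdot>\<^bsub>M\<^esub> fmor \<Phi> (fmor Tr g \<cdot>\<^bsub>C\<^esub> \<eta> c) = g" .
qed

text \<open>Justifies the definite description. The tensorator is invertible, so the defining
  equation prescribes the transpose of \<open>h\<close>, and transposition is a bijection.\<close>

lemma tr_mu:
  assumes x: "x \<in> Obj\<^bsub>M\<^esub>" and y: "y \<in> Obj\<^bsub>M\<^esub>"
  shows "C.mor (tr_mu x y) (fobj Tr x \<otimes>\<^bsub>C\<^esub> fobj Tr y) (fobj Tr (x \<otimes>\<^bsub>M\<^esub> y))"
    "\<epsilon> (x \<otimes>\<^bsub>M\<^esub> y) \<cdot>\<^bsub>M\<^esub> fmor \<Phi> (tr_mu x y) \<cdot>\<^bsub>M\<^esub> tensorator \<Phi> (fobj Tr x) (fobj Tr y) = \<epsilon> x \<odot>\<^bsub>M\<^esub> \<epsilon> y"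
proof -
  let ?X = "fobj Tr x" and ?Y = "fobj Tr y"
  let ?P = "\<lambda>h. h \<in> Hom\<^bsub>C\<^esub> (?X \<otimes>\<^bsub>C\<^esub> ?Y) (fobj Tr (x \<otimes>\<^bsub>M\<^esub> y)) \<and>
     \<epsilon> (x \<otimes>\<^bsub>M\<^esub> y) \<cdot>\<^bsub>M\<^esub> fmor \<Phi> h \<cdot>\<^bsub>M\<^esub> tensorator \<Phi> ?X ?Y = \<epsilon> x \<odot>\<^bsub>M\<^esub> \<epsilon> y"
  have xy: "x \<otimes>\<^bsub>M\<^esub> y \<in> Obj\<^bsub>M\<^esub>" and XY: "?X \<otimes>\<^bsub>C\<^esub> ?Y \<in> Obj\<^bsub>C\<^esub>" using x y by simp_all
  note t = mor_tens_inv[OF Tr_Obj[OF x] Tr_Obj[OF y]] and e = mor_counit[OF xy]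
  have ee: "D.mor (\<epsilon> x \<odot>\<^bsub>M\<^esub> \<epsilon> y) (fobj \<Phi> ?X \<otimes>\<^bsub>M\<^esub> fobj \<Phi> ?Y) (x \<otimes>\<^bsub>M\<^esub> y)"
    using mor_counit x y by (intro D.mor_tens) auto
  let ?g = "(\<epsilon> x \<odot>\<^bsub>M\<^esub> \<epsilon> y) \<cdot>\<^bsub>M\<^esub> tens_inv ?X ?Y"
  have g: "D.mor ?g (fobj \<Phi> (?X \<otimes>\<^bsub>C\<^esub> ?Y)) (x \<otimes>\<^bsub>M\<^esub> y)" using ee t(2) by (rule D.mor_comp)
  note h = transpose_surj[OF XY g]
  have gt: "?g \<cdot>\<^bsub>M\<^esub> tensorator \<Phi> ?X ?Y = \<epsilon> x \<odot>\<^bsub>M\<^esub> \<epsilon> y"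
    using D.m_assoc[OF ee t(2,1)] t(3) D.m_id(2)[OF ee] by simp
  have H: "C.mor h (?X \<otimes>\<^bsub>C\<^esub> ?Y) (fobj Tr (x \<otimes>\<^bsub>M\<^esub> y)) \<and> \<epsilon> (x \<otimes>\<^bsub>M\<^esub> y) \<cdot>\<^bsub>M\<^esub> fmor \<Phi> h = ?g" if "?P h" for h
  proof
    show h: "C.mor h (?X \<otimes>\<^bsub>C\<^esub> ?Y) (fobj Tr (x \<otimes>\<^bsub>M\<^esub> y))" using that XY xy by (simp add: C.mor_def)
    note eh = D.mor_comp[OF e F_mor[OF h]]
    show "\<epsilon> (x \<otimes>\<^bsub>M\<^esub> y) \<cdot>\<^bsub>M\<^esub> fmor \<Phi> h = ?g"
      using D.m_assoc[OF eh t(1,2)] t(4) D.m_id(2)[OF eh] that by simp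
  qed
  have "?P (tr_mu x y)"
    unfolding tr_mu_def
  proof (rule theI)
    show "?P (fmor Tr ?g \<cdot>\<^bsub>C\<^esub> \<eta> (?X \<otimes>\<^bsub>C\<^esub> ?Y))" using h gt C.mor_Hom by simp
    show "k = fmor Tr ?g \<cdot>\<^bsub>C\<^esub> \<eta> (?X \<otimes>\<^bsub>C\<^esub> ?Y)" if "?P k" for k
      using transpose_inj[OF xy _ h(1)] H[OF that] h(2) by simp
  qed
  then show "C.mor (tr_mu x y) (?X \<otimes>\<^bsub>C\<^esub> ?Y) (fobj Tr (x \<otimes>\<^bsub>M\<^esub> y))"
    "\<epsilon> (x \<otimes>\<^bsub>M\<^esub> y) \<cdot>\<^bsub>M\<^esub> fmor \<Phi> (tr_mu x y) \<cdot>\<^bsub>M\<^esub> tensorator \<Phi> ?X ?Y = \<epsilon> x \<odot>\<^bsub>M\<^esub> \<epsilon> y"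
    using H by blast+
qed

end

locale right_adjoint_algebra =
  tensor_functor_right_adjoint C M \<Phi> Tr \<eta> \<epsilon> + A: algebra_object M A m i
  for C :: "('k::field, 'o, 'm::ab_group_add, 'y) tensor_cat_scheme"
    and M :: "('k, 'p, 'n::ab_group_add, 'z) tensor_cat_scheme"
    and \<Phi> :: "('o, 'm, 'p, 'n, 'f) tensor_functor_data_scheme"
    and Tr :: "('p, 'n, 'o, 'm, 'g) linear_functor_data_scheme"
    and \<eta> :: "'o \<Rightarrow> 'm" and \<epsilon> :: "'p \<Rightarrow> 'n"
    and A :: 'p and m :: 'n and i :: 'n
begin

abbreviation "TA \<equiv> fobj Tr A"
abbreviation "mT \<equiv> tr_mult A m"
abbreviation "iT \<equiv> tr_unit i"
abbreviation "FT \<equiv> fobj \<Phi> (fobj Tr A)"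

lemma TA_Obj: "TA \<in> Obj\<^bsub>C\<^esub>" by simp

text \<open>Naturality of the counit at \<open>m\<close> and the defining equation of
  \<open>tr_mu\<close> combine to say that the counit from \<open>\<Phi> (Tr A)\<close> to
  \<open>A\<close> is multiplicative.\<close>

lemma mor_mT: "C.mor mT (TA \<otimes>\<^bsub>C\<^esub> TA) TA"
  and mT_counit: "\<epsilon> A \<cdot>\<^bsub>M\<^esub> fmor \<Phi> mT \<cdot>\<^bsub>M\<^esub> tensorator \<Phi> TA TA = m \<cdot>\<^bsub>M\<^esub> (\<epsilon> A \<odot>\<^bsub>M\<^esub> \<epsilon> A)"
proof -
  note mu = tr_mu[OF A.A_Obj A.A_Obj] and Tm = Tr_mor[OF A.mor_m] and e = mor_counit[OF A.A_Obj]
  note t = mor_tens_inv(1)[OF TA_Obj TA_Obj]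
  have AA: "A \<otimes>\<^bsub>M\<^esub> A \<in> Obj\<^bsub>M\<^esub>" by simp
  note eA = mor_counit[OF AA]
  show "C.mor mT (TA \<otimes>\<^bsub>C\<^esub> TA) TA" unfolding tr_mult_def using Tm mu(1) by (rule C.mor_comp)
  have "\<epsilon> A \<cdot>\<^bsub>M\<^esub> fmor \<Phi> mT = (\<epsilon> A \<cdot>\<^bsub>M\<^esub> fmor \<Phi> (fmor Tr m)) \<cdot>\<^bsub>M\<^esub> fmor \<Phi> (tr_mu A A)"
    unfolding tr_mult_def using F_comp[OF Tm mu(1)] D.m_assoc[OF e F_mor[OF Tm] F_mor[OF mu(1)]] by simp
  also have "\<epsilon> A \<cdot>\<^bsub>M\<^esub> fmor \<Phi> (fmor Tr m) = m \<cdot>\<^bsub>M\<^esub> \<epsilon> (A \<otimes>\<^bsub>M\<^esub> A)"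
    using counit_natural[OF AA A.A_Obj A.mult_in_Hom] .
  also have "\<dots> \<cdot>\<^bsub>M\<^esub> fmor \<Phi> (tr_mu A A) = m \<cdot>\<^bsub>M\<^esub> (\<epsilon> (A \<otimes>\<^bsub>M\<^esub> A) \<cdot>\<^bsub>M\<^esub> fmor \<Phi> (tr_mu A A))"
    using D.m_assoc[OF A.mor_m eA F_mor[OF mu(1)]] .
  finally show "\<epsilon> A \<cdot>\<^bsub>M\<^esub> fmor \<Phi> mT \<cdot>\<^bsub>M\<^esub> tensorator \<Phi> TA TA = m \<cdot>\<^bsub>M\<^esub> (\<epsilon> A \<odot>\<^bsub>M\<^esub> \<epsilon> A)"
    using D.m_assoc[OF A.mor_m D.mor_comp[OF eA F_mor[OF mu(1)]] t] mu(2) by simp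
qed

lemma mor_iT: "C.mor iT \<one>\<^bsub>C\<^esub> TA"
  and iT_counit: "\<epsilon> A \<cdot>\<^bsub>M\<^esub> fmor \<Phi> iT \<cdot>\<^bsub>M\<^esub> unitor \<Phi> = i"
proof -
  note u = mor_unitor_inv
  have ui: "D.mor (i \<cdot>\<^bsub>M\<^esub> unitor_inv) (fobj \<Phi> \<one>\<^bsub>C\<^esub>) A" using A.mor_i u(2) by (rule D.mor_comp)
  have eq: "iT = fmor Tr (i \<cdot>\<^bsub>M\<^esub> unitor_inv) \<cdot>\<^bsub>C\<^esub> \<eta> \<one>\<^bsub>C\<^esub>"
    unfolding tr_unit_def unitor_inv_def[symmetric] using Tr_comp[OF A.mor_i u(2)] by simp
  note s = transpose_surj[OF C.unit_Obj ui]
  show "C.mor iT \<one>\<^bsub>C\<^esub> TA" unfolding eq by (rule s(1))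
  show "\<epsilon> A \<cdot>\<^bsub>M\<^esub> fmor \<Phi> iT \<cdot>\<^bsub>M\<^esub> unitor \<Phi> = i"
    unfolding eq s(2) using D.m_assoc[OF A.mor_i u(2,1)] u(3) D.m_id(2)[OF A.mor_i] by simp
qed

abbreviation "bM \<equiv> (TA \<otimes>\<^bsub>C\<^esub> TA, mT, TA)"
abbreviation "bI \<equiv> (\<one>\<^bsub>C\<^esub>, iT, TA)"
abbreviation "bE \<equiv> (FT, \<epsilon> A, A)"

lemma barr_T [simp]: "C.barr bM" "C.barr bI" "D.barr bE"
  using mor_mT mor_iT mor_counit by simp_all

text \<open>Strict forms of the counit at \<open>A\<close> and of the multiplication and unit of the
  image algebra \<open>\<Phi> (Tr A)\<close>.\<close>

definition eh where "eh = D.emb bE"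
definition Fm where "Fm = Femb bM \<circ>\<^sub>d Fjoin TA TA"
definition Fi where "Fi = Femb bI \<circ>\<^sub>d Fpunit"

lemma eh_simps [simp]:
  "D.sarr eh" "D.sdom eh = [FT]" "D.scod eh = [A]"
  "D.sarr Fm" "D.sdom Fm = [FT, FT]" "D.scod Fm = [FT]"
  "D.sarr Fi" "D.sdom Fi = []" "D.scod Fi = [FT]"
  by (simp_all add: eh_def Fm_def Fi_def)

lemma Femb_mi: "Femb bM = Fm \<circ>\<^sub>d Funjoin TA TA" "Femb bI = Fi \<circ>\<^sub>d Funpunit"
  by (simp_all add: Fm_def Fi_def)

lemma eh_Fm: "eh \<circ>\<^sub>d Fm = A.mhat \<circ>\<^sub>d D.wh [] eh [A] \<circ>\<^sub>d D.wh [FT] eh []"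
proof -
  let ?j = "D.join FT FT"
  have "D.bcomp (D.bcomp bE (bmap bM)) (bt TA TA) = D.bcomp (A \<otimes>\<^bsub>M\<^esub> A, m, A) (D.btens bE bE)"
    using mT_counit by (simp add: D.bdefs bmap_def bt_def)
  then have "D.emb (D.bcomp (D.bcomp bE (bmap bM)) (bt TA TA)) \<circ>\<^sub>d ?j
      = D.emb (D.bcomp (A \<otimes>\<^bsub>M\<^esub> A, m, A) (D.btens bE bE)) \<circ>\<^sub>d ?j" by simp
  then show ?thesis by (simp add: eh_def Fm_def Femb_def Fjoin_def A.emb_mi)
qed

lemma eh_Fi: "eh \<circ>\<^sub>d Fi = A.ihat"
proof -
  have "D.bcomp (D.bcomp bE (bmap bI)) bu = (\<one>\<^bsub>M\<^esub>, i, A)"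
    using iT_counit by (simp add: D.bdefs bmap_def bu_def)
  then have "D.emb (D.bcomp (D.bcomp bE (bmap bI)) bu) \<circ>\<^sub>d D.punit = D.emb (\<one>\<^bsub>M\<^esub>, i, A) \<circ>\<^sub>d D.punit" by simp
  then show ?thesis by (simp add: eh_def Fi_def Femb_def Fpunit_def A.emb_mi)
qed

lemma eh_Fm_wh:
  assumes "set k \<subseteq> Obj\<^bsub>M\<^esub>" "set r \<subseteq> Obj\<^bsub>M\<^esub>"
  shows "D.wh k eh r \<circ>\<^sub>d D.wh k Fm r = D.wh k A.mhat r \<circ>\<^sub>d D.wh k eh (A # r) \<circ>\<^sub>d D.wh (k @ [FT]) eh r"
    "D.wh k eh r \<circ>\<^sub>d D.wh k Fi r = D.wh k A.ihat r"
  using arg_cong[OF eh_Fm, of "\<lambda>f. D.wh k f r"] arg_cong[OF eh_Fi, of "\<lambda>f. D.wh k f r"] assms by simp_all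

text \<open>Injectivity of transposition in strict form: morphisms into \<open>Tr A\<close> are
  compared after \<Phi> and the counit, where computations take place in the strict category of
  \<open>M\<close>.\<close>

lemma eh_cancel:
  assumes "C.barr s" "C.barr t" "C.bdom s = C.bdom t" "C.bcod s = TA" "C.bcod t = TA"
    "eh \<circ>\<^sub>d Femb s = eh \<circ>\<^sub>d Femb t"
  shows "s = t"
proof -
  obtain c f where s: "s = (c, f, TA)" using assms(4) by (cases s) auto
  obtain g where t: "t = (c, g, TA)" using assms(3,5) s by (cases t) auto
  have f: "C.mor f c TA" and g: "C.mor g c TA" using assms(1,2) s t by (simp_all add: C.barr_def)
  have "D.emb (D.bcomp bE (bmap s)) = D.emb (D.bcomp bE (bmap t))"
    using assms by (simp add: eh_def Femb_def)
  then have "D.bcomp bE (bmap s) = D.bcomp bE (bmap t)"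
    by (rule D.emb_inject[rotated 4]) (use assms in simp_all)
  then have "\<epsilon> A \<cdot>\<^bsub>M\<^esub> fmor \<Phi> f = \<epsilon> A \<cdot>\<^bsub>M\<^esub> fmor \<Phi> g" by (simp add: s t D.bdefs bmap_def)
  then show ?thesis using transpose_inj[OF A.A_Obj f g] s t by simp
qed

text \<open>Each law is tested after \<Phi> and the counit. There \<open>eh_Fm\<close> and
  \<open>eh_Fi\<close> exchange the operations of \<open>Tr A\<close> for those of \<open>A\<close>,
  the law of \<open>A\<close> applies, and the same exchange is run backwards.\<close>

lemma tr_algebra: "algebra_object C TA mT iT"
proof
  let ?U = "D.wh [] (Funjoin TA TA) [FT] \<circ>\<^sub>d Funjoin (TA \<otimes>\<^bsub>C\<^esub> TA) TA"
  let ?u = "D.wh [] Funpunit [FT] \<circ>\<^sub>d Funjoin \<one>\<^bsub>C\<^esub> TA" and ?v = "D.wh [FT] Funpunit [] \<circ>\<^sub>d Funjoin TA \<one>\<^bsub>C\<^esub>"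
  let ?E = "D.wh [] eh [A, A] \<circ>\<^sub>d D.wh [FT] eh [A] \<circ>\<^sub>d D.wh [FT, FT] eh []"
  have "eh \<circ>\<^sub>d Femb (bM \<circ>\<^sub>b (bM \<otimes>\<^sub>b C.bid TA)) = (eh \<circ>\<^sub>d Fm) \<circ>\<^sub>d D.wh [] Fm [FT] \<circ>\<^sub>d ?U"
    by (simp add: Femb_mi)
  also have "\<dots> = A.mhat \<circ>\<^sub>d D.wh [] eh [A] \<circ>\<^sub>d (D.wh [FT] eh [] \<circ>\<^sub>d D.wh [] Fm [FT]) \<circ>\<^sub>d ?U"
    unfolding eh_Fm by simp
  also have "D.wh [FT] eh [] \<circ>\<^sub>d D.wh [] Fm [FT] = D.wh [] Fm [A] \<circ>\<^sub>d D.wh [FT, FT] eh []"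
    using D.interchange[of Fm eh "[]" "[]" "[]"] by simp
  also have "A.mhat \<circ>\<^sub>d D.wh [] eh [A] \<circ>\<^sub>d (D.wh [] Fm [A] \<circ>\<^sub>d D.wh [FT, FT] eh []) \<circ>\<^sub>d ?U
      = A.mhat \<circ>\<^sub>d (D.wh [] eh [A] \<circ>\<^sub>d D.wh [] Fm [A]) \<circ>\<^sub>d D.wh [FT, FT] eh [] \<circ>\<^sub>d ?U"
    by simp
  also have "\<dots> = (A.mhat \<circ>\<^sub>d D.wh [] A.mhat [A]) \<circ>\<^sub>d ?E \<circ>\<^sub>d ?U"
    using eh_Fm_wh(1)[of "[]" "[A]"] by simp
  also have "\<dots> = A.mhat \<circ>\<^sub>d (D.wh [A] A.mhat [] \<circ>\<^sub>d D.wh [] eh [A, A]) \<circ>\<^sub>d D.wh [FT] eh [A] \<circ>\<^sub>d D.wh [FT, FT] eh [] \<circ>\<^sub>d ?U"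
    unfolding A.mhat_assoc by simp
  also have "D.wh [A] A.mhat [] \<circ>\<^sub>d D.wh [] eh [A, A] = D.wh [] eh [A] \<circ>\<^sub>d D.wh [FT] A.mhat []"
    using D.interchange[of eh A.mhat "[]" "[]" "[]"] by simp
  also have "A.mhat \<circ>\<^sub>d (D.wh [] eh [A] \<circ>\<^sub>d D.wh [FT] A.mhat []) \<circ>\<^sub>d D.wh [FT] eh [A] \<circ>\<^sub>d D.wh [FT, FT] eh [] \<circ>\<^sub>d ?U
      = A.mhat \<circ>\<^sub>d D.wh [] eh [A] \<circ>\<^sub>d (D.wh [FT] A.mhat [] \<circ>\<^sub>d D.wh [FT] eh [A] \<circ>\<^sub>d D.wh [FT, FT] eh []) \<circ>\<^sub>d ?U"
    by simp
  also have "D.wh [FT] A.mhat [] \<circ>\<^sub>d D.wh [FT] eh [A] \<circ>\<^sub>d D.wh [FT, FT] eh [] = D.wh [FT] eh [] \<circ>\<^sub>d D.wh [FT] Fm []"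
    using eh_Fm_wh(1)[of "[FT]" "[]"] by simp
  also have "A.mhat \<circ>\<^sub>d D.wh [] eh [A] \<circ>\<^sub>d (D.wh [FT] eh [] \<circ>\<^sub>d D.wh [FT] Fm []) \<circ>\<^sub>d ?U
      = (A.mhat \<circ>\<^sub>d D.wh [] eh [A] \<circ>\<^sub>d D.wh [FT] eh []) \<circ>\<^sub>d D.wh [FT] Fm [] \<circ>\<^sub>d ?U"
    by simp
  also have "\<dots> = eh \<circ>\<^sub>d Fm \<circ>\<^sub>d D.wh [FT] Fm [] \<circ>\<^sub>d ?U"
    unfolding eh_Fm[symmetric] by simp
  also have "\<dots> = eh \<circ>\<^sub>d Femb ((bM \<circ>\<^sub>b (C.bid TA \<otimes>\<^sub>b bM)) \<circ>\<^sub>b C.bassoc TA TA TA)"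
    by (simp add: Femb_mi)
  finally have "bM \<circ>\<^sub>b (bM \<otimes>\<^sub>b C.bid TA) = (bM \<circ>\<^sub>b (C.bid TA \<otimes>\<^sub>b bM)) \<circ>\<^sub>b C.bassoc TA TA TA"
    by (rule eh_cancel[rotated 5]) simp_all
  then show "mT \<cdot>\<^bsub>C\<^esub> (mT \<odot>\<^bsub>C\<^esub> idm\<^bsub>C\<^esub> TA) = mT \<cdot>\<^bsub>C\<^esub> (idm\<^bsub>C\<^esub> TA \<odot>\<^bsub>C\<^esub> mT) \<cdot>\<^bsub>C\<^esub> \<a>\<^bsub>C\<^esub> TA TA TA"
    by (simp add: C.bdefs)
  have "eh \<circ>\<^sub>d Femb (bM \<circ>\<^sub>b (bI \<otimes>\<^sub>b C.bid TA)) = (eh \<circ>\<^sub>d Fm) \<circ>\<^sub>d D.wh [] Fi [FT] \<circ>\<^sub>d ?u"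
    by (simp add: Femb_mi)
  also have "\<dots> = A.mhat \<circ>\<^sub>d D.wh [] eh [A] \<circ>\<^sub>d (D.wh [FT] eh [] \<circ>\<^sub>d D.wh [] Fi [FT]) \<circ>\<^sub>d ?u"
    unfolding eh_Fm by simp
  also have "D.wh [FT] eh [] \<circ>\<^sub>d D.wh [] Fi [FT] = D.wh [] Fi [A] \<circ>\<^sub>d eh"
    using D.interchange[of Fi eh "[]" "[]" "[]"] by simp
  also have "A.mhat \<circ>\<^sub>d D.wh [] eh [A] \<circ>\<^sub>d (D.wh [] Fi [A] \<circ>\<^sub>d eh) \<circ>\<^sub>d ?u
      = A.mhat \<circ>\<^sub>d (D.wh [] eh [A] \<circ>\<^sub>d D.wh [] Fi [A]) \<circ>\<^sub>d eh \<circ>\<^sub>d ?u"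
    by simp
  also have "\<dots> = (A.mhat \<circ>\<^sub>d D.wh [] A.ihat [A]) \<circ>\<^sub>d eh \<circ>\<^sub>d ?u"
    using eh_Fm_wh(2)[of "[]" "[A]"] by simp
  also have "\<dots> = eh \<circ>\<^sub>d Femb (C.blunit TA)" unfolding A.mhat_unit by simp
  finally have "bM \<circ>\<^sub>b (bI \<otimes>\<^sub>b C.bid TA) = C.blunit TA"
    by (rule eh_cancel[rotated 5]) simp_all
  then show "mT \<cdot>\<^bsub>C\<^esub> (iT \<odot>\<^bsub>C\<^esub> idm\<^bsub>C\<^esub> TA) = \<l>\<^bsub>C\<^esub> TA" by (simp add: C.bdefs)
  have "eh \<circ>\<^sub>d Femb (bM \<circ>\<^sub>b (C.bid TA \<otimes>\<^sub>b bI)) = (eh \<circ>\<^sub>d Fm) \<circ>\<^sub>d D.wh [FT] Fi [] \<circ>\<^sub>d ?v"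
    by (simp add: Femb_mi)
  also have "\<dots> = A.mhat \<circ>\<^sub>d D.wh [] eh [A] \<circ>\<^sub>d (D.wh [FT] eh [] \<circ>\<^sub>d D.wh [FT] Fi []) \<circ>\<^sub>d ?v"
    unfolding eh_Fm by simp
  also have "\<dots> = A.mhat \<circ>\<^sub>d (D.wh [] eh [A] \<circ>\<^sub>d D.wh [FT] A.ihat []) \<circ>\<^sub>d ?v"
    using eh_Fm_wh(2)[of "[FT]" "[]"] by simp
  also have "D.wh [] eh [A] \<circ>\<^sub>d D.wh [FT] A.ihat [] = D.wh [A] A.ihat [] \<circ>\<^sub>d eh"
    using D.interchange[of eh A.ihat "[]" "[]" "[]"] by simp
  also have "A.mhat \<circ>\<^sub>d (D.wh [A] A.ihat [] \<circ>\<^sub>d eh) \<circ>\<^sub>d ?v = (A.mhat \<circ>\<^sub>d D.wh [A] A.ihat []) \<circ>\<^sub>d eh \<circ>\<^sub>d ?v"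
    by simp
  also have "\<dots> = eh \<circ>\<^sub>d Femb (C.brunit TA)" unfolding A.mhat_unit by simp
  finally have "bM \<circ>\<^sub>b (C.bid TA \<otimes>\<^sub>b bI) = C.brunit TA"
    by (rule eh_cancel[rotated 5]) simp_all
  then show "mT \<cdot>\<^bsub>C\<^esub> (idm\<^bsub>C\<^esub> TA \<odot>\<^bsub>C\<^esub> iT) = \<r>\<^bsub>C\<^esub> TA" by (simp add: C.bdefs)
qed (use mor_mT mor_iT in \<open>simp_all add: C.mor_def\<close>)

sublocale T: algebra_object C TA mT iT
  by (rule tr_algebra)

text \<open>Transposition, with \<open>\<Phi> \<one>\<close> identified with the unit by the unitor,
  is linear and injective in both directions; each direction gives one inequality.\<close>

lemma dim_Hom_unit: "C.dim (Hom\<^bsub>C\<^esub> \<one>\<^bsub>C\<^esub> TA) = D.dim (Hom\<^bsub>M\<^esub> \<one>\<^bsub>M\<^esub> A)"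
proof (rule antisym)
  interpret CM: vector_space_pair "scale C" "scale M" ..
  interpret MC: vector_space_pair "scale M" "scale C" ..
  note u = mor_unitor_inv and e = mor_counit[OF A.A_Obj]
  have HC: "C.mor f \<one>\<^bsub>C\<^esub> TA" if "f \<in> Hom\<^bsub>C\<^esub> \<one>\<^bsub>C\<^esub> TA" for f using that by (simp add: C.mor_def)
  have HM: "D.mor f \<one>\<^bsub>M\<^esub> A" if "f \<in> Hom\<^bsub>M\<^esub> \<one>\<^bsub>M\<^esub> A" for f using that by (simp add: D.mor_def)
  obtain B where B: "finite B" "C.span B = Hom\<^bsub>C\<^esub> \<one>\<^bsub>C\<^esub> TA" using C.Hom_finite_dim[OF C.unit_Obj TA_Obj] by metis
  obtain B' where B': "finite B'" "D.span B' = Hom\<^bsub>M\<^esub> \<one>\<^bsub>M\<^esub> A" using D.Hom_finite_dim[OF D.unit_Obj A.A_Obj] by metis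
  let ?f = "\<lambda>f. \<epsilon> A \<cdot>\<^bsub>M\<^esub> fmor \<Phi> f \<cdot>\<^bsub>M\<^esub> unitor \<Phi>"
  have eF: "D.mor (\<epsilon> A \<cdot>\<^bsub>M\<^esub> fmor \<Phi> f) (fobj \<Phi> \<one>\<^bsub>C\<^esub>) A" if "C.mor f \<one>\<^bsub>C\<^esub> TA" for f
    using e F_mor[OF that] by (rule D.mor_comp)
  show "C.dim (Hom\<^bsub>C\<^esub> \<one>\<^bsub>C\<^esub> TA) \<le> D.dim (Hom\<^bsub>M\<^esub> \<one>\<^bsub>M\<^esub> A)"
  proof (rule CM.dim_le_of_injective[OF C.Hom_subspace[OF C.unit_Obj TA_Obj] B', of ?f])
    fix f g c assume f: "f \<in> Hom\<^bsub>C\<^esub> \<one>\<^bsub>C\<^esub> TA"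
    note f' = HC[OF f]
    show "?f f \<in> Hom\<^bsub>M\<^esub> \<one>\<^bsub>M\<^esub> A" using D.mor_Hom[OF D.mor_comp[OF eF[OF f'] u(1)]] .
    show "?f (scale C c f) = scale M c (?f f)"
      using fmor_scale[OF C.unit_Obj TA_Obj f] D.m_scale(2)[OF e F_mor[OF f']] D.m_scale(1)[OF eF[OF f'] u(1)]
      by simp
    show "f = 0" if "?f f = 0"
    proof -
      have "?f f \<cdot>\<^bsub>M\<^esub> unitor_inv = \<epsilon> A \<cdot>\<^bsub>M\<^esub> fmor \<Phi> f"
        using D.m_assoc[OF eF[OF f'] u(1,2)] u(4) D.m_id(2)[OF eF[OF f']] by simp
      then have "\<epsilon> A \<cdot>\<^bsub>M\<^esub> fmor \<Phi> f = 0" using that D.m_zero(1)[OF u(2) A.A_Obj] by simp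
      moreover have "fmor \<Phi> 0 = 0"
        using fmor_scale[OF C.unit_Obj TA_Obj f, of 0] by simp
      ultimately show "f = 0"
        using transpose_inj[OF A.A_Obj f' C.mor_zero[OF C.unit_Obj TA_Obj]]
          D.m_zero(2)[OF e, of "fobj \<Phi> \<one>\<^bsub>C\<^esub>"] by simp
    qed
    assume g: "g \<in> Hom\<^bsub>C\<^esub> \<one>\<^bsub>C\<^esub> TA"
    show "?f (f + g) = ?f f + ?f g"
      using fmor_add[OF C.unit_Obj TA_Obj f g] D.m_add(2)[OF e F_mor[OF f'] F_mor[OF HC[OF g]]]
        D.m_add(1)[OF eF[OF f'] eF[OF HC[OF g]] u(1)] by simp
  qed
  let ?g = "\<lambda>g. fmor Tr (g \<cdot>\<^bsub>M\<^esub> unitor_inv) \<cdot>\<^bsub>C\<^esub> \<eta> \<one>\<^bsub>C\<^esub>"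
  have gu: "D.mor (g \<cdot>\<^bsub>M\<^esub> unitor_inv) (fobj \<Phi> \<one>\<^bsub>C\<^esub>) A" if "D.mor g \<one>\<^bsub>M\<^esub> A" for g
    using that u(2) by (rule D.mor_comp)
  have F1: "fobj \<Phi> \<one>\<^bsub>C\<^esub> \<in> Obj\<^bsub>M\<^esub>" by simp
  note n = mor_unit[OF C.unit_Obj]
  show "D.dim (Hom\<^bsub>M\<^esub> \<one>\<^bsub>M\<^esub> A) \<le> C.dim (Hom\<^bsub>C\<^esub> \<one>\<^bsub>C\<^esub> TA)"
  proof (rule MC.dim_le_of_injective[OF D.Hom_subspace[OF D.unit_Obj A.A_Obj] B, of ?g])
    fix f g c assume f: "f \<in> Hom\<^bsub>M\<^esub> \<one>\<^bsub>M\<^esub> A"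
    note f' = gu[OF HM[OF f]]
    note s = transpose_surj[OF C.unit_Obj f']
    show "?g f \<in> Hom\<^bsub>C\<^esub> \<one>\<^bsub>C\<^esub> TA" using C.mor_Hom[OF s(1)] .
    show "?g (scale M c f) = scale C c (?g f)"
      using D.m_scale(1)[OF HM[OF f] u(2)] G.fmor_scale[OF F1 A.A_Obj D.mor_Hom[OF f']]
        C.m_scale(1)[OF Tr_mor[OF f'] n] by simp
    show "f = 0" if "?g f = 0"
    proof -
      have "fmor \<Phi> 0 = 0" using fmor_scale[OF C.unit_Obj TA_Obj C.mor_Hom[OF s(1)], of 0] by simp
      then have "f \<cdot>\<^bsub>M\<^esub> unitor_inv = 0"
        using s(2) that D.m_zero(2)[OF e, of "fobj \<Phi> \<one>\<^bsub>C\<^esub>"] by simp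
      then show "f = 0"
        using D.m_assoc[OF HM[OF f] u(2,1)] u(3) D.m_id(2)[OF HM[OF f]] D.m_zero(1)[OF u(1) A.A_Obj] by simp
    qed
    assume g: "g \<in> Hom\<^bsub>M\<^esub> \<one>\<^bsub>M\<^esub> A"
    note g' = gu[OF HM[OF g]]
    show "?g (f + g) = ?g f + ?g g"
      using D.m_add(1)[OF HM[OF f] HM[OF g] u(2)] G.fmor_add[OF F1 A.A_Obj D.mor_Hom[OF f'] D.mor_Hom[OF g']]
        C.m_add(1)[OF Tr_mor[OF f'] Tr_mor[OF g'] n] by simp
  qed
qed

text \<open>The projection formula \<open>Hom d (Tr A \<otimes> c) \<cong> Hom (\<Phi> d) (A \<otimes> \<Phi> c)\<close>.\<close>

definition proj :: "'o \<Rightarrow> 'm \<Rightarrow> 'n" where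
  "proj c f = (\<epsilon> A \<odot>\<^bsub>M\<^esub> idm\<^bsub>M\<^esub> (fobj \<Phi> c)) \<cdot>\<^bsub>M\<^esub> (tens_inv TA c \<cdot>\<^bsub>M\<^esub> fmor \<Phi> f)"

text \<open>\<open>proj c f\<close> with its target kept as the list \<open>[A, \<Phi> c]\<close>,
  so that it composes with whiskered arrows without bracketing.\<close>

definition projh :: "'o \<Rightarrow> 'o \<Rightarrow> 'm \<Rightarrow> 'p list \<times> ('p \<Rightarrow> 'n) \<times> 'p list" where
  "projh d c f = D.wh [] eh [fobj \<Phi> c] \<circ>\<^sub>d Funjoin TA c \<circ>\<^sub>d Femb (d, f, TA \<otimes>\<^bsub>C\<^esub> c)"

lemma bproj: "(fobj \<Phi> d, proj c f, A \<otimes>\<^bsub>M\<^esub> fobj \<Phi> c)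
    = D.bcomp (D.btens bE (D.bid (fobj \<Phi> c))) (D.bcomp (bt' TA c) (bmap (d, f, TA \<otimes>\<^bsub>C\<^esub> c)))"
  by (simp add: proj_def D.bdefs bmap_def bt'_def)

lemma proj_simps:
  assumes c [simp]: "c \<in> Obj\<^bsub>C\<^esub>" and f: "C.mor f d (TA \<otimes>\<^bsub>C\<^esub> c)"
  shows "D.mor (proj c f) (fobj \<Phi> d) (A \<otimes>\<^bsub>M\<^esub> fobj \<Phi> c)"
    "D.emb (fobj \<Phi> d, proj c f, A \<otimes>\<^bsub>M\<^esub> fobj \<Phi> c) = D.join A (fobj \<Phi> c) \<circ>\<^sub>d projh d c f"
    "D.sarr (projh d c f)" "D.sdom (projh d c f) = [fobj \<Phi> d]" "D.scod (projh d c f) = [A, fobj \<Phi> c]"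
proof -
  have d [simp]: "d \<in> Obj\<^bsub>C\<^esub>" using f by (simp add: C.mor_def)
  have "D.barr (fobj \<Phi> d, proj c f, A \<otimes>\<^bsub>M\<^esub> fobj \<Phi> c)" unfolding bproj using f by simp
  then show "D.mor (proj c f) (fobj \<Phi> d) (A \<otimes>\<^bsub>M\<^esub> fobj \<Phi> c)" by (simp add: D.barr_def)
  show "D.emb (fobj \<Phi> d, proj c f, A \<otimes>\<^bsub>M\<^esub> fobj \<Phi> c) = D.join A (fobj \<Phi> c) \<circ>\<^sub>d projh d c f"
    unfolding bproj using f by (simp add: projh_def eh_def Femb_def Funjoin_def)
  show "D.sarr (projh d c f)" "D.sdom (projh d c f) = [fobj \<Phi> d]" "D.scod (projh d c f) = [A, fobj \<Phi> c]"
    using f by (simp_all add: projh_def)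
qed

text \<open>Multiplicativity of the counit is the whole reason: \<open>eh_Fm\<close> replaces
  \<open>mT\<close> by \<open>m\<close> preceded by two counits. One counit completes
  \<open>projh b c g\<close>, and interchange slides the other past it to complete
  \<open>projh d b h\<close>.\<close>

lemma proj_kleisli:
  assumes b [simp]: "b \<in> Obj\<^bsub>C\<^esub>" and c [simp]: "c \<in> Obj\<^bsub>C\<^esub>"
    and h: "C.mor h d (TA \<otimes>\<^bsub>C\<^esub> b)" and g: "C.mor g b (TA \<otimes>\<^bsub>C\<^esub> c)"
  shows "proj c (T.kleisli c g h) = A.kleisli (fobj \<Phi> c) (proj c g) (proj b h)"
proof -
  have d [simp]: "d \<in> Obj\<^bsub>C\<^esub>" using h by (simp add: C.mor_def)
  let ?h = "(d, h, TA \<otimes>\<^bsub>C\<^esub> b)" and ?g = "(b, g, TA \<otimes>\<^bsub>C\<^esub> c)"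
  note [simp] = proj_simps[OF c g] proj_simps[OF b h]
  have hg [simp]: "C.barr ?h" "C.barr ?g" using h g by simp_all
  have bk: "(d, T.kleisli c g h, TA \<otimes>\<^bsub>C\<^esub> c)
      = ((bM \<otimes>\<^sub>b C.bid c) \<circ>\<^sub>b C.bassoc' TA TA c) \<circ>\<^sub>b (C.bid TA \<otimes>\<^sub>b ?g) \<circ>\<^sub>b ?h"
    by (simp add: T.kleisli_def T.fmult_def C.bdefs)
  have kh: "C.mor (T.kleisli c g h) d (TA \<otimes>\<^bsub>C\<^esub> c)" using h g by (rule T.mor_kleisli) simp
  let ?P = "(fobj \<Phi> d, proj b h, A \<otimes>\<^bsub>M\<^esub> fobj \<Phi> b)" and ?Q = "(fobj \<Phi> b, proj c g, A \<otimes>\<^bsub>M\<^esub> fobj \<Phi> c)"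
  have bk': "(fobj \<Phi> d, A.kleisli (fobj \<Phi> c) (proj c g) (proj b h), A \<otimes>\<^bsub>M\<^esub> fobj \<Phi> c)
      = D.bcomp (D.bcomp (D.btens (A \<otimes>\<^bsub>M\<^esub> A, m, A) (D.bid (fobj \<Phi> c))) (D.bassoc' A A (fobj \<Phi> c)))
          (D.bcomp (D.btens (D.bid A) ?Q) ?P)"
    by (simp add: A.kleisli_def A.fmult_def D.bdefs)
  have "projh d c (T.kleisli c g h) = (D.wh [] eh [fobj \<Phi> c] \<circ>\<^sub>d D.wh [] Fm [fobj \<Phi> c])
      \<circ>\<^sub>d D.wh [FT] (Funjoin TA c) [] \<circ>\<^sub>d D.wh [FT] (Femb ?g) [] \<circ>\<^sub>d Funjoin TA b \<circ>\<^sub>d Femb ?h"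
    unfolding projh_def bk by (simp add: Femb_mi)
  also have "\<dots> = D.wh [] A.mhat [fobj \<Phi> c] \<circ>\<^sub>d (D.wh [] eh [A, fobj \<Phi> c] \<circ>\<^sub>d D.wh [FT] (projh b c g) [])
      \<circ>\<^sub>d Funjoin TA b \<circ>\<^sub>d Femb ?h"
    using eh_Fm_wh(1)[of "[]" "[fobj \<Phi> c]"] by (simp add: projh_def)
  also have "D.wh [] eh [A, fobj \<Phi> c] \<circ>\<^sub>d D.wh [FT] (projh b c g) []
      = D.wh [A] (projh b c g) [] \<circ>\<^sub>d D.wh [] eh [fobj \<Phi> b]"
    using D.interchange[of eh "projh b c g" "[]" "[]" "[]"] by simp
  also have "D.wh [] A.mhat [fobj \<Phi> c] \<circ>\<^sub>d (D.wh [A] (projh b c g) [] \<circ>\<^sub>d D.wh [] eh [fobj \<Phi> b])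
      \<circ>\<^sub>d Funjoin TA b \<circ>\<^sub>d Femb ?h
     = D.wh [] A.mhat [fobj \<Phi> c] \<circ>\<^sub>d D.wh [A] (projh b c g) [] \<circ>\<^sub>d projh d b h"
    by (simp add: projh_def[of d b])
  finally have "D.emb (fobj \<Phi> d, proj c (T.kleisli c g h), A \<otimes>\<^bsub>M\<^esub> fobj \<Phi> c)
      = D.emb (fobj \<Phi> d, A.kleisli (fobj \<Phi> c) (proj c g) (proj b h), A \<otimes>\<^bsub>M\<^esub> fobj \<Phi> c)"
    unfolding proj_simps(2)[OF c kh] bk' by (simp add: A.emb_mi)
  then have "(fobj \<Phi> d, proj c (T.kleisli c g h), A \<otimes>\<^bsub>M\<^esub> fobj \<Phi> c)
      = (fobj \<Phi> d, A.kleisli (fobj \<Phi> c) (proj c g) (proj b h), A \<otimes>\<^bsub>M\<^esub> fobj \<Phi> c)"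
    by (rule D.emb_inject[rotated 4])
      (use proj_simps(1)[OF c kh] A.mor_kleisli[of "proj b h" "fobj \<Phi> d" "fobj \<Phi> b" "proj c g" "fobj \<Phi> c"] in simp_all)
  then show ?thesis by simp
qed

text \<open>Bending \<open>c\<close> down and transposing agrees with applying \<open>proj\<close>
  and bending \<open>\<Phi> c\<close> down in \<open>M\<close>. This reduces bijectivity of
  \<open>proj\<close> to that of transposition and of bending.\<close>

lemma Femb_sharp:
  assumes "C.is_dual z c e k" and f: "C.mor f d (TA \<otimes>\<^bsub>C\<^esub> c)"
  shows "eh \<circ>\<^sub>d Femb (d \<otimes>\<^bsub>C\<^esub> z, C.sharp z c e TA f, TA)
    = D.wh [A] (Fev z c e) [] \<circ>\<^sub>d D.wh [] (projh d c f) [fobj \<Phi> z] \<circ>\<^sub>d Funjoin d z"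
proof -
  have O [simp]: "z \<in> Obj\<^bsub>C\<^esub>" "c \<in> Obj\<^bsub>C\<^esub>" "d \<in> Obj\<^bsub>C\<^esub>"
    and [simp]: "C.mor e (c \<otimes>\<^bsub>C\<^esub> z) \<one>\<^bsub>C\<^esub>" "C.barr (d, f, TA \<otimes>\<^bsub>C\<^esub> c)"
    using assms by (auto simp: C.is_dual_iff C.mor_def)
  let ?R = "D.wh [] (Funjoin TA c) [fobj \<Phi> z] \<circ>\<^sub>d D.wh [] (Femb (d, f, TA \<otimes>\<^bsub>C\<^esub> c)) [fobj \<Phi> z] \<circ>\<^sub>d Funjoin d z"
  have "eh \<circ>\<^sub>d Femb (d \<otimes>\<^bsub>C\<^esub> z, C.sharp z c e TA f, TA) = (eh \<circ>\<^sub>d D.wh [FT] (Fev z c e) []) \<circ>\<^sub>d ?R"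
    unfolding C.bsharp by (simp add: Femb_ev)
  also have "eh \<circ>\<^sub>d D.wh [FT] (Fev z c e) [] = D.wh [A] (Fev z c e) [] \<circ>\<^sub>d D.wh [] eh [fobj \<Phi> c, fobj \<Phi> z]"
    using D.interchange[of eh "Fev z c e" "[]" "[]" "[]"] by simp
  finally show ?thesis by (simp add: projh_def)
qed

text \<open>Bending \<open>\<Phi> c\<close> down and up again is undone by the zig-zag of the image
  of the dual pair, after interchange has moved \<open>g\<close> out of the way.\<close>

lemma F_flat:
  assumes "C.is_dual z c e k" and [simp]: "D.sarr g" "D.sdom g = [x]" "D.scod g = [y, fobj \<Phi> c]"
    "x \<in> Obj\<^bsub>M\<^esub>" "y \<in> Obj\<^bsub>M\<^esub>"
  shows "D.wh [] (D.wh [y] (Fev z c e) [] \<circ>\<^sub>d D.wh [] g [fobj \<Phi> z]) [fobj \<Phi> c]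
    \<circ>\<^sub>d D.wh [x] (Fcoev z c k) [] = g"
proof -
  have O [simp]: "z \<in> Obj\<^bsub>C\<^esub>" "c \<in> Obj\<^bsub>C\<^esub>"
    and [simp]: "C.mor e (c \<otimes>\<^bsub>C\<^esub> z) \<one>\<^bsub>C\<^esub>" "C.mor k \<one>\<^bsub>C\<^esub> (z \<otimes>\<^bsub>C\<^esub> c)"
    using assms by (auto simp: C.is_dual_iff)
  have "D.wh [] (D.wh [y] (Fev z c e) [] \<circ>\<^sub>d D.wh [] g [fobj \<Phi> z]) [fobj \<Phi> c] \<circ>\<^sub>d D.wh [x] (Fcoev z c k) []
     = D.wh [y] (Fev z c e) [fobj \<Phi> c] \<circ>\<^sub>d (D.wh [] g [fobj \<Phi> z, fobj \<Phi> c] \<circ>\<^sub>d D.wh [x] (Fcoev z c k) [])"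
    by simp
  also have "D.wh [] g [fobj \<Phi> z, fobj \<Phi> c] \<circ>\<^sub>d D.wh [x] (Fcoev z c k) [] = D.wh [y, fobj \<Phi> c] (Fcoev z c k) [] \<circ>\<^sub>d g"
    using D.interchange[of g "Fcoev z c k" "[]" "[]" "[]"] by simp
  also have "D.wh [y] (Fev z c e) [fobj \<Phi> c] \<circ>\<^sub>d D.wh [y, fobj \<Phi> c] (Fcoev z c k) [] \<circ>\<^sub>d g
      = D.wh [y] (D.wh [] (Fev z c e) [fobj \<Phi> c] \<circ>\<^sub>d D.wh [fobj \<Phi> c] (Fcoev z c k) []) [] \<circ>\<^sub>d g"
    by simp
  also have "\<dots> = g" unfolding Fdual[OF assms(1)] by simp
  finally show ?thesis .
qed

lemma proj_inj:
  assumes dual: "C.is_dual z c e k" and f: "C.mor f d (TA \<otimes>\<^bsub>C\<^esub> c)" "C.mor f' d (TA \<otimes>\<^bsub>C\<^esub> c)"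
    and eq: "proj c f = proj c f'"
  shows "f = f'"
proof -
  have O [simp]: "z \<in> Obj\<^bsub>C\<^esub>" "c \<in> Obj\<^bsub>C\<^esub>" "d \<in> Obj\<^bsub>C\<^esub>"
    using dual f by (auto simp: C.is_dual_iff C.mor_def)
  note p = proj_simps[OF O(2) f(1)] and p' = proj_simps[OF O(2) f(2)]
  have "D.unjoin A (fobj \<Phi> c) \<circ>\<^sub>d D.join A (fobj \<Phi> c) \<circ>\<^sub>d projh d c f
      = D.unjoin A (fobj \<Phi> c) \<circ>\<^sub>d D.join A (fobj \<Phi> c) \<circ>\<^sub>d projh d c f'"
    using p(2) p'(2) eq by simp
  then have "projh d c f = projh d c f'" using p p' by simp
  then have "(d \<otimes>\<^bsub>C\<^esub> z, C.sharp z c e TA f, TA) = (d \<otimes>\<^bsub>C\<^esub> z, C.sharp z c e TA f', TA)"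
    using Femb_sharp[OF dual f(1)] Femb_sharp[OF dual f(2)] C.sharp_flat(1)[OF dual TA_Obj] f
    by (intro eh_cancel) simp_all
  then have "C.sharp z c e TA f = C.sharp z c e TA f'" by simp
  then show ?thesis using C.sharp_flat(3)[OF dual TA_Obj f(1)] C.sharp_flat(3)[OF dual TA_Obj f(2)] by argo
qed

lemma proj_surj:
  assumes dual: "C.is_dual z c e k" and d [simp]: "d \<in> Obj\<^bsub>C\<^esub>" and g: "D.mor g (fobj \<Phi> d) (A \<otimes>\<^bsub>M\<^esub> fobj \<Phi> c)"
  shows "\<exists>f. C.mor f d (TA \<otimes>\<^bsub>C\<^esub> c) \<and> proj c f = g"
proof -
  have O [simp]: "z \<in> Obj\<^bsub>C\<^esub>" "c \<in> Obj\<^bsub>C\<^esub>" and e [simp]: "C.mor e (c \<otimes>\<^bsub>C\<^esub> z) \<one>\<^bsub>C\<^esub>"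
    using dual by (auto simp: C.is_dual_iff)
  let ?e = "(c \<otimes>\<^bsub>C\<^esub> z, e, \<one>\<^bsub>C\<^esub>)" and ?g = "(fobj \<Phi> d, g, A \<otimes>\<^bsub>M\<^esub> fobj \<Phi> c)"
  \<comment> \<open>The pairing of \<open>\<Phi> c\<close> with \<open>\<Phi> z\<close> obtained
    from \<open>e\<close>. Bending \<open>\<Phi> c\<close> down in \<open>g\<close> with it gives
    \<open>?\<beta>\<close>, a morphism from \<open>\<Phi> (d \<otimes> z)\<close> to
    \<open>A\<close> that can be transposed.\<close>
  let ?ev = "D.bcomp bu' (D.bcomp (bmap ?e) (bt c z))"
  let ?\<beta> = "D.bcomp (D.brunit A) (D.bcomp (D.btens (D.bid A) ?ev)
    (D.bcomp (D.bassoc A (fobj \<Phi> c) (fobj \<Phi> z)) (D.bcomp (D.btens ?g (D.bid (fobj \<Phi> z))) (bt' d z))))"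
  have [simp]: "D.barr ?g" using g by simp
  have \<beta>: "D.barr ?\<beta>" "D.bdom ?\<beta> = fobj \<Phi> (d \<otimes>\<^bsub>C\<^esub> z)" "D.bcod ?\<beta> = A" by simp_all
  obtain \<beta> where \<beta>_eq: "?\<beta> = (fobj \<Phi> (d \<otimes>\<^bsub>C\<^esub> z), \<beta>, A)"
    using \<beta>(2,3) by (metis D.bdom_simps(1) D.bcod_simps(1) prod_cases3)
  have \<beta>': "D.mor \<beta> (fobj \<Phi> (d \<otimes>\<^bsub>C\<^esub> z)) A" using \<beta>(1) unfolding \<beta>_eq by (simp add: D.barr_def)
  let ?gh = "D.unjoin A (fobj \<Phi> c) \<circ>\<^sub>d D.emb ?g"
  have emb\<beta>: "D.emb ?\<beta> = D.wh [A] (Fev z c e) [] \<circ>\<^sub>d D.wh [] ?gh [fobj \<Phi> z] \<circ>\<^sub>d Funjoin d z"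
    by (simp add: Fev_def Femb_def Funpunit_def Fjoin_def Funjoin_def)
  have dz: "d \<otimes>\<^bsub>C\<^esub> z \<in> Obj\<^bsub>C\<^esub>" by simp
  \<comment> \<open>The transpose of the bent \<open>g\<close>; bending \<open>c\<close> back up in
    \<open>C\<close> by \<open>flat\<close> then gives the preimage of \<open>g\<close>.\<close>
  define f0 where "f0 = fmor Tr \<beta> \<cdot>\<^bsub>C\<^esub> \<eta> (d \<otimes>\<^bsub>C\<^esub> z)"
  have f0: "C.mor f0 (d \<otimes>\<^bsub>C\<^esub> z) TA" "\<epsilon> A \<cdot>\<^bsub>M\<^esub> fmor \<Phi> f0 = \<beta>"
    using transpose_surj[OF dz \<beta>'] by (simp_all add: f0_def)
  define f where "f = C.flat z c k d f0"
  have f: "C.mor f d (TA \<otimes>\<^bsub>C\<^esub> c)" "C.sharp z c e TA f = f0"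
    using C.sharp_flat(2,4)[OF dual TA_Obj f0(1) d] by (simp_all add: f_def)
  note p = proj_simps[OF O(2) f(1)]
  have "D.emb ?\<beta> = eh \<circ>\<^sub>d Femb (d \<otimes>\<^bsub>C\<^esub> z, f0, TA)"
  proof -
    have "?\<beta> = D.bcomp bE (bmap (d \<otimes>\<^bsub>C\<^esub> z, f0, TA))"
      unfolding \<beta>_eq f0(2)[symmetric] by (simp add: D.bcomp_def bmap_def)
    then show ?thesis using f0(1) by (simp add: eh_def Femb_def)
  qed
  also have "\<dots> = D.wh [A] (Fev z c e) [] \<circ>\<^sub>d D.wh [] (projh d c f) [fobj \<Phi> z] \<circ>\<^sub>d Funjoin d z"
    using Femb_sharp[OF dual f(1)] f(2) by simp
  finally have "(D.wh [A] (Fev z c e) [] \<circ>\<^sub>d D.wh [] ?gh [fobj \<Phi> z]) \<circ>\<^sub>d Funjoin d z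
      = (D.wh [A] (Fev z c e) [] \<circ>\<^sub>d D.wh [] (projh d c f) [fobj \<Phi> z]) \<circ>\<^sub>d Funjoin d z"
    unfolding emb\<beta> using p by simp
  then have "D.wh [A] (Fev z c e) [] \<circ>\<^sub>d D.wh [] ?gh [fobj \<Phi> z]
      = D.wh [A] (Fev z c e) [] \<circ>\<^sub>d D.wh [] (projh d c f) [fobj \<Phi> z]"
    by (rule D.scomp_eq_cancel[where v = "Fjoin d z"]) (use p in simp_all)
  then have "?gh = projh d c f"
    using F_flat[OF dual, of ?gh "fobj \<Phi> d" A] F_flat[OF dual, of "projh d c f" "fobj \<Phi> d" A] p by simp
  then have "D.emb (fobj \<Phi> d, proj c f, A \<otimes>\<^bsub>M\<^esub> fobj \<Phi> c) = D.emb ?g"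
    unfolding p(2) by (simp flip: \<open>?gh = projh d c f\<close>)
  then have "(fobj \<Phi> d, proj c f, A \<otimes>\<^bsub>M\<^esub> fobj \<Phi> c) = ?g"
    by (rule D.emb_inject[rotated 4]) (use p in simp_all)
  then show ?thesis using f(1) by auto
qed

text \<open>A quasi-inverse of \<open>proj b h\<close> lifts along the surjective
  \<open>proj c\<close>, and its equation descends along the injective \<open>proj b\<close>. The
  first needs \<open>c\<close>, the second \<open>b\<close>, to be a dual of some object.\<close>

lemma tr_kleisli_regular:
  assumes K: "\<And>c b h. \<lbrakk>b \<in> Obj\<^bsub>M\<^esub>; D.mor h c (A \<otimes>\<^bsub>M\<^esub> b)\<rbrakk> \<Longrightarrow> A.kleisli_regular c b h"
    and C: "rigid_tensor_category C" and b: "b \<in> Obj\<^bsub>C\<^esub>" and h: "C.mor h c (TA \<otimes>\<^bsub>C\<^esub> b)"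
  shows "T.kleisli_regular c b h"
proof -
  have c: "c \<in> Obj\<^bsub>C\<^esub>" using h by (simp add: C.mor_def)
  interpret R: rigid_tensor_category C by (rule C)
  obtain z e k where zb: "C.is_dual z b e k" using R.has_left_dual[OF b] by blast
  obtain z' e' k' where zc: "C.is_dual z' c e' k'" using R.has_left_dual[OF c] by blast
  obtain g' where g': "D.mor g' (fobj \<Phi> b) (A \<otimes>\<^bsub>M\<^esub> fobj \<Phi> c)"
    "A.kleisli (fobj \<Phi> b) (proj b h) (A.kleisli (fobj \<Phi> c) g' (proj b h)) = proj b h"
    using K[OF F_Obj[OF b] proj_simps(1)[OF b h]] by (auto simp: A.kleisli_regular_def)
  obtain g where g: "C.mor g b (TA \<otimes>\<^bsub>C\<^esub> c)" "proj c g = g'" using proj_surj[OF zc b g'(1)] by blast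
  have k: "C.mor (T.kleisli c g h) c (TA \<otimes>\<^bsub>C\<^esub> c)" using T.mor_kleisli[OF h g(1) c] .
  have "proj b (T.kleisli b h (T.kleisli c g h)) = proj b h"
    using proj_kleisli[OF c b k h] proj_kleisli[OF b c h g(1)] g(2) g'(2) by simp
  then have "T.kleisli b h (T.kleisli c g h) = h"
    by (rule proj_inj[OF zb T.mor_kleisli[OF k h b] h])
  then show ?thesis using g(1) by (auto simp: T.kleisli_regular_def)
qed

end

section \<open>Connected semisimple algebras are Frobenius\<close>

context vector_space
begin

lemma dim_one_scale:
  assumes "finite B0" "span B0 = V" "dim V = 1" "v \<in> V" "v \<noteq> 0" "w \<in> V"
  shows "\<exists>c. w = scale c v"
proof (rule ccontr)
  assume n: "\<nexists>c. w = scale c v"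
  then have "w \<notin> span {v}" by (auto simp: span_singleton)
  moreover have "independent {v}" using assms(5) by simp
  ultimately have "independent {w, v}" by (rule independent_insertI)
  moreover have "{w, v} \<subseteq> V" using assms by simp
  ultimately have "card {w, v} \<le> 1"
    using independent_card_le_dim_finite(2)[OF assms(1,2)] assms(3) by metis
  moreover have "w \<noteq> v" using n scale_one[of v] by metis
  ultimately show False by simp
qed

end

section \<open>Currying a pairing along a dual\<close>

context tensor_category
begin

text \<open>When \<open>c\<close> is dual to \<open>z\<close>, this is the morphism from
  \<open>d\<close> to \<open>z\<close> that represents the pairing \<open>g\<close> on
  \<open>c \<otimes> d\<close>; the inverse sends \<open>f\<close> to
  \<open>e \<cdot> (idm c \<odot> f)\<close>.\<close>

definition curry_left :: "'o \<Rightarrow> 'o \<Rightarrow> 'm \<Rightarrow> 'o \<Rightarrow> 'm \<Rightarrow> 'm" where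
  "curry_left z c k d g = \<r> z \<cdot> ((idm z \<odot> g) \<cdot> (\<a> z c d \<cdot> ((k \<odot> idm d) \<cdot> linv d)))"

lemma bcurry_left: "(d, curry_left z c k d g, z)
    = brunit z \<circ>\<^sub>b (bid z \<otimes>\<^sub>b (c \<otimes> d, g, \<one>)) \<circ>\<^sub>b bassoc z c d \<circ>\<^sub>b ((\<one>, k, z \<otimes> c) \<otimes>\<^sub>b bid d) \<circ>\<^sub>b blunit' d"
  by (simp add: bdefs curry_left_def)

lemma curry_left:
  assumes "is_dual z c e k" and d [simp]: "d \<in> Obj"
  shows "mor g (c \<otimes> d) \<one> \<Longrightarrow> mor (curry_left z c k d g) d z"
    "mor g (c \<otimes> d) \<one> \<Longrightarrow> e \<cdot> (idm c \<odot> curry_left z c k d g) = g"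
    "mor f d z \<Longrightarrow> curry_left z c k d (e \<cdot> (idm c \<odot> f)) = f"
proof -
  have O [simp]: "z \<in> Obj" "c \<in> Obj" and M [simp]: "mor e (c \<otimes> z) \<one>" "mor k \<one> (z \<otimes> c)"
    and Z: "wh [z] (evhat z c e) [] \<circ>\<^sub>s wh [] (coevhat z c k) [z] = sid [z]"
      "wh [] (evhat z c e) [c] \<circ>\<^sub>s wh [c] (coevhat z c k) [] = sid [c]"
    using assms(1) by (auto simp: is_dual_iff)
  let ?e = "evhat z c e" and ?k = "coevhat z c k"
  show s: "mor (curry_left z c k d g) d z" if "mor g (c \<otimes> d) \<one>" for g
  proof -
    have "barr (d, curry_left z c k d g, z)" unfolding bcurry_left using that by simp
    then show ?thesis by (simp add: barr_def)
  qed
  have es: "emb (d, curry_left z c k d g, z) = wh [z] (evhat d c g) [] \<circ>\<^sub>s wh [] ?k [d]"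
    if "mor g (c \<otimes> d) \<one>" for g
    unfolding bcurry_left using that by (simp add: emb_ev)
  have ef: "evhat d c (e \<cdot> (idm c \<odot> f)) = ?e \<circ>\<^sub>s wh [c] (emb (d, f, z)) []" and mf: "mor (e \<cdot> (idm c \<odot> f)) (c \<otimes> d) \<one>"
    if f: "mor f d z" for f
  proof -
    have "(c \<otimes> d, e \<cdot> (idm c \<odot> f), \<one>) = (c \<otimes> z, e, \<one>) \<circ>\<^sub>b (bid c \<otimes>\<^sub>b (d, f, z))" by (simp add: bdefs)
    then show "evhat d c (e \<cdot> (idm c \<odot> f)) = ?e \<circ>\<^sub>s wh [c] (emb (d, f, z)) []"
      unfolding evhat_def[of d] using f by (simp add: emb_ev)
    show "mor (e \<cdot> (idm c \<odot> f)) (c \<otimes> d) \<one>" using mor_comp[OF M(1) mor_tens[OF mor_id[OF O(2)] f]] .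
  qed
  show "e \<cdot> (idm c \<odot> curry_left z c k d g) = g" if g: "mor g (c \<otimes> d) \<one>" for g
  proof -
    have "evhat d c (e \<cdot> (idm c \<odot> curry_left z c k d g))
        = (?e \<circ>\<^sub>s wh [c, z] (evhat d c g) []) \<circ>\<^sub>s wh [c] ?k [d]"
      using g by (simp add: ef[OF s[OF g]] es[OF g])
    also have "?e \<circ>\<^sub>s wh [c, z] (evhat d c g) [] = evhat d c g \<circ>\<^sub>s wh [] ?e [c, d]"
      using interchange[of ?e "evhat d c g" "[]" "[]" "[]"] g by simp
    also have "(evhat d c g \<circ>\<^sub>s wh [] ?e [c, d]) \<circ>\<^sub>s wh [c] ?k [d]
        = evhat d c g \<circ>\<^sub>s wh [] (wh [] ?e [c] \<circ>\<^sub>s wh [c] ?k []) [d]"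
      using g by simp
    also have "\<dots> = evhat d c g" unfolding Z using g by simp
    finally have "emb (c \<otimes> d, e \<cdot> (idm c \<odot> curry_left z c k d g), \<one>) = emb (c \<otimes> d, g, \<one>)"
      using g mf[OF s[OF g]] by (simp add: emb_ev)
    then have "(c \<otimes> d, e \<cdot> (idm c \<odot> curry_left z c k d g), \<one>) = (c \<otimes> d, g, \<one>)"
      by (rule emb_inject[rotated 4]) (use g mf[OF s[OF g]] in simp_all)
    then show ?thesis by simp
  qed
  show "curry_left z c k d (e \<cdot> (idm c \<odot> f)) = f" if f: "mor f d z" for f
  proof -
    have "emb (d, curry_left z c k d (e \<cdot> (idm c \<odot> f)), z)
        = wh [z] ?e [] \<circ>\<^sub>s (wh [z, c] (emb (d, f, z)) [] \<circ>\<^sub>s wh [] ?k [d])"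
      using f by (simp add: es[OF mf[OF f]] ef[OF f])
    also have "wh [z, c] (emb (d, f, z)) [] \<circ>\<^sub>s wh [] ?k [d] = wh [] ?k [z] \<circ>\<^sub>s emb (d, f, z)"
      using interchange[of ?k "emb (d, f, z)" "[]" "[]" "[]"] f by simp
    also have "wh [z] ?e [] \<circ>\<^sub>s wh [] ?k [z] \<circ>\<^sub>s emb (d, f, z) = (wh [z] ?e [] \<circ>\<^sub>s wh [] ?k [z]) \<circ>\<^sub>s emb (d, f, z)"
      using f by simp
    also have "\<dots> = emb (d, f, z)" unfolding Z using f by simp
    finally have "(d, curry_left z c k d (e \<cdot> (idm c \<odot> f)), z) = (d, f, z)"
      by (rule emb_inject[rotated 4]) (use f s[OF mf[OF f]] in simp_all)
    then show ?thesis by simp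
  qed
qed

end

section \<open>Frobenius structures from nondegenerate forms\<close>

context algebra_object
begin

text \<open>The copairing \<open>k\<close> of a nondegenerate invariant pairing \<open>e \<cdot> m\<close> gives the comultiplication
  \<open>(m \<otimes> A) \<cdot> (A \<otimes> k)\<close>.\<close>

lemma frobenius_if_self_dual:
  assumes e: "mor e A \<one>" and dual: "is_dual A A (e \<cdot> m) k"
  shows "\<exists>\<Delta>. frobenius_algebra C A m \<Delta> i e"
proof -
  have k [simp]: "mor k \<one> (A \<otimes> A)"
    and Z: "wh [A] (evhat A A (e \<cdot> m)) [] \<circ>\<^sub>s wh [] (coevhat A A k) [A] = sid [A]"
      "wh [] (evhat A A (e \<cdot> m)) [A] \<circ>\<^sub>s wh [A] (coevhat A A k) [] = sid [A]"
    using dual by (auto simp: is_dual_iff)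
  note [simp] = e
  define ehat where "ehat = unpunit \<circ>\<^sub>s emb (A, e, \<one>)"
  have eh [simp]: "sarr ehat" "sdom ehat = [A]" "scod ehat = []" by (simp_all add: ehat_def)
  have embe: "emb (A, e, \<one>) = punit \<circ>\<^sub>s ehat" by (simp add: ehat_def)
  let ?om = "coevhat A A k"
  have "(A \<otimes> A, e \<cdot> m, \<one>) = (A, e, \<one>) \<circ>\<^sub>b (A \<otimes> A, m, A)" by (simp add: bdefs)
  then have ev: "evhat A A (e \<cdot> m) = ehat \<circ>\<^sub>s mhat"
    unfolding evhat_def ehat_def by (simp add: emb_mi)
  have z1: "wh [A] ehat [] \<circ>\<^sub>s wh [A] mhat [] \<circ>\<^sub>s wh [] ?om [A] = sid [A]"
    and z2: "wh [] ehat [A] \<circ>\<^sub>s wh [] mhat [A] \<circ>\<^sub>s wh [A] ?om [] = sid [A]"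
    using Z unfolding ev by simp_all
  define dh where "dh = wh [] mhat [A] \<circ>\<^sub>s wh [A] ?om []"
  have dh [simp]: "sarr dh" "sdom dh = [A]" "scod dh = [A, A]" by (simp_all add: dh_def)
  have mom: "wh [] mhat [A, A] \<circ>\<^sub>s wh [A, A] ?om [] = wh [A] ?om [] \<circ>\<^sub>s mhat"
    using interchange[of mhat ?om "[]" "[]" "[]"] by simp
  have omm: "wh [] ?om [A] \<circ>\<^sub>s mhat = wh [A, A] mhat [] \<circ>\<^sub>s wh [] ?om [A, A]"
    using interchange[of ?om mhat "[]" "[]" "[]"] by simp
  have assoc: "wh k' mhat r \<circ>\<^sub>s wh (k' @ [A]) mhat r \<circ>\<^sub>s h = wh k' mhat r \<circ>\<^sub>s wh k' mhat (A # r) \<circ>\<^sub>s h"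
    if "set k' \<subseteq> Obj" "set r \<subseteq> Obj" "sarr h" "scod h = k' @ [A, A, A] @ r" for k' r h
    using arg_cong[OF mhat_wh(1)[OF that(1,2)], of "\<lambda>f. f \<circ>\<^sub>s h"] that by simp
  have frob1: "wh [] mhat [A] \<circ>\<^sub>s wh [A] dh [] = dh \<circ>\<^sub>s mhat"
  proof -
    have "wh [] mhat [A] \<circ>\<^sub>s wh [A] dh [] = wh [] mhat [A] \<circ>\<^sub>s (wh [] mhat [A, A] \<circ>\<^sub>s wh [A, A] ?om [])"
      using assoc[of "[]" "[A]" "wh [A, A] ?om []"] by (simp add: dh_def)
    also have "\<dots> = dh \<circ>\<^sub>s mhat" unfolding mom by (simp add: dh_def)
    finally show ?thesis .
  qed
  \<comment> \<open>The copairing may be multiplied from either side. The zig-zag \<open>z2\<close>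
    and \<open>frob1\<close> express \<open>mhat\<close> through \<open>dh\<close>; sliding the
    copairing past \<open>dh\<close> then lets \<open>z1\<close> contract it.\<close>
  have dh_alt: "dh = wh [A] mhat [] \<circ>\<^sub>s wh [] ?om [A]"
  proof -
    have "mhat = (wh [] ehat [A] \<circ>\<^sub>s wh [] mhat [A] \<circ>\<^sub>s wh [A] ?om []) \<circ>\<^sub>s mhat" unfolding z2 by simp
    also have "\<dots> = wh [] ehat [A] \<circ>\<^sub>s (dh \<circ>\<^sub>s mhat)" by (simp add: dh_def)
    also have "\<dots> = wh [] ehat [A] \<circ>\<^sub>s wh [] mhat [A] \<circ>\<^sub>s wh [A] dh []" unfolding frob1[symmetric] ..
    finally have "wh [A] mhat [] \<circ>\<^sub>s wh [] ?om [A]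
        = wh [A] (wh [] ehat [A] \<circ>\<^sub>s wh [] mhat [A] \<circ>\<^sub>s wh [A] dh []) [] \<circ>\<^sub>s wh [] ?om [A]" by simp
    also have "\<dots> = wh [A] ehat [A] \<circ>\<^sub>s wh [A] mhat [A] \<circ>\<^sub>s (wh [A, A] dh [] \<circ>\<^sub>s wh [] ?om [A])" by simp
    also have "wh [A, A] dh [] \<circ>\<^sub>s wh [] ?om [A] = wh [] ?om [A, A] \<circ>\<^sub>s dh"
      using interchange[of ?om dh "[]" "[]" "[]"] by simp
    also have "wh [A] ehat [A] \<circ>\<^sub>s wh [A] mhat [A] \<circ>\<^sub>s wh [] ?om [A, A] \<circ>\<^sub>s dh
        = wh [] (wh [A] ehat [] \<circ>\<^sub>s wh [A] mhat [] \<circ>\<^sub>s wh [] ?om [A]) [A] \<circ>\<^sub>s dh" by simp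
    also have "\<dots> = dh" unfolding z1 by simp
    finally show ?thesis by simp
  qed
  have frob2: "wh [A] mhat [] \<circ>\<^sub>s wh [] dh [A] = dh \<circ>\<^sub>s mhat"
  proof -
    have "wh [A] mhat [] \<circ>\<^sub>s wh [] dh [A] = wh [A] mhat [] \<circ>\<^sub>s wh [A] mhat [A] \<circ>\<^sub>s wh [] ?om [A, A]"
      unfolding dh_alt by simp
    also have "\<dots> = wh [A] mhat [] \<circ>\<^sub>s (wh [A, A] mhat [] \<circ>\<^sub>s wh [] ?om [A, A])"
      using assoc[of "[A]" "[]" "wh [] ?om [A, A]"] by simp
    also have "\<dots> = dh \<circ>\<^sub>s mhat" unfolding omm[symmetric] unfolding dh_alt by simp
    finally show ?thesis .
  qed
  have coassoc: "wh [] dh [A] \<circ>\<^sub>s dh = wh [A] dh [] \<circ>\<^sub>s dh"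
  proof -
    \<comment> \<open>Coassociativity on the copairing, where both sides multiply the inner factors
      of two copairings. Since \<open>dh\<close> is the copairing multiplied from the left,
      \<open>frob1\<close> and interchange extend this to \<open>A\<close>.\<close>
    have om2: "wh [] dh [A] \<circ>\<^sub>s ?om = wh [A] dh [] \<circ>\<^sub>s ?om"
    proof -
      have "wh [] ?om [A, A] \<circ>\<^sub>s ?om = wh [A, A] ?om [] \<circ>\<^sub>s ?om"
        using interchange[of ?om ?om "[]" "[]" "[]"] by simp
      then have "wh [A] mhat [A] \<circ>\<^sub>s wh [] ?om [A, A] \<circ>\<^sub>s ?om = wh [A] mhat [A] \<circ>\<^sub>s wh [A, A] ?om [] \<circ>\<^sub>s ?om"
        by simp
      moreover have "wh [] dh [A] = wh [A] mhat [A] \<circ>\<^sub>s wh [] ?om [A, A]" unfolding dh_alt by simp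
      moreover have "wh [A] dh [] = wh [A] mhat [A] \<circ>\<^sub>s wh [A, A] ?om []" unfolding dh_def by simp
      ultimately show ?thesis by simp
    qed
    have "wh [] dh [A] \<circ>\<^sub>s dh = wh [] (dh \<circ>\<^sub>s mhat) [A] \<circ>\<^sub>s wh [A] ?om []" by (simp add: dh_def)
    also have "\<dots> = wh [] mhat [A, A] \<circ>\<^sub>s wh [A] (wh [] dh [A] \<circ>\<^sub>s ?om) []"
      unfolding frob1[symmetric] by simp
    also have "\<dots> = (wh [] mhat [A, A] \<circ>\<^sub>s wh [A, A] dh []) \<circ>\<^sub>s wh [A] ?om []"
      unfolding om2 by simp
    also have "wh [] mhat [A, A] \<circ>\<^sub>s wh [A, A] dh [] = wh [A] dh [] \<circ>\<^sub>s wh [] mhat [A]"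
      using interchange[of mhat dh "[]" "[]" "[]"] by simp
    also have "(wh [A] dh [] \<circ>\<^sub>s wh [] mhat [A]) \<circ>\<^sub>s wh [A] ?om [] = wh [A] dh [] \<circ>\<^sub>s dh"
      unfolding dh_def[symmetric] by (subst sassoc) (simp_all add: dh_def)
    finally show ?thesis .
  qed
  define \<Delta> where "\<Delta> = (m \<odot> idm A) \<cdot> (assoc_inv A A A \<cdot> ((idm A \<odot> k) \<cdot> rinv A))"
  let ?M = "(A \<otimes> A, m, A)" and ?D = "(A, \<Delta>, A \<otimes> A)" and ?E = "(A, e, \<one>)"
  have bD: "?D = (?M \<otimes>\<^sub>b bid A) \<circ>\<^sub>b bassoc' A A A \<circ>\<^sub>b (bid A \<otimes>\<^sub>b (\<one>, k, A \<otimes> A)) \<circ>\<^sub>b brunit' A"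
    by (simp add: bdefs \<Delta>_def)
  have barrD [simp]: "barr ?D" unfolding bD by simp
  then have \<Delta>: "mor \<Delta> A (A \<otimes> A)" by (simp add: barr_def)
  have embD: "emb ?D = join A A \<circ>\<^sub>s dh" unfolding bD by (simp add: emb_mi emb_ev dh_def)
  have c1: "(bassoc A A A \<circ>\<^sub>b (?D \<otimes>\<^sub>b bid A)) \<circ>\<^sub>b ?D = (bid A \<otimes>\<^sub>b ?D) \<circ>\<^sub>b ?D"
    by (rule emb_inject) (use coassoc in \<open>simp_all add: embD\<close>)
  have c2: "(blunit A \<circ>\<^sub>b (?E \<otimes>\<^sub>b bid A)) \<circ>\<^sub>b ?D = bid A"
    by (rule emb_inject) (use z2 in \<open>simp_all add: embD embe dh_def\<close>)
  have c3: "(brunit A \<circ>\<^sub>b (bid A \<otimes>\<^sub>b ?E)) \<circ>\<^sub>b ?D = bid A"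
    by (rule emb_inject) (use z1 in \<open>simp_all add: embD embe dh_alt\<close>)
  have f1: "((?M \<otimes>\<^sub>b bid A) \<circ>\<^sub>b bassoc' A A A) \<circ>\<^sub>b (bid A \<otimes>\<^sub>b ?D) = ?D \<circ>\<^sub>b ?M"
  proof (rule emb_inject)
    have "emb (((?M \<otimes>\<^sub>b bid A) \<circ>\<^sub>b bassoc' A A A) \<circ>\<^sub>b (bid A \<otimes>\<^sub>b ?D))
        = join A A \<circ>\<^sub>s (wh [] mhat [A] \<circ>\<^sub>s wh [A] dh []) \<circ>\<^sub>s unjoin A A"
      by (simp add: embD emb_mi)
    also have "\<dots> = emb (?D \<circ>\<^sub>b ?M)" unfolding frob1 by (simp add: embD emb_mi)
    finally show "emb (((?M \<otimes>\<^sub>b bid A) \<circ>\<^sub>b bassoc' A A A) \<circ>\<^sub>b (bid A \<otimes>\<^sub>b ?D)) = emb (?D \<circ>\<^sub>b ?M)" .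
  qed simp_all
  have f2: "?D \<circ>\<^sub>b ?M = ((bid A \<otimes>\<^sub>b ?M) \<circ>\<^sub>b bassoc A A A) \<circ>\<^sub>b (?D \<otimes>\<^sub>b bid A)"
  proof (rule emb_inject)
    have "emb (((bid A \<otimes>\<^sub>b ?M) \<circ>\<^sub>b bassoc A A A) \<circ>\<^sub>b (?D \<otimes>\<^sub>b bid A))
        = join A A \<circ>\<^sub>s (wh [A] mhat [] \<circ>\<^sub>s wh [] dh [A]) \<circ>\<^sub>s unjoin A A"
      by (simp add: embD emb_mi)
    also have "\<dots> = emb (?D \<circ>\<^sub>b ?M)" unfolding frob2 by (simp add: embD emb_mi)
    finally show "emb (?D \<circ>\<^sub>b ?M) = emb (((bid A \<otimes>\<^sub>b ?M) \<circ>\<^sub>b bassoc A A A) \<circ>\<^sub>b (?D \<otimes>\<^sub>b bid A))" by simp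
  qed simp_all
  have "frobenius_algebra C A m \<Delta> i e"
  proof
    show "\<Delta> \<in> Hom A (A \<otimes> A)" "e \<in> Hom A \<one>" using \<Delta> e by (simp_all add: mor_def)
    show "\<a> A A A \<cdot> (\<Delta> \<odot> idm A) \<cdot> \<Delta> = (idm A \<odot> \<Delta>) \<cdot> \<Delta>" using c1 by (simp add: bdefs)
    show "\<l> A \<cdot> (e \<odot> idm A) \<cdot> \<Delta> = idm A" using c2 by (simp add: bdefs)
    show "\<r> A \<cdot> (idm A \<odot> e) \<cdot> \<Delta> = idm A" using c3 by (simp add: bdefs)
    show "(m \<odot> idm A) \<cdot> assoc_inv A A A \<cdot> (idm A \<odot> \<Delta>) = \<Delta> \<cdot> m" using f1 by (simp add: bdefs)
    show "\<Delta> \<cdot> m = (idm A \<odot> m) \<cdot> \<a> A A A \<cdot> (\<Delta> \<odot> idm A)" using f2 by (simp add: bdefs)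
  qed simp
  then show ?thesis by blast
qed

lemma self_module: "is_left_module A m"
  using mor_m mult_assoc mult_unit_left by (simp add: is_left_module_def mor_def)

text \<open>If \<open>i\<close> were zero, the right unit law would make \<open>\<r> A\<close> zero,
  hence \<open>idm A\<close> and with it all of \<open>Hom \<one> A\<close>.\<close>

lemma unit_nonzero:
  assumes "dim (Hom \<one> A) = 1"
  shows "i \<noteq> 0"
proof
  assume "i = 0"
  note r = mor_runit[OF A_Obj]
  have "\<r> A = 0"
    using mult_unit_right \<open>i = 0\<close> m_tens_zero_right[OF mor_id[OF A_Obj] unit_Obj A_Obj]
      m_zero(2)[OF mor_m, of "A \<otimes> \<one>"] by simp
  then have "idm A = 0" using r(4) m_zero(1)[OF r(2) A_Obj] by simp
  then have "Hom \<one> A \<subseteq> {0}"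
    using m_id(1)[of _ \<one> A] m_zero(1)[of _ \<one> A A] by (auto simp: mor_def)
  then have "dim (Hom \<one> A) \<le> card ({} :: 'm set)"
    by (intro dim_le_card) auto
  then show False using assms by simp
qed

text \<open>A module endomorphism of \<open>A\<close> is determined by its value
  \<open>q \<cdot> i\<close> on the unit, and connectedness makes that value a multiple of
  \<open>i\<close>.\<close>

lemma endomorphism_scalar:
  assumes "dim (Hom \<one> A) = 1" and q: "Mod.mor q (A, m) (A, m)"
  shows "\<exists>c. q = scale C c (idm A)"
proof -
  have q': "mor q A A" and qm: "q \<cdot> m = m \<cdot> T q" using q by (auto simp: Mod_mor)
  obtain B0 where B0: "finite B0" "span B0 = Hom \<one> A" using Hom_finite_dim[OF unit_Obj A_Obj] by metis
  obtain c where c: "q \<cdot> i = scale C c i"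
    using dim_one_scale[OF B0 assms(1) unit_in_Hom unit_nonzero[OF assms(1)] mor_Hom[OF mor_comp[OF q' mor_i]]]
    by metis
  note r = mor_runit[OF A_Obj]
  have "q \<cdot> \<r> A = m \<cdot> (T q \<cdot> T i)"
    using mult_unit_right m_ext[OF q' mor_m mor_m mor_T[OF q'] qm mor_T[OF mor_i]] by simp
  also have "\<dots> = scale C c (\<r> A)"
    using T_comp[OF q' mor_i] c m_tens_scale(2)[OF mor_id[OF A_Obj] mor_i, of c]
      m_scale(2)[OF mor_m mor_T[OF mor_i], of c] mult_unit_right by simp
  finally have "q \<cdot> \<r> A = scale C c (\<r> A)" .
  then have "q \<cdot> (\<r> A \<cdot> rinv A) = scale C c (\<r> A \<cdot> rinv A)"
    using m_assoc[OF q' r(1,2)] m_scale(1)[OF r(1,2)] by simp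
  then show ?thesis using r(4) m_id(2)[OF q'] by auto
qed

text \<open>The algebra is a simple module over itself, so the left ideal generated by the radical of the
  form is zero.\<close>

lemma form_nondegenerate:
  assumes dim: "dim (Hom \<one> A) = 1" and ss: "semisimple_category module_category"
    and e: "mor e A \<one>" "e \<noteq> 0" and p: "mor p c A" "(e \<cdot> m) \<cdot> T p = 0"
  shows "p = 0"
proof -
  interpret S: semisimple_category module_category by (rule ss)
  have c: "c \<in> Obj" using p by (simp add: mor_def)
  let ?f = "m \<cdot> T p"
  have f: "Mod.mor ?f (A \<otimes> c, fmult c) (A, m)" and fu: "?f \<cdot> funit c = p"
    using Mod_mor_free[OF self_module p(1)] by auto
  obtain g where g: "Mod.mor g (A, m) (A \<otimes> c, fmult c)" "?f \<cdot> (g \<cdot> ?f) = ?f"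
    using S.regular[OF f] by (auto simp: Mod.regular_def)
  have f': "mor ?f (A \<otimes> c) A" and g': "mor g A (A \<otimes> c)" using f g by (auto simp: Mod_mor)
  have fg: "mor (?f \<cdot> g) A A" using f' g' by (rule mor_comp)
  \<comment> \<open>\<open>?f \<cdot> g\<close> is a module endomorphism of \<open>A\<close>, hence
    a scalar. As \<open>e \<cdot> ?f = 0\<close> while \<open>e\<close> is nonzero, this scalar is
    zero, and then \<open>?f = (?f \<cdot> g) \<cdot> ?f\<close> vanishes.\<close>
  obtain a where a: "?f \<cdot> g = scale C a (idm A)"
    using endomorphism_scalar[OF dim Mod.mor_comp[OF f g(1)]] by auto
  have "scale C a e = e \<cdot> (?f \<cdot> g)"
    unfolding a using m_scale(2)[OF e(1) mor_id[OF A_Obj]] m_id(2)[OF e(1)] by simp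
  also have "\<dots> = (e \<cdot> ?f) \<cdot> g" using m_assoc[OF e(1) f' g'] by simp
  also have "e \<cdot> ?f = 0" using m_assoc[OF e(1) mor_m mor_T[OF p(1)]] p(2) by simp
  also have "0 \<cdot> g = 0" using m_zero(1)[OF g' unit_Obj] .
  finally have "a = 0" using e(2) by simp
  then have "?f \<cdot> g = 0" using a by simp
  then have "?f = 0" using g(2) m_assoc[OF f' g' f'] m_zero(1)[OF f' A_Obj] by simp
  then show ?thesis using fu m_zero(1)[OF mor_funit[OF c] A_Obj] by simp
qed

text \<open>The form \<open>e \<cdot> m\<close> is represented by a morphism \<open>\<phi>\<close>
  from \<open>A\<close> to an object \<open>z\<close> whose dual is \<open>A\<close>. Once
  \<open>\<phi>\<close> is invertible, the dual pair moves along it and makes \<open>A\<close> its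
  own dual with evaluation \<open>e \<cdot> m\<close>.\<close>

theorem frobenius_if_connected_semisimple:
  assumes C: "rigid_semisimple_tensor_category C" and dim: "dim (Hom \<one> A) = 1"
    and ss: "semisimple_category module_category"
  shows "\<exists>\<Delta> e. frobenius_algebra C A m \<Delta> i e"
proof -
  interpret R: rigid_semisimple_tensor_category C by (rule C)
  \<comment> \<open>Semisimplicity of \<open>C\<close> makes the unit \<open>i\<close> regular; as
    \<open>i\<close> is nonzero, its quasi-inverse is a nonzero functional on
    \<open>A\<close>.\<close>
  obtain e where e: "mor e A \<one>" "i \<cdot> (e \<cdot> i) = i"
    using R.regular[OF mor_i] by (auto simp: regular_def)
  have e0: "e \<noteq> 0"
  proof
    assume "e = 0"
    then have "i = 0" using e(2) m_zero(1)[OF mor_i unit_Obj] m_zero(2)[OF mor_i unit_Obj] by simp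
    then show False using unit_nonzero[OF dim] by simp
  qed
  have em: "mor (e \<cdot> m) (A \<otimes> A) \<one>" using e(1) mor_m by (rule mor_comp)
  obtain z v k where dual: "is_dual z A v k" using R.has_left_dual[OF A_Obj] by blast
  have z: "z \<in> Obj" and v: "mor v (A \<otimes> z) \<one>" and k: "mor k \<one> (z \<otimes> A)" using dual by (auto simp: is_dual_iff)
  define \<phi> where "\<phi> = curry_left z A k A (e \<cdot> m)"
  have \<phi>: "mor \<phi> A z" "v \<cdot> T \<phi> = e \<cdot> m"
    using curry_left(1,2)[OF dual A_Obj em] by (simp_all add: \<phi>_def)
  have \<phi>_mono: "p = 0" if p: "mor p c A" "\<phi> \<cdot> p = 0" for p c
  proof (rule form_nondegenerate[OF dim ss e(1) e0 p(1)])
    have c: "c \<in> Obj" using p by (simp add: mor_def)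
    have "(e \<cdot> m) \<cdot> T p = v \<cdot> T (\<phi> \<cdot> p)"
      using \<phi>(2) m_assoc[OF v mor_T[OF \<phi>(1)] mor_T[OF p(1)]] T_comp[OF \<phi>(1) p(1)] by simp
    then show "(e \<cdot> m) \<cdot> T p = 0"
      using p(2) m_tens_zero_right[OF mor_id[OF A_Obj] c z] m_zero(2)[OF v, of "A \<otimes> c"] c by simp
  qed
  obtain \<psi> where \<psi>: "mor \<psi> z A" "\<phi> \<cdot> (\<psi> \<cdot> \<phi>) = \<phi>"
    using R.regular[OF \<phi>(1)] by (auto simp: regular_def)
  have \<psi>\<phi>': "mor (\<psi> \<cdot> \<phi>) A A" using \<psi>(1) \<phi>(1) by (rule mor_comp)
  have "\<phi> \<cdot> (\<psi> \<cdot> \<phi> - idm A) = 0"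
    using m_diff(2)[OF \<phi>(1) \<psi>\<phi>' mor_id[OF A_Obj]] \<psi>(2) m_id(2)[OF \<phi>(1)] by simp
  then have \<psi>\<phi>: "\<psi> \<cdot> \<phi> = idm A"
    using \<phi>_mono[OF mor_diff[OF \<psi>\<phi>' mor_id[OF A_Obj]]] by simp
  let ?W = "assoc_inv A z A \<cdot> ((idm A \<odot> k) \<cdot> rinv A)"
  have W: "mor ?W A ((A \<otimes> z) \<otimes> A)"
    using mor_comp[OF mor_assoc(2) mor_comp[OF mor_tens[OF mor_id k] mor_runit(2)]] z by simp
  \<comment> \<open>Duality from endomorphisms of \<open>z\<close> to endomorphisms of
    \<open>A\<close>: pairing with \<open>v\<close> turns \<open>f\<close> into a morphism from
    \<open>A \<otimes> z\<close> to \<open>\<one>\<close>, and \<open>flat\<close> bends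
    \<open>z\<close> back up.\<close>
  let ?X = "\<lambda>f. \<l> A \<cdot> flat z A k A (v \<cdot> T f)"
  note l = mor_lunit[OF A_Obj]
  have vT: "mor (v \<cdot> T f) (A \<otimes> z) \<one>" if "mor f z z" for f using v mor_T[OF that] by (rule mor_comp)
  have flat: "mor (flat z A k A g) A (\<one> \<otimes> A)" if "mor g (A \<otimes> z) \<one>" for g
    using sharp_flat(2)[OF dual unit_Obj that A_Obj] .
  have X: "mor (?X f) A A" if "mor f z z" for f using l(1) flat[OF vT[OF that]] by (rule mor_comp)
  have X\<psi>: "mor (?X f \<cdot> \<psi>) z A" if "mor f z z" for f using X[OF that] \<psi>(1) by (rule mor_comp)
  have H: "mor f z z" if "f \<in> Hom z z" for f using that z by (simp add: mor_def)
  obtain B0 where B0: "finite B0" "span B0 = Hom z z" using Hom_finite_dim[OF z z] by metis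
  have flat_add: "flat z A k A (g + g') = flat z A k A g + flat z A k A g'"
    if "mor g (A \<otimes> z) \<one>" "mor g' (A \<otimes> z) \<one>" for g g'
  proof -
    have "(g + g') \<odot> idm A = g \<odot> idm A + g' \<odot> idm A"
      using tmor_add_left[OF mor_Obj[OF that(1)] A_Obj A_Obj mor_Hom[OF that(1)] mor_Hom[OF that(2)] id_in_Hom[OF A_Obj]] .
    then show ?thesis
      unfolding flat_def using m_add(1)[OF mor_tens mor_tens W] that mor_id[OF A_Obj] by simp
  qed
  have flat_scale: "flat z A k A (scale C c g) = scale C c (flat z A k A g)"
    if "mor g (A \<otimes> z) \<one>" for g c
    unfolding flat_def
    using m_tens_scale(1)[OF that mor_id[OF A_Obj]] m_scale(1)[OF mor_tens[OF that mor_id[OF A_Obj]] W] by simp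
  \<comment> \<open>Carrying \<open>?X f\<close> over to \<open>z\<close> by \<open>\<phi>\<close>
    and \<open>\<psi>\<close> is an injective linear endomorphism of the finite-dimensional space
    \<open>Hom z z\<close>, hence surjective; only the value \<open>idm z\<close> is wanted.\<close>
  have "(\<lambda>f. \<phi> \<cdot> (?X f \<cdot> \<psi>)) ` Hom z z = Hom z z"
  proof (rule injective_endo_surjective[OF B0])
    fix f g c assume f: "f \<in> Hom z z"
    note f' = H[OF f]
    show "\<phi> \<cdot> (?X f \<cdot> \<psi>) \<in> Hom z z" using mor_Hom[OF mor_comp[OF \<phi>(1) X\<psi>[OF f']]] .
    have "v \<cdot> T (scale C c f) = scale C c (v \<cdot> T f)"
      using m_tens_scale(2)[OF mor_id[OF A_Obj] f'] m_scale(2)[OF v mor_T[OF f']] by simp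
    then have "?X (scale C c f) = scale C c (?X f)"
      using flat_scale[OF vT[OF f']] m_scale(2)[OF l(1) flat[OF vT[OF f']]] by simp
    then show "\<phi> \<cdot> (?X (scale C c f) \<cdot> \<psi>) = scale C c (\<phi> \<cdot> (?X f \<cdot> \<psi>))"
      using m_scale(1)[OF X[OF f'] \<psi>(1)] m_scale(2)[OF \<phi>(1) X\<psi>[OF f']] by simp
    show "f = 0" if zero: "\<phi> \<cdot> (?X f \<cdot> \<psi>) = 0"
    proof -
      have "?X f \<cdot> \<psi> = 0" using \<phi>_mono[OF X\<psi>[OF f'] zero] .
      then have "?X f = 0"
        using m_assoc[OF X[OF f'] \<psi>(1) \<phi>(1)] \<psi>\<phi> m_id(2)[OF X[OF f']] m_zero(1)[OF \<phi>(1) A_Obj] by simp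
      then have "flat z A k A (v \<cdot> T f) = 0"
        using m_assoc[OF l(2,1) flat[OF vT[OF f']]] l(3) m_id(1)[OF flat[OF vT[OF f']]]
          m_zero(2)[OF l(2) A_Obj] by simp
      also have "0 = flat z A k A 0"
        using flat_scale[OF mor_zero[of "A \<otimes> z" \<one>], of 0] z by simp
      finally have "v \<cdot> T f = 0"
        using sharp_flat(4)[OF dual unit_Obj vT[OF f'] A_Obj]
          sharp_flat(4)[OF dual unit_Obj mor_zero[of "A \<otimes> z" \<one>] A_Obj] z by simp
      also have "0 = v \<cdot> T 0" using m_tens_zero_right[OF mor_id[OF A_Obj] z z] m_zero(2)[OF v, of "A \<otimes> z"] z by simp
      finally show "f = 0"
        using curry_left(3)[OF dual z f'] curry_left(3)[OF dual z mor_zero[OF z z]] by simp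
    qed
    assume g: "g \<in> Hom z z"
    note g' = H[OF g]
    have "v \<cdot> T (f + g) = v \<cdot> T f + v \<cdot> T g"
      using tmor_add_right[OF A_Obj A_Obj z z id_in_Hom[OF A_Obj] f g] m_add(2)[OF v mor_T[OF f'] mor_T[OF g']] by simp
    then have "?X (f + g) = ?X f + ?X g"
      using flat_add[OF vT[OF f'] vT[OF g']] m_add(2)[OF l(1) flat[OF vT[OF f']] flat[OF vT[OF g']]] by simp
    then show "\<phi> \<cdot> (?X (f + g) \<cdot> \<psi>) = \<phi> \<cdot> (?X f \<cdot> \<psi>) + \<phi> \<cdot> (?X g \<cdot> \<psi>)"
      using m_add(1)[OF X[OF f'] X[OF g'] \<psi>(1)] m_add(2)[OF \<phi>(1) X\<psi>[OF f'] X\<psi>[OF g']] by simp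
  qed
  then obtain f where f: "f \<in> Hom z z" "\<phi> \<cdot> (?X f \<cdot> \<psi>) = idm z" using id_in_Hom[OF z] by (metis (no_types, lifting) imageE)
  \<comment> \<open>\<open>\<phi> \<cdot> \<psi>\<close> fixes every morphism of the form
    \<open>\<phi> \<cdot> u\<close>, and \<open>idm z\<close> has just been written in this
    form.\<close>
  have \<phi>\<psi>: "\<phi> \<cdot> \<psi> = idm z"
  proof -
    note Y = X\<psi>[OF H[OF f(1)]]
    have "\<phi> \<cdot> \<psi> = (\<phi> \<cdot> \<psi>) \<cdot> (\<phi> \<cdot> (?X f \<cdot> \<psi>))" using f(2) m_id(2)[OF mor_comp[OF \<phi>(1) \<psi>(1)]] by simp
    also have "\<dots> = \<phi> \<cdot> ((\<psi> \<cdot> \<phi>) \<cdot> (?X f \<cdot> \<psi>))"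
      using m_assoc[OF \<phi>(1) \<psi>(1) mor_comp[OF \<phi>(1) Y]] m_assoc[OF \<psi>(1) \<phi>(1) Y] by simp
    also have "\<dots> = idm z" using \<psi>\<phi> m_id(1)[OF Y] f(2) by simp
    finally show ?thesis .
  qed
  \<comment> \<open>By the choice of \<open>\<phi>\<close>, the transported evaluation is
    \<open>e \<cdot> m\<close>.\<close>
  have "is_dual A A (v \<cdot> (idm A \<odot> \<phi>)) ((\<psi> \<odot> idm A) \<cdot> k)"
    using is_dual_transport[OF dual \<phi>(1) \<psi>(1) \<psi>\<phi> \<phi>\<psi> mor_id[OF A_Obj] mor_id[OF A_Obj]] m_id(1)[OF mor_id[OF A_Obj]]
    by simp
  then show ?thesis using frobenius_if_self_dual[OF e(1)] \<phi>(2) by metis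
qed

end

theorem corollary5p3:
  fixes C :: "('k::field, 'o, 'm::ab_group_add) tensor_cat"
    and M :: "('k, 'p, 'n::ab_group_add) tensor_cat"
    and \<Phi> :: "('o, 'm, 'p, 'n) tensor_functor_data"
    and Tr :: "('p, 'n, 'o, 'm) linear_functor_data"
    and \<eta> :: "'o \<Rightarrow> 'm" and \<epsilon> :: "'p \<Rightarrow> 'n"
    and A :: 'p and m \<Delta> i e :: 'n
  assumes "rigid_semisimple_tensor_category C"
    and "rigid_semisimple_tensor_category M"
    and "tensor_functor_right_adjoint C M \<Phi> Tr \<eta> \<epsilon>"
    and "frobenius_algebra M A m \<Delta> i e"
    and "connected_algebra M A m i"
    and "semisimple_algebra M A m i"
  shows "let
      TA = fobj Tr A;
      mT = tensor_functor_right_adjoint.tr_mult C M \<Phi> Tr \<epsilon> A m;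
      iT = tensor_functor_right_adjoint.tr_unit C M \<Phi> Tr \<eta> i
    in connected_algebra C TA mT iT \<and> semisimple_algebra C TA mT iT \<and>
       (\<exists>\<Delta>T eT. frobenius_algebra C TA mT \<Delta>T iT eT)"
proof -
  interpret tensor_functor_right_adjoint C M \<Phi> Tr \<eta> \<epsilon> by (rule assms(3))
  interpret S: semisimple_algebra M A m i by (rule assms(6))
  interpret right_adjoint_algebra C M \<Phi> Tr \<eta> \<epsilon> A m i ..
  interpret R: rigid_semisimple_tensor_category C by (rule assms(1))
  have dim: "C.dim (Hom\<^bsub>C\<^esub> \<one>\<^bsub>C\<^esub> TA) = 1"
    using dim_Hom_unit connected_algebra.connected[OF assms(5)] by simp
  have ss: "semisimple_category T.module_category"
  proof (rule T.semisimple_if_kleisli_regular)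
    show "semisimple_category C" ..
    \<comment> \<open>Semisimplicity of the \<open>A\<close>-modules enters as regularity of Kleisli
      morphisms of \<open>A\<close>; rigidity of \<open>C\<close> provides the dual pairs for the
      projection formula.\<close>
    show "T.kleisli_regular c b h" if "b \<in> Obj\<^bsub>C\<^esub>" "C.mor h c (TA \<otimes>\<^bsub>C\<^esub> b)" for c b h
      using S.kleisli_regular_if_semisimple[OF S.semisimple_modules] R.rigid_tensor_category_axioms that
      by (rule tr_kleisli_regular)
  qed
  have "connected_algebra C TA mT iT"
    by (intro connected_algebra.intro connected_algebra_axioms.intro tr_algebra dim)
  moreover have "semisimple_algebra C TA mT iT"
    by (intro semisimple_algebra.intro semisimple_algebra_axioms.intro tr_algebra ss)
  moreover have "\<exists>\<Delta>T eT. frobenius_algebra C TA mT \<Delta>T iT eT"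
    by (rule T.frobenius_if_connected_semisimple[OF assms(1) dim ss])
  ultimately show ?thesis by (simp add: Let_def)
qed

end
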